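(* Assume that $f$ and $g$ satisfy: (A$_1$) $f\in C^4(\mathbb{R})$; (A$_2$) $g\in C^3(\mathbb{R})$, $g(0)=g(1)=0$, $g'(0)>0$, $g'(1)<0$, $g(u)>0$ for all $u\in(0,1)$, and $g(u)<0$ for all $u\in(-\infty,0)$; (A$_3$) there exists $u_*\in(-\infty,0)$ such that $\int_{u_*}^0 g(s)\,ds+\int_0^1 g(s)\,ds=0$; (A$_4$) $\overline{a}_0 := f'''(0) - \dfrac{f''(0)g''(0)}{\sqrt{g'(0)}}\neq 0$. Let $\epsilon_0>0$ and let $u(x,t)=\varphi^\epsilon(x-c(\epsilon)t)$, $0<\epsilon<\epsilon_0$, be the family of small-amplitude periodic traveling wave solutions of $$u_t+f(u)_x=u_{xx}+g(u)$$ described in the context, with fundamental periods $L_\epsilon$. Then there exists $\bar\epsilon_0\in(0,\epsilon_0)$ sufficiently small such that each periodic wave $u(x,t)=\varphi^\epsilon(x-c(\epsilon)t)$ with $\epsilon\in(0,\bar\epsilon_0)$ is orbitally unstable in the periodic space $H^2_{\mathrm{per}}([0,L_\epsilon])$ under the flow of the equation.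
   Context: For $L>0$ and $s\in\mathbb{R}$, $H^s_{\mathrm{per}}([0,L])$ is the Sobolev space of $L$-periodic distributions $u$ with $\|u\|_s^2 := L\sum_{k\in\mathbb{Z}}(1+|k|^2)^s|\widehat u(k)|^2<\infty$. The family of small-amplitude waves (a known existence result, obtained from a local Hopf bifurcation): under (A$_1$)–(A$_4$), with $c_0:=f'(0)$, there is $\epsilon_0>0$ sufficiently small such that for each $0<\epsilon<\epsilon_0$ there exists a unique (up to translations) periodic traveling wave solution $u(x,t)=\varphi^\epsilon(x-c(\epsilon)t)$ of $u_t+f(u)_x=u_{xx}+g(u)$ with speed $c(\epsilon)=c_0+\epsilon$ if $\overline a_0>0$, or $c(\epsilon)=c_0-\epsilon$ if $\overline a_0<0$, and with fundamental period $L_\epsilon=\frac{2\pi}{\sqrt{g'(0)}}+O(\epsilon)$ as $\epsilon\to0^+$; the profile $\varphi^\epsilon$ is of class $C^3(\mathbb{R})$, is $L_\epsilon$-periodic, and satisfies $|\varphi^\epsilon(x)|,|(\varphi^\epsilon)'(x)|\le C\sqrt{\epsilon}$ for all $x\in\mathbb{R}$ with a uniform constant $C>0$. Orbital (in)stability: with $X=H^2_{\mathrm{per}}([0,L])$, $L$ the fundamental period of the wave, a traveling wave $\varphi\in X$ is orbitally stable in $X$ by the flow of the equation if for each $\varepsilon>0$ there exists $\delta>0$ such that whenever $\psi\in X$ satisfies $\inf_{r\in\mathbb{R}}\|\psi(\cdot)-\varphi(\cdot+r)\|_X<\delta$, the solution $u(x,t)$ with initial condition $u(0)=\psi$ exists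 globally in time and satisfies $\sup_{t>0}\inf_{r\in\mathbb{R}}\|u(\cdot,t)-\varphi(\cdot+r)\|_X<\varepsilon$. Otherwise $\varphi$ is orbitally unstable in $X$. Solutions with data in $H^2_{\mathrm{per}}([0,L])$ are the unique local solutions in $C([0,T];H^2_{\mathrm{per}}([0,L]))\cap C^1((0,T];L^2_{\mathrm{per}}([0,L]))$. *)

theory Defs
  imports "HOL-Analysis.Analysis" "HOL-Library.Landau_Symbols"
begin

definition Ck :: "nat \<Rightarrow> (real \<Rightarrow> real) \<Rightarrow> bool" where
  "Ck n h \<longleftrightarrow>
     (\<forall>i<n. \<forall>x. (deriv ^^ i) h differentiable (at x)) \<and>
     continuous_on UNIV ((deriv ^^ n) h)"

definition periodic :: "real \<Rightarrow> (real \<Rightarrow> real) \<Rightarrow> bool" where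
  "periodic L u \<longleftrightarrow> (\<forall>x. u (x + L) = u x)"

definition fundamental_period :: "real \<Rightarrow> (real \<Rightarrow> real) \<Rightarrow> bool" where
  "fundamental_period L u \<longleftrightarrow>
     0 < L \<and> periodic L u \<and> (\<forall>P. 0 < P \<and> P < L \<longrightarrow> \<not> periodic P u)"


section \<open>Periodic Sobolev spaces\<close>

text \<open>
  Since \<open>f\<close> and \<open>g\<close> act on real numbers, all spaces consist of real-valued functions.  Elements are
  represented by Borel functions on the line; functions that agree almost everywhere represent the
  same element, so the norms below are seminorms on representatives.
\<close>

definition L2_per :: "real \<Rightarrow> (real \<Rightarrow> real) set" where
  "L2_per L =
     {u. u \<in> borel_measurable borel \<and> periodic L u \<and>
         set_integrable lborel {0..L} (\<lambda>x. (u x)\<^sup>2)}"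

definition L2_norm :: "real \<Rightarrow> (real \<Rightarrow> real) \<Rightarrow> real" where
  "L2_norm L u = sqrt (LINT x:{0..L}|lborel. (u x)\<^sup>2)"

definition fourier_coeff :: "real \<Rightarrow> (real \<Rightarrow> real) \<Rightarrow> int \<Rightarrow> complex" where
  "fourier_coeff L u k =
     (LINT x:{0..L}|lborel. complex_of_real (u x) * cis (- (2 * pi * of_int k * x / L)))
       / complex_of_real L"

text \<open>
  For \<open>s \<ge> 0\<close> every periodic distribution of finite \<open>H\<^sup>s\<close> norm is a square-integrable function, so
  the following is the full Sobolev space in that range; only \<open>s = 2\<close> is used.
\<close>

definition Hs_per :: "real \<Rightarrow> real \<Rightarrow> (real \<Rightarrow> real) set" where
  "Hs_per s L =
     {u \<in> L2_per L.
        (\<lambda>k::int. (1 + (real_of_int k)\<^sup>2) powr s * (cmod (fourier_coeff L u k))\<^sup>2) summable_on UNIV}"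

definition Hs_norm :: "real \<Rightarrow> real \<Rightarrow> (real \<Rightarrow> real) \<Rightarrow> real" where
  "Hs_norm s L u =
     sqrt (L * (\<Sum>\<^sub>\<infinity>k::int. (1 + (real_of_int k)\<^sup>2) powr s * (cmod (fourier_coeff L u k))\<^sup>2))"

text \<open>Distributional derivative, with smooth \<open>L\<close>-periodic test functions.\<close>

definition weak_deriv_per :: "real \<Rightarrow> (real \<Rightarrow> real) \<Rightarrow> (real \<Rightarrow> real) \<Rightarrow> bool" where
  "weak_deriv_per L u v \<longleftrightarrow>
     u \<in> L2_per L \<and> v \<in> L2_per L \<and>
     (\<forall>h. (\<forall>n. Ck n h) \<and> periodic L h \<longrightarrow>
        (LINT x:{0..L}|lborel. u x * deriv h x) = - (LINT x:{0..L}|lborel. v x * h x))"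


section \<open>The equation \<open>u\<^sub>t + f(u)\<^sub>x = u\<^sub>x\<^sub>x + g(u)\<close>\<close>

text \<open>
  \<open>u t\<close> is the spatial profile at time \<open>t\<close>.  A solution on \<open>[0,T]\<close> lies in
  \<open>C([0,T]; H\<^sup>2) \<inter> C\<^sup>1((0,T]; L\<^sup>2)\<close>, \<open>v\<close> being its time derivative in \<open>L\<^sup>2\<close>; the equation is an identity
  in \<open>L\<^sup>2\<close> for every \<open>t \<in> (0,T]\<close>.
\<close>

definition solution_on ::
  "(real \<Rightarrow> real) \<Rightarrow> (real \<Rightarrow> real) \<Rightarrow> real \<Rightarrow> real \<Rightarrow> (real \<Rightarrow> real \<Rightarrow> real) \<Rightarrow> bool" where
  "solution_on f g L T u \<longleftrightarrow>
     (\<forall>t\<in>{0..T}. u t \<in> Hs_per 2 L \<and>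
        ((\<lambda>s. Hs_norm 2 L (\<lambda>x. u s x - u t x)) \<longlongrightarrow> 0) (at t within {0..T})) \<and>
     (\<exists>v. \<forall>t\<in>{0<..T}. v t \<in> L2_per L \<and>
        ((\<lambda>s. L2_norm L (\<lambda>x. (u s x - u t x) / (s - t) - v t x)) \<longlongrightarrow> 0) (at t within {0<..T}) \<and>
        ((\<lambda>s. L2_norm L (\<lambda>x. v s x - v t x)) \<longlongrightarrow> 0) (at t within {0<..T}) \<and>
        (\<exists>ux uxx fx.
           weak_deriv_per L (u t) ux \<and> weak_deriv_per L ux uxx \<and>
           weak_deriv_per L (\<lambda>x. f (u t x)) fx \<and>
           (AE x in lborel. v t x + fx x = uxx x + g (u t x))))"

definition global_solution ::
  "(real \<Rightarrow> real) \<Rightarrow> (real \<Rightarrow> real) \<Rightarrow> real \<Rightarrow> (real \<Rightarrow> real) \<Rightarrow> (real \<Rightarrow> real \<Rightarrow> real) \<Rightarrow> bool" where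
  "global_solution f g L \<psi> u \<longleftrightarrow>
     (\<forall>T>0. solution_on f g L T u) \<and> (AE x in lborel. u 0 x = \<psi> x)"


section \<open>Orbital stability\<close>

definition orbit_dist :: "real \<Rightarrow> (real \<Rightarrow> real) \<Rightarrow> (real \<Rightarrow> real) \<Rightarrow> real" where
  "orbit_dist L \<phi> w = (INF r. Hs_norm 2 L (\<lambda>x. w x - \<phi> (x + r)))"

text \<open>The supremum is taken in the extended reals because it may be infinite.\<close>

definition orbitally_stable ::
  "(real \<Rightarrow> real) \<Rightarrow> (real \<Rightarrow> real) \<Rightarrow> real \<Rightarrow> (real \<Rightarrow> real) \<Rightarrow> bool" where
  "orbitally_stable f g L \<phi> \<longleftrightarrow>
     (\<forall>e>0. \<exists>d>0. \<forall>\<psi>\<in>Hs_per 2 L. orbit_dist L \<phi> \<psi> < d \<longrightarrow>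
        (\<exists>u. global_solution f g L \<psi> u \<and>
             (SUP t\<in>{0<..}. ereal (orbit_dist L \<phi> (u t))) < ereal e))"

definition orbitally_unstable ::
  "(real \<Rightarrow> real) \<Rightarrow> (real \<Rightarrow> real) \<Rightarrow> real \<Rightarrow> (real \<Rightarrow> real) \<Rightarrow> bool" where
  "orbitally_unstable f g L \<phi> \<longleftrightarrow> \<not> orbitally_stable f g L \<phi>"


section \<open>Small-amplitude periodic traveling waves\<close>

text \<open>Pointwise solutions, written \<open>u x t\<close>; meaningful for sufficiently differentiable \<open>u\<close>.\<close>

definition classical_solution ::
  "(real \<Rightarrow> real) \<Rightarrow> (real \<Rightarrow> real) \<Rightarrow> (real \<Rightarrow> real \<Rightarrow> real) \<Rightarrow> bool" where
  "classical_solution f g u \<longleftrightarrow>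
     (\<forall>x t. deriv (\<lambda>\<tau>. u x \<tau>) t + deriv (\<lambda>y. f (u y t)) x
            = (deriv ^^ 2) (\<lambda>y. u y t) x + g (u x t))"

definition a0_bar :: "(real \<Rightarrow> real) \<Rightarrow> (real \<Rightarrow> real) \<Rightarrow> real" where
  "a0_bar f g =
     (deriv ^^ 3) f 0 - (deriv ^^ 2) f 0 * (deriv ^^ 2) g 0 / sqrt (deriv g 0)"

text \<open>
  The Hopf branch of waves, for \<open>0 < \<epsilon> < \<epsilon>\<^sub>0\<close>: profile \<open>\<phi> \<epsilon>\<close>, speed \<open>c \<epsilon>\<close>, fundamental period \<open>L \<epsilon>\<close>.
  The branch is unique up to translations, but uniqueness is not among the conditions.
\<close>

definition small_amplitude_waves ::
  "(real \<Rightarrow> real) \<Rightarrow> (real \<Rightarrow> real) \<Rightarrow> real \<Rightarrow>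
   (real \<Rightarrow> real \<Rightarrow> real) \<Rightarrow> (real \<Rightarrow> real) \<Rightarrow> (real \<Rightarrow> real) \<Rightarrow> bool" where
  "small_amplitude_waves f g \<epsilon>\<^sub>0 \<phi> c L \<longleftrightarrow>
     (\<forall>\<epsilon>. 0 < \<epsilon> \<and> \<epsilon> < \<epsilon>\<^sub>0 \<longrightarrow>
        Ck 3 (\<phi> \<epsilon>) \<and>
        fundamental_period (L \<epsilon>) (\<phi> \<epsilon>) \<and>
        classical_solution f g (\<lambda>x t. \<phi> \<epsilon> (x - c \<epsilon> * t)) \<and>
        (a0_bar f g > 0 \<longrightarrow> c \<epsilon> = deriv f 0 + \<epsilon>) \<and>
        (a0_bar f g < 0 \<longrightarrow> c \<epsilon> = deriv f 0 - \<epsilon>)) \<and>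
     (\<lambda>\<epsilon>. L \<epsilon> - 2 * pi / sqrt (deriv g 0)) \<in> O[at_right 0](\<lambda>\<epsilon>. \<epsilon>) \<and>
     (\<exists>C>0. \<forall>\<epsilon> x. 0 < \<epsilon> \<and> \<epsilon> < \<epsilon>\<^sub>0 \<longrightarrow>
        \<bar>\<phi> \<epsilon> x\<bar> \<le> C * sqrt \<epsilon> \<and> \<bar>deriv (\<phi> \<epsilon>) x\<bar> \<le> C * sqrt \<epsilon>)"

end

theory Submission
  imports Defs
begin

text \<open>
  Start at \<open>\<psi> = \<phi> + \<delta>\<close> and put \<open>w t x = u t x - \<phi> (x - c t)\<close>.  As long as \<open>u\<close> and \<open>\<phi>\<close> are small, \<open>w\<close>
  solves a small perturbation of the linear equation \<open>w\<^sub>t + f'(0) w\<^sub>x = w\<^sub>x\<^sub>x + g'(0) w\<close>, whose constant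
  mode grows faster than every other mode, with a gap controlled by the Poincare inequality.
  Decompose \<open>w\<close> into its mean and the rest and let \<open>V\<close> be the squared \<open>L\<^sup>2\<close> norm of the former minus that of
  the latter, that is \<open>V = 2 (\<integral>w)\<^sup>2 / L - \<integral>w\<^sup>2\<close>.  The gap gives \<open>V' \<ge> r V\<close> with \<open>r > 0\<close>, whatever the
  sign of \<open>V\<close>, and \<open>V 0 = L \<delta>\<^sup>2 > 0\<close>, so \<open>V\<close> is unbounded.  On the other hand \<open>V \<le> \<integral>w\<^sup>2\<close> stays bounded near
  the orbit of \<open>\<phi>\<close>, since the \<open>H\<^sup>2\<close> norm controls the supremum.  The supremum bound, the integrations by
  parts and the Poincare inequality are all read off the Fourier series, which converges absolutely
  for \<open>H\<^sup>2\<close> functions.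
\<close>

section \<open>Completeness of the characters\<close>

text \<open>Let \<open>\<kappa>\<close> bound the deviation of \<open>f'\<close> and
  \<open>g'\<close> from their values at 0 on the range of \<open>u\<close> and
  \<open>\<phi>\<close>, and let \<eta> be \<open>6 * \<kappa> + \<kappa>\<^sup>2\<close>. The
  errors in the derivative of \<open>V\<close> are at most \<eta> times the squared norm of
  \<open>w\<close>: \<open>4 * \<kappa>\<close> from the mean, \<open>2 * \<kappa>\<close> from the
  reaction in the energy, \<open>\<kappa>\<^sup>2\<close> from the flux, which also uses up half of
  the dissipation. If the other half dominates 2 \<eta> times the mean-free part, gain and loss add
  up to exactly -\<eta> \<open>V\<close>. The resulting inequality is linear in \<open>V\<close>, so
  no cone has to be shown invariant.

  Stability keeps \<open>u\<close> near some uncontrolled translate, whereas \<open>w\<close> is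
  taken relative to the moving wave. No phase has to be tracked: both the growth estimate and the
  upper bound on \<open>V\<close> use only that \<open>u\<close> and \<open>\<phi>\<close> are
  small.

  The \<open>H^2\<close> norm is defined by Fourier coefficients, and weak derivatives by smooth
  test functions, while \<open>w\<close> itself is not smooth. Hence the identities are compared
  coefficient by coefficient, which requires that the coefficients determine a function almost
  everywhere.\<close>

abbreviation per_measure :: "real \<Rightarrow> real measure" where
  "per_measure L \<equiv> restrict_space lborel {0..L}"

definition character :: "real \<Rightarrow> int \<Rightarrow> real \<Rightarrow> complex" where
  "character L k x = cis (2 * pi * of_int k * x / L)"

lemma norm_character [simp]: "norm (character L k x) = 1"
  by (simp add: character_def)

lemma character_0 [simp]: "character L 0 x = 1"
  by (simp add: character_def)

lemma character_uminus: "character L (- k) x = cnj (character L k x)"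
  by (simp add: character_def cis_cnj)

lemma set_integral_eq_per_measure:
  fixes h :: "real \<Rightarrow> 'a::{banach, second_countable_topology}"
  shows "(LINT x:{0..L}|lborel. h x) = (\<integral>x. h x \<partial>per_measure L)"
  by (simp add: set_lebesgue_integral_def integral_restrict_space)

lemma set_integrable_iff_per_measure:
  fixes h :: "real \<Rightarrow> 'a::{banach, second_countable_topology}"
  shows "set_integrable lborel {0..L} h \<longleftrightarrow> integrable (per_measure L) h"
  by (simp add: set_integrable_def integrable_restrict_space)

lemma finite_per_measure: "finite_measure (per_measure L)"
  by (rule finite_measureI)
     (simp add: space_restrict_space emeasure_restrict_space emeasure_lborel_Icc_eq)

lemma measure_per_measure:
  "0 \<le> L \<Longrightarrow> measure (per_measure L) (space (per_measure L)) = L"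
  by (simp add: space_restrict_space measure_restrict_space)

lemma AE_per_measure: "(AE x in lborel. P x) \<Longrightarrow> AE x in per_measure L. P x"
  by (subst AE_restrict_space_iff) (auto elim: eventually_mono)

lemma borel_measurable_per_measure:
  "h \<in> borel_measurable borel \<Longrightarrow> h \<in> borel_measurable (per_measure L)"
  by (rule measurable_restrict_space1) simp

lemma integrable_per_measure_bounded:
  fixes h :: "real \<Rightarrow> 'a::{banach, second_countable_topology}"
  assumes "h \<in> borel_measurable (per_measure L)" "AE x in per_measure L. norm (h x) \<le> B"
  shows "integrable (per_measure L) h"
  using finite_measure.integrable_const_bound[OF finite_per_measure] assms by blast

lemma integrable_per_measure_continuous:
  fixes h :: "real \<Rightarrow> 'a::{banach, second_countable_topology}"
  assumes "continuous_on UNIV h"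
  shows "integrable (per_measure L) h"
proof -
  have "set_integrable lborel {0..L} h"
    unfolding set_integrable_def
    by (rule borel_integrable_compact) (auto intro: continuous_on_subset[OF assms])
  then show ?thesis by (simp add: set_integrable_iff_per_measure)
qed

lemma integrable_mult_bounded:
  fixes h F :: "'a \<Rightarrow> complex"
  assumes "integrable M h" "F \<in> borel_measurable M" "\<And>x. x \<in> space M \<Longrightarrow> norm (F x) \<le> B"
  shows "integrable M (\<lambda>x. h x * F x)"
proof (rule Bochner_Integration.integrable_bound)
  show "integrable M (\<lambda>x. B * norm (h x))" using assms(1) by simp
  show "(\<lambda>x. h x * F x) \<in> borel_measurable M" using assms(1,2) by measurable
  show "AE x in M. norm (h x * F x) \<le> norm (B * norm (h x))"
  proof (rule AE_I2)
    fix x assume "x \<in> space M"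
    have "norm (h x * F x) \<le> B * norm (h x)"
      unfolding norm_mult using assms(3)[OF \<open>x \<in> space M\<close>]
      by (simp add: mult.commute mult_right_mono)
    then show "norm (h x * F x) \<le> norm (B * norm (h x))" by simp
  qed
qed

lemma continuous_character: "continuous_on UNIV (character L k)"
  unfolding character_def by (cases "L = 0") (auto intro!: continuous_intros)

lemma character_measurable: "character L k \<in> borel_measurable (per_measure L)"
  by (intro borel_measurable_per_measure borel_measurable_continuous_onI continuous_character)

lemma character_mult: "character L j x * character L k x = character L (j + k) x"
  by (simp add: character_def cis_mult ring_distribs add_divide_distrib)

lemma continuous_on_of_real_character:
  fixes F :: "complex \<Rightarrow> real"
  assumes "continuous_on UNIV F"
  shows "continuous_on UNIV (\<lambda>x. complex_of_real (F (character L 1 x)))"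
proof (rule continuous_on_of_real)
  show "continuous_on UNIV (\<lambda>x. F (character L 1 x))"
    by (rule continuous_on_compose2[OF assms continuous_character]) simp
qed

lemma measurable_of_real_character:
  fixes F :: "complex \<Rightarrow> real"
  assumes "continuous_on UNIV F"
  shows "(\<lambda>x. complex_of_real (F (character L 1 x))) \<in> borel_measurable (per_measure L)"
  by (rule borel_measurable_per_measure, rule borel_measurable_continuous_onI,
      rule continuous_on_of_real_character[OF assms])

lemma real_polynomial_measurable:
  fixes p :: "complex \<Rightarrow> real"
  assumes "real_polynomial_function p"
  shows "(\<lambda>x. complex_of_real (p (character L 1 x))) \<in> borel_measurable (per_measure L)"
    "\<exists>B. \<forall>x. norm (complex_of_real (p (character L 1 x))) \<le> B"
proof -
  have cont: "continuous_on UNIV p"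
    using assms by (simp add: continuous_on_polymonial_function real_polynomial_function_eq)
  then show "(\<lambda>x. complex_of_real (p (character L 1 x))) \<in> borel_measurable (per_measure L)"
    by (rule measurable_of_real_character)
  have "compact (p ` sphere 0 1)"
    by (intro compact_continuous_image continuous_on_subset[OF cont]) auto
  then obtain B where "\<forall>y\<in>p ` sphere 0 1. \<bar>y\<bar> \<le> B"
    by (metis bounded_iff compact_imp_bounded real_norm_def)
  then show "\<exists>B. \<forall>x. norm (complex_of_real (p (character L 1 x))) \<le> B"
    by (intro exI[of _ B]) auto
qed

text \<open>
  Quantifying over all \<open>h\<close> orthogonal to the characters makes products of polynomials immediate:
  multiplying by one factor yields another such \<open>h\<close>.
\<close>

lemma orthogonal_characters_mult_polynomial:
  fixes h :: "real \<Rightarrow> complex" and p :: "complex \<Rightarrow> real"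
  assumes "real_polynomial_function p"
    and "integrable (per_measure L) h"
    and "\<And>k. (\<integral>x. h x * character L k x \<partial>per_measure L) = 0"
  shows "integrable (per_measure L) (\<lambda>x. h x * p (character L 1 x)) \<and>
    (\<forall>k. (\<integral>x. (h x * p (character L 1 x)) * character L k x \<partial>per_measure L) = 0)"
  using assms
proof (induction arbitrary: h)
  case (linear p h)
  have intk: "integrable (per_measure L) (\<lambda>x. h x * character L k x)" for k
    by (rule integrable_mult_bounded[where B=1]) (use linear(2) in \<open>auto intro: character_measurable\<close>)
  \<comment> \<open>On the unit circle a real-linear form is a combination of \<open>cis t\<close>
    and \<open>cis (- t)\<close>, so multiplying by it only moves the index of a character by 1 or
    -1.\<close>
  define a where "a = (complex_of_real (p 1) - \<i> * complex_of_real (p \<i>)) / 2"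
  define b where "b = (complex_of_real (p 1) + \<i> * complex_of_real (p \<i>)) / 2"
  have p: "complex_of_real (p (cis t)) = a * cis t + b * cis (- t)" for t
  proof -
    have "cis t = cos t *\<^sub>R 1 + sin t *\<^sub>R \<i>" by (simp add: complex_eq_iff)
    then have "p (cis t) = cos t * p 1 + sin t * p \<i>"
      using bounded_linear.linear[OF linear(1)] by (simp add: linear_add linear_scale)
    then show ?thesis by (simp add: a_def b_def complex_eq_iff field_simps)
  qed
  have pc: "h x * p (character L 1 x) * character L k x =
      a * (h x * character L (k + 1) x) + b * (h x * character L (k - 1) x)" for x k
  proof -
    have "complex_of_real (p (character L 1 x)) = a * character L 1 x + b * character L (- 1) x"
      using p[of "2 * pi * of_int 1 * x / L"] by (simp add: character_def)
    then have "h x * p (character L 1 x) * character L k x =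
      a * (h x * (character L k x * character L 1 x)) + b * (h x * (character L k x * character L (- 1) x))"
      by (simp add: algebra_simps)
    then show ?thesis unfolding character_mult by simp
  qed
  obtain B where B: "\<And>x. norm (complex_of_real (p (character L 1 x))) \<le> B"
    using real_polynomial_measurable(2)[OF real_polynomial_function.intros(1)[OF linear(1)]] by blast
  have "integrable (per_measure L) (\<lambda>x. h x * p (character L 1 x))"
    by (rule integrable_mult_bounded[where B=B, OF linear(2)
          real_polynomial_measurable(1)[OF real_polynomial_function.intros(1)[OF linear(1)]]])
       (use B in auto)
  moreover have "(\<integral>x. (h x * p (character L 1 x)) * character L k x \<partial>per_measure L) = 0" for k
    unfolding pc by (subst Bochner_Integration.integral_add) (auto simp: intk linear(3))
  ultimately show ?case by blast
next
  case (const c h)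
  have "(\<integral>x. h x * c * character L k x \<partial>per_measure L) =
        (\<integral>x. c * (h x * character L k x) \<partial>per_measure L)" for k
    by (simp add: mult_ac)
  then show ?case using const by (simp add: integrable_mult_left)
next
  case (add p q h)
  have pint: "integrable (per_measure L) (\<lambda>x. h x * p (character L 1 x))"
    and qint: "integrable (per_measure L) (\<lambda>x. h x * q (character L 1 x))"
    using add by blast+
  have "integrable (per_measure L) (\<lambda>x. h x * p (character L 1 x) * character L k x)"
    "integrable (per_measure L) (\<lambda>x. h x * q (character L 1 x) * character L k x)" for k
    by (rule integrable_mult_bounded[where B=1]; use pint qint in \<open>auto intro: character_measurable\<close>)+
  then show ?case using add pint qint by (simp add: ring_distribs)
next
  case (mult p q h)
  have "integrable (per_measure L) (\<lambda>x. (h x * p (character L 1 x)) * q (character L 1 x)) \<and>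
    (\<forall>k. (\<integral>x. ((h x * p (character L 1 x)) * q (character L 1 x)) * character L k x
        \<partial>per_measure L) = 0)"
    by (rule mult.IH(2)) (use mult.IH(1)[OF mult.prems] in auto)
  then show ?case by (simp add: mult.assoc)
qed

text \<open>By Stone-Weierstrass, \<open>F\<close> is uniformly close to a real polynomial on the
  unit circle. The polynomial contributes 0, and the error is at most \<open>e\<close> times the
  integral of \<open>norm (h x)\<close>.\<close>

lemma orthogonal_characters_continuous:
  fixes h :: "real \<Rightarrow> complex" and F :: "complex \<Rightarrow> real"
  assumes h: "integrable (per_measure L) h"
    and orth: "\<And>k. (\<integral>x. h x * character L k x \<partial>per_measure L) = 0"
    and F: "continuous_on UNIV F"
  shows "(\<integral>x. h x * F (character L 1 x) \<partial>per_measure L) = 0"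
proof -
  let ?M = "per_measure L"
  have Fm: "(\<lambda>x. complex_of_real (F (character L 1 x))) \<in> borel_measurable ?M"
    by (rule measurable_of_real_character[OF F])
  have bound: "norm (\<integral>x. h x * F (character L 1 x) \<partial>?M) \<le> e * (\<integral>x. norm (h x) \<partial>?M)" if e: "e > 0" for e
  proof -
    obtain p where p: "real_polynomial_function p" "\<And>z. z \<in> sphere 0 1 \<Longrightarrow> \<bar>F z - p z\<bar> < e"
      by (rule Stone_Weierstrass_real_polynomial_function
          [OF compact_sphere continuous_on_subset[OF F subset_UNIV] e]) (rule that)
    note ortho = orthogonal_characters_mult_polynomial[OF p(1) h orth]
    have p0: "(\<integral>x. h x * p (character L 1 x) \<partial>?M) = 0"
      using ortho[THEN conjunct2, rule_format, of 0] by simp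
    have d: "\<bar>F (character L 1 x) - p (character L 1 x)\<bar> \<le> e" for x
      using p(2)[of "character L 1 x"] by (simp add: less_imp_le)
    have di: "integrable ?M (\<lambda>x. h x * (complex_of_real (F (character L 1 x)) - p (character L 1 x)))"
    proof (rule integrable_mult_bounded[OF h])
      show "(\<lambda>x. complex_of_real (F (character L 1 x)) - p (character L 1 x)) \<in> borel_measurable ?M"
        using Fm real_polynomial_measurable(1)[OF p(1)] by measurable
      show "cmod (complex_of_real (F (character L 1 x)) - p (character L 1 x)) \<le> e" for x
        unfolding of_real_diff[symmetric] norm_of_real by (rule d)
    qed
    have "(\<integral>x. h x * F (character L 1 x) \<partial>?M) =
        (\<integral>x. h x * (complex_of_real (F (character L 1 x)) - p (character L 1 x))
              + h x * p (character L 1 x) \<partial>?M)"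
      by (simp add: algebra_simps)
    also have "\<dots> = (\<integral>x. h x * (complex_of_real (F (character L 1 x)) - p (character L 1 x)) \<partial>?M)"
      using di ortho p0 by simp
    finally have "norm (\<integral>x. h x * F (character L 1 x) \<partial>?M) \<le>
      (\<integral>x. norm (h x * (complex_of_real (F (character L 1 x)) - p (character L 1 x))) \<partial>?M)"
      using integral_norm_bound by simp
    also have "\<dots> \<le> (\<integral>x. e * norm (h x) \<partial>?M)"
    proof (rule integral_mono)
      show "integrable ?M (\<lambda>x. norm (h x * (complex_of_real (F (character L 1 x)) - p (character L 1 x))))"
        using di by (rule integrable_norm)
      show "cmod (h x * (complex_of_real (F (character L 1 x)) - p (character L 1 x))) \<le> e * cmod (h x)" for x
        unfolding norm_mult of_real_diff[symmetric] norm_of_real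
        using mult_right_mono[OF d[of x] norm_ge_zero[of "h x"]] by (simp add: mult.commute)
    qed (use h in simp)
    finally show ?thesis by simp
  qed
  have "norm (\<integral>x. h x * F (character L 1 x) \<partial>?M) \<le> 0 + e" if "e > 0" for e
  proof -
    let ?I = "\<integral>x. norm (h x) \<partial>?M"
    have I0: "0 \<le> ?I" by simp
    \<comment> \<open>Dividing by \<open>?I + 1\<close> instead of \<open>?I\<close> covers the case
      that \<open>?I\<close> is 0.\<close>
    have "norm (\<integral>x. h x * F (character L 1 x) \<partial>?M) \<le> e / (?I + 1) * ?I"
      using bound[of "e / (?I + 1)"] that I0 by simp
    also have "\<dots> \<le> e / (?I + 1) * (?I + 1)" using that I0 by (intro mult_left_mono) auto
    also have "\<dots> = e" using I0 by (simp add: add_nonneg_eq_0_iff)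
    finally show ?thesis by simp
  qed
  then show ?thesis by (metis field_le_epsilon norm_le_zero_iff)
qed

text \<open>\<open>character L 1\<close> wraps the period around the circle and identifies only its
  two end points. Keeping \<open>x\<close> away from them is enough: \<open>(x - y) / L\<close> is
  then an integer of modulus less than 1.\<close>

lemma character_eq_imp_eq:
  assumes "0 < x" "x < L" "0 \<le> y" "y \<le> L" "character L 1 x = character L 1 y"
  shows "x = y"
proof -
  have "cis (2 * pi * x / L - 2 * pi * y / L) = 1"
    using assms(5) by (simp add: character_def cis_divide[symmetric])
  then have "sin (2 * pi * x / L - 2 * pi * y / L) = 0" "cos (2 * pi * x / L - 2 * pi * y / L) = 1"
    by (simp_all add: complex_eq_iff)
  then obtain n :: int where "2 * pi * x / L - 2 * pi * y / L = of_int n * 2 * pi"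
    by (metis cos_one_2pi_int)
  moreover have "2 * pi * x / L - 2 * pi * y / L = 2 * pi * ((x - y) / L)"
    by (simp add: diff_divide_distrib algebra_simps)
  ultimately have "2 * pi * ((x - y) / L) = 2 * pi * of_int n" by simp
  then have n: "(x - y) / L = of_int n" by (metis mult_cancel_left pi_neq_zero zero_neq_numeral mult_eq_0_iff)
  have "\<bar>(x - y) / L\<bar> < 1" using assms by (simp add: field_simps abs_if)
  with n have "n = 0" by linarith
  with n assms show ?thesis by simp
qed

text \<open>The part of \<open>K\<close> in one period is carried to a compact set on the circle.
  Its indicator is a bounded pointwise limit of continuous functions, to which the previous
  orthogonality applies, and dominated convergence passes to the limit.\<close>

lemma orthogonal_characters_closed:
  fixes h :: "real \<Rightarrow> complex"
  assumes h: "integrable (per_measure L) h"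
    and orth: "\<And>k. (\<integral>x. h x * character L k x \<partial>per_measure L) = 0"
    and K: "closed K"
  shows "(\<integral>x. indicator K x *\<^sub>R h x \<partial>per_measure L) = 0"
proof (cases "K \<inter> {0..L} = {}")
  case True
  then have "(\<integral>x. indicator K x *\<^sub>R h x \<partial>per_measure L) = (\<integral>x. 0 \<partial>per_measure L)"
    by (intro Bochner_Integration.integral_cong) (auto simp: space_restrict_space indicator_def)
  then show ?thesis by simp
next
  case False
  let ?M = "per_measure L"
  define C where "C = character L 1 ` (K \<inter> {0..L})"
  have "compact (K \<inter> {0..L})" using K by (metis Int_commute compact_Icc compact_Int_closed)
  then have "compact C"
    unfolding C_def by (rule compact_continuous_image[rotated]) (rule continuous_on_subset[OF continuous_character], simp)
  then have C: "closed C" "C \<noteq> {}" using False by (auto simp: C_def compact_imp_closed)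
  \<comment> \<open>A distance cutoff: 1 on \<open>C\<close>, and 0 at a point outside as soon as
    \<open>n\<close> exceeds the reciprocal of its distance to \<open>C\<close>.\<close>
  define F where "F n z = max 0 (1 - real n * infdist z C)" for n and z :: complex
  have Fc: "continuous_on UNIV (F n)" for n unfolding F_def by (intro continuous_intros)
  have F1: "\<bar>F n z\<bar> \<le> 1" for n z unfolding F_def using infdist_nonneg[of z C] by auto
  have Flim: "(\<lambda>n. F n z) \<longlonglongrightarrow> indicator C z" for z
  proof (cases "z \<in> C")
    case True
    then have "infdist z C = 0" by simp
    with True show ?thesis by (simp add: F_def)
  next
    case False
    with C have pos: "infdist z C > 0"
      using in_closed_iff_infdist_zero infdist_nonneg by (metis less_le)
    obtain N :: nat where N: "1 / infdist z C < real N" using reals_Archimedean2 by blast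
    have "F n z = 0" if "n \<ge> N" for n
    proof -
      have "1 / infdist z C < real n" using N that by linarith
      then show ?thesis using pos by (simp add: F_def field_simps)
    qed
    then have "eventually (\<lambda>n. F n z = 0) sequentially" by (auto simp: eventually_sequentially)
    then show ?thesis using False by (simp add: tendsto_eventually)
  qed
  have hm: "h \<in> borel_measurable ?M" using h by simp
  have "(\<lambda>n. \<integral>x. h x * F n (character L 1 x) \<partial>?M) \<longlonglongrightarrow> (\<integral>x. indicator K x *\<^sub>R h x \<partial>?M)"
  proof (rule integral_dominated_convergence[where w="\<lambda>x. norm (h x)"])
    show "(\<lambda>x. indicator K x *\<^sub>R h x) \<in> borel_measurable ?M"
      by (intro borel_measurable_scaleR borel_measurable_per_measure[OF borel_measurable_indicator]) (use K h in auto)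
    show "integrable ?M (\<lambda>x. norm (h x))" using h by simp
    show "(\<lambda>x. h x * F n (character L 1 x)) \<in> borel_measurable ?M" for n
      by (rule borel_measurable_times[OF hm measurable_of_real_character[OF Fc]])
    show "AE x in ?M. norm (h x * F n (character L 1 x)) \<le> norm (h x)" for n
      by (rule AE_I2) (simp add: norm_mult mult_left_le F1)
    \<comment> \<open>At 0 and \<open>L\<close> the image may lie in \<open>C\<close> although the
      point is not in \<open>K\<close>, because the other end point is. These two points form a null
      set.\<close>
    have "AE x in lborel. x \<noteq> 0 \<and> x \<noteq> L" using AE_lborel_singleton[of 0] AE_lborel_singleton[of L] by auto
    then have "AE x in ?M. x \<noteq> 0 \<and> x \<noteq> L" by (rule AE_per_measure)
    moreover have "AE x in ?M. x \<in> {0..L}" by (rule AE_I2) (simp add: space_restrict_space)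
    ultimately show "AE x in ?M. (\<lambda>n. h x * F n (character L 1 x)) \<longlonglongrightarrow> indicator K x *\<^sub>R h x"
    proof eventually_elim
      case (elim x)
      have "character L 1 x \<in> C \<longleftrightarrow> x \<in> K"
      proof
        assume "character L 1 x \<in> C"
        then obtain y where "y \<in> K" "y \<in> {0..L}" "character L 1 x = character L 1 y"
          unfolding C_def by (elim imageE IntE)
        then show "x \<in> K" using elim character_eq_imp_eq[of x L y] by simp
      next
        assume "x \<in> K"
        then show "character L 1 x \<in> C" using elim unfolding C_def by (intro imageI IntI)
      qed
      then have ind: "indicator C (character L 1 x) = (indicator K x :: real)" by (simp add: indicator_def)
      have "(\<lambda>n. h x * F n (character L 1 x)) \<longlonglongrightarrow> h x * complex_of_real (indicator C (character L 1 x))"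
        by (intro tendsto_intros Flim)
      then show ?case unfolding ind by (simp add: scaleR_conv_of_real mult.commute)
    qed
  qed
  moreover have "(\<integral>x. h x * F n (character L 1 x) \<partial>?M) = 0" for n
    by (rule orthogonal_characters_continuous[OF h orth Fc])
  ultimately show ?thesis by (simp add: LIMSEQ_const_iff)
qed

text \<open>Closed sets form an intersection-stable generator of the Borel sets, so the vanishing of
  the integrals over closed sets extends to all Borel sets by a Dynkin argument. A density with all
  set integrals 0 is 0 almost everywhere.\<close>

theorem orthogonal_characters_imp_AE_zero:
  fixes h :: "real \<Rightarrow> complex"
  assumes h: "integrable (per_measure L) h"
    and orth: "\<And>k. (\<integral>x. h x * character L k x \<partial>per_measure L) = 0"
  shows "AE x in per_measure L. h x = 0"
proof -
  interpret finite_measure "per_measure L" by (rule finite_per_measure)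
  let ?M = "per_measure L"
  have int: "integrable ?M (\<lambda>x. indicator B x *\<^sub>R h x)" if "B \<in> sets borel" for B
  proof -
    have "integrable ?M (\<lambda>x. indicator (B \<inter> {0..L}) x *\<^sub>R h x)"
      using h that by (intro integrable_mult_indicator) (auto simp: sets_restrict_space)
    moreover have "integrable ?M (\<lambda>x. indicator (B \<inter> {0..L}) x *\<^sub>R h x) \<longleftrightarrow>
        integrable ?M (\<lambda>x. indicator B x *\<^sub>R h x)"
      by (rule Bochner_Integration.integrable_cong) (auto simp: space_restrict_space indicator_def)
    ultimately show ?thesis by simp
  qed
  have zero: "(\<integral>x. indicator B x *\<^sub>R h x \<partial>?M) = 0" if "B \<in> sets borel" for B
  proof -
    have sb: "sets (borel :: real measure) = sigma_sets UNIV (Collect closed)"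
      by (simp add: borel_eq_closed)
    have "Int_stable (Collect closed :: real set set)" by (auto simp: Int_stable_def)
    moreover have "Collect closed \<subseteq> Pow (UNIV :: real set)" by simp
    moreover have "B \<in> sigma_sets UNIV (Collect closed)" using that sb by simp
    ultimately show ?thesis
    proof (induction rule: sigma_sets_induct_disjoint)
      case (basic A)
      then show ?case using orthogonal_characters_closed[OF h orth] by simp
    next
      case (compl A)
      have "(\<integral>x. indicator UNIV x *\<^sub>R h x \<partial>?M) = 0"
        by (rule orthogonal_characters_closed[OF h orth]) simp
      then have "(\<integral>x. h x - indicator A x *\<^sub>R h x \<partial>?M) = 0"
        using compl h int[of A] sb by (subst Bochner_Integration.integral_diff) auto
      moreover have "indicator (UNIV - A) x *\<^sub>R h x = h x - indicator A x *\<^sub>R h x" for x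
        by (simp add: indicator_def)
      ultimately show ?case by simp
    next
      case (union A)
      have "(\<lambda>n. \<integral>x. indicator (\<Union>i<n. A i) x *\<^sub>R h x \<partial>?M) \<longlonglongrightarrow>
          (\<integral>x. indicator (\<Union>i. A i) x *\<^sub>R h x \<partial>?M)"
      proof (rule integral_dominated_convergence[where w="\<lambda>x. norm (h x)"])
        have A: "A i \<in> sets borel" for i using union sb by auto
        show "(\<lambda>x. indicator (\<Union>i. A i) x *\<^sub>R h x) \<in> borel_measurable ?M"
          using int[of "\<Union>i. A i"] A by auto
        show "(\<lambda>x. indicator (\<Union>i<n. A i) x *\<^sub>R h x) \<in> borel_measurable ?M" for n
          using int[of "\<Union>i<n. A i"] A by auto
        show "AE x in ?M. (\<lambda>n. indicator (\<Union>i<n. A i) x *\<^sub>R h x) \<longlonglongrightarrow> indicator (\<Union>i. A i) x *\<^sub>R h x"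
          by (intro AE_I2 tendsto_scaleR LIMSEQ_indicator_UN tendsto_const)
      qed (use h in \<open>auto simp: indicator_def\<close>)
      moreover have "(\<integral>x. indicator (\<Union>i<n. A i) x *\<^sub>R h x \<partial>?M) = 0" for n
      proof (induction n)
        case (Suc n)
        have A: "A i \<in> sets borel" for i using union sb by auto
        have "indicator (\<Union>i<Suc n. A i) x *\<^sub>R h x =
            indicator (\<Union>i<n. A i) x *\<^sub>R h x + indicator (A n) x *\<^sub>R h x" for x
          using \<open>disjoint_family A\<close> unfolding disjoint_family_on_def
          by (auto simp: indicator_def lessThan_Suc) (metis IntI emptyE nat_neq_iff)
        moreover have "integrable ?M (\<lambda>x. indicator (\<Union>i<n. A i) x *\<^sub>R h x)"
          using A by (intro int) auto
        ultimately show ?case using Suc union int[OF A] by simp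
      qed simp
      ultimately show ?case by (simp add: LIMSEQ_const_iff)
    qed simp_all
  qed
  have "set_lebesgue_integral ?M A h = 0" if "A \<in> sets ?M" for A
  proof -
    from that obtain B where B: "B \<in> sets borel" "A = B \<inter> {0..L}" by (auto simp: sets_restrict_space)
  have "(\<integral>x. indicator A x *\<^sub>R h x \<partial>?M) = (\<integral>x. indicator B x *\<^sub>R h x \<partial>?M)"
    by (intro Bochner_Integration.integral_cong) (auto simp: B space_restrict_space indicator_def)
  then show ?thesis
    using zero[OF B(1)] by (simp add: set_lebesgue_integral_def)
  qed
  then show ?thesis by (rule density_zero[OF h])
qed

section \<open>Absolutely convergent Fourier series\<close>

lemma fourier_coeff_eq:
  "fourier_coeff L u k = (\<integral>x. u x * cnj (character L k x) \<partial>per_measure L) / L"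
  unfolding fourier_coeff_def set_integral_eq_per_measure character_def by (simp add: cis_cnj)

lemma integrable_mult_character:
  assumes "integrable (per_measure L) h"
  shows "integrable (per_measure L) (\<lambda>x. h x * character L k x)"
  by (rule integrable_mult_bounded[where B=1, OF assms character_measurable]) simp

lemma integral_mult_character:
  fixes u :: "real \<Rightarrow> real"
  assumes "L > 0"
  shows "(\<integral>x. u x * character L k x \<partial>per_measure L) = L * cnj (fourier_coeff L u k)"
proof -
  have "cnj (\<integral>x. u x * cnj (character L k x) \<partial>per_measure L) = (\<integral>x. u x * character L k x \<partial>per_measure L)"
    by (subst Bochner_Integration.integral_cnj[symmetric]) simp
  then show ?thesis using assms by (simp add: fourier_coeff_eq)
qed

lemma integral_character:
  assumes "L > 0"
  shows "(\<integral>x. character L k x \<partial>per_measure L) = (if k = 0 then complex_of_real L else 0)"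
proof (cases "k = 0")
  case True
  then show ?thesis using assms measure_per_measure[of L] by (simp add: scaleR_conv_of_real)
next
  case False
  define a where "a = 2 * pi * of_int k / L"
  have a: "a \<noteq> 0" using False assms by (simp add: a_def)
  have c: "character L k x = cis (a * x)" for x by (simp add: character_def a_def)
  have d: "((\<lambda>x. cis (a * x) / (\<i> * a)) has_vector_derivative cis (a * x)) (at x within {0..L})" for x
  proof -
    have "((\<lambda>z. exp (\<i> * a * z) / (\<i> * a)) has_field_derivative exp (\<i> * a * complex_of_real x))
        (at (complex_of_real x))"
      using a by (auto intro!: derivative_eq_intros)
    from has_vector_derivative_real_field[OF this] show ?thesis
      by (simp add: cis_conv_exp mult.assoc)
  qed
  have "(LBINT x. indicator {0..L} x *\<^sub>R cis (a * x)) = cis (a * L) / (\<i> * a) - cis (a * 0) / (\<i> * a)"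
    by (rule integral_FTC_atLeastAtMost) (use assms d in \<open>auto intro!: continuous_intros\<close>)
  also have "a * L = 2 * pi * of_int k" using assms by (simp add: a_def)
  finally have "(LBINT x. indicator {0..L} x *\<^sub>R cis (a * x)) = 0"
    by (simp add: cis_multiple_2pi)
  then show ?thesis using False by (simp add: c integral_restrict_space)
qed

lemma summable_inverse_1_plus_square_int: "(\<lambda>k::int. 1 / (1 + (real_of_int k)\<^sup>2)) summable_on UNIV"
proof -
  let ?w = "\<lambda>k::int. 1 / (1 + (real_of_int k)\<^sup>2)"
  have "summable (\<lambda>n. 1 / (1 + (real n)\<^sup>2))"
  proof (rule summable_comparison_test_ev)
    show "eventually (\<lambda>n. norm (1 / (1 + (real n)\<^sup>2)) \<le> inverse (real n ^ 2)) sequentially"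
      using eventually_gt_at_top[of 0] by eventually_elim (simp add: inverse_eq_divide frac_le)
    show "summable (\<lambda>n. inverse (real n ^ 2))" by (rule inverse_power_summable) simp
  qed
  then have n: "(\<lambda>n. 1 / (1 + (real n)\<^sup>2)) summable_on UNIV"
    by (simp add: summable_on_UNIV_nonneg_real_iff)
  have "?w summable_on range int"
    by (subst summable_on_reindex) (use n in \<open>auto simp: o_def\<close>)
  moreover have "?w summable_on range (\<lambda>n. - int n)"
    by (subst summable_on_reindex) (use n in \<open>auto simp: o_def inj_def\<close>)
  ultimately have "?w summable_on (range int \<union> range (\<lambda>n. - int n))"
    by (rule summable_on_union)
  moreover have "range int \<union> range (\<lambda>n. - int n) = UNIV"
  proof -
    have "k \<in> range int \<union> range (\<lambda>n. - int n)" for k by (cases k rule: int_cases2) auto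
    then show ?thesis by blast
  qed
  ultimately show ?thesis by simp
qed

lemma Cauchy_Schwarz_infsum:
  fixes a b :: "'a \<Rightarrow> real"
  assumes "(\<lambda>x. (a x)\<^sup>2) summable_on A" "(\<lambda>x. (b x)\<^sup>2) summable_on A"
    and nonneg: "\<And>x. x \<in> A \<Longrightarrow> 0 \<le> a x" "\<And>x. x \<in> A \<Longrightarrow> 0 \<le> b x"
  shows "(\<lambda>x. a x * b x) summable_on A"
    and "(\<Sum>\<^sub>\<infinity>x\<in>A. a x * b x) \<le> sqrt (\<Sum>\<^sub>\<infinity>x\<in>A. (a x)\<^sup>2) * sqrt (\<Sum>\<^sub>\<infinity>x\<in>A. (b x)\<^sup>2)"
proof -
  have le: "(\<Sum>x\<in>F. a x * b x) \<le> sqrt (\<Sum>\<^sub>\<infinity>x\<in>A. (a x)\<^sup>2) * sqrt (\<Sum>\<^sub>\<infinity>x\<in>A. (b x)\<^sup>2)"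
    if "finite F" "F \<subseteq> A" for F
  proof -
    have "(\<Sum>x\<in>F. a x * b x) \<le> L2_set a F * L2_set b F"
      using L2_set_mult_ineq[of a b F] that nonneg
      by (smt (verit) abs_of_nonneg mult_mono subsetD sum.cong)
    also have "\<dots> \<le> sqrt (\<Sum>\<^sub>\<infinity>x\<in>A. (a x)\<^sup>2) * sqrt (\<Sum>\<^sub>\<infinity>x\<in>A. (b x)\<^sup>2)"
      unfolding L2_set_def
      by (intro mult_mono real_sqrt_le_mono finite_sum_le_infsum assms that)
         (auto intro!: infsum_nonneg sum_nonneg)
    finally show ?thesis .
  qed
  show "(\<lambda>x. a x * b x) summable_on A"
    by (rule nonneg_bdd_above_summable_on) (use le nonneg in \<open>auto intro!: bdd_aboveI\<close>)
  then show "(\<Sum>\<^sub>\<infinity>x\<in>A. a x * b x) \<le> sqrt (\<Sum>\<^sub>\<infinity>x\<in>A. (a x)\<^sup>2) * sqrt (\<Sum>\<^sub>\<infinity>x\<in>A. (b x)\<^sup>2)"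
    by (rule infsum_le_finite_sums) (use le in auto)
qed

context
  fixes L :: real and c :: "int \<Rightarrow> complex"
  assumes c: "(\<lambda>k. cmod (c k)) summable_on UNIV"
begin

lemma continuous_fourier_series: "continuous_on UNIV (\<lambda>x. \<Sum>\<^sub>\<infinity>k. c k * character L k x)"
proof (rule uniform_limit_theorem)
  show "uniform_limit UNIV (\<lambda>F x. \<Sum>k\<in>F. c k * character L k x)
      (\<lambda>x. \<Sum>\<^sub>\<infinity>k. c k * character L k x) (finite_subsets_at_top UNIV)"
    by (rule Weierstrass_m_test_general[OF _ c]) (simp add: norm_mult)
qed (auto intro!: always_eventually continuous_intros continuous_character)

lemma norm_fourier_series_le: "cmod (\<Sum>\<^sub>\<infinity>k. c k * character L k x) \<le> (\<Sum>\<^sub>\<infinity>k. cmod (c k))"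
  by (rule order.trans[OF norm_infsum_bound]) (simp_all add: norm_mult c)

text \<open>By the Weierstrass test the series converges uniformly, so it may be integrated term by
  term against any integrable \<open>b\<close>, however irregular.\<close>

lemma integral_mult_fourier_series:
  assumes b: "integrable (per_measure L) b"
  shows "((\<lambda>k. c k * (\<integral>x. b x * character L k x \<partial>per_measure L)) has_sum
      (\<integral>x. b x * (\<Sum>\<^sub>\<infinity>k. c k * character L k x) \<partial>per_measure L)) UNIV"
proof -
  let ?M = "per_measure L"
  let ?S = "\<lambda>x. \<Sum>\<^sub>\<infinity>k. c k * character L k x"
  let ?I = "\<lambda>F. \<Sum>k\<in>F. c k * (\<integral>x. b x * character L k x \<partial>?M)"
  have Sm: "?S \<in> borel_measurable ?M"
    by (intro borel_measurable_per_measure borel_measurable_continuous_onI continuous_fourier_series)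
  have Sint: "integrable ?M (\<lambda>x. b x * ?S x)"
    by (rule integrable_mult_bounded[OF b Sm norm_fourier_series_le])
  have Fint: "integrable ?M (\<lambda>x. b x * (\<Sum>k\<in>F. c k * character L k x))" for F
    unfolding sum_distrib_left mult.left_commute[of "b _"]
    by (intro Bochner_Integration.integrable_sum integrable_mult_right integrable_mult_character[OF b])
  have eq: "?I F = (\<integral>x. b x * (\<Sum>k\<in>F. c k * character L k x) \<partial>?M)" for F
    unfolding sum_distrib_left mult.left_commute[of "b _"]
    by (subst Bochner_Integration.integral_sum)
       (simp_all add: integrable_mult_right integrable_mult_character[OF b])
  have lim: "uniform_limit UNIV (\<lambda>F x. \<Sum>k\<in>F. c k * character L k x) ?S (finite_subsets_at_top UNIV)"
    by (rule Weierstrass_m_test_general[OF _ c]) (simp add: norm_mult)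
  let ?B = "\<integral>x. norm (b x) \<partial>?M"
  have "((\<lambda>F. ?I F) \<longlongrightarrow> (\<integral>x. b x * ?S x \<partial>?M)) (finite_subsets_at_top UNIV)"
  proof (rule tendstoI)
    fix e :: real assume e: "e > 0"
    have B0: "0 \<le> ?B" by simp
    define d where "d = e / (?B + 1)"
    have d: "d > 0" using e B0 by (simp add: d_def add_nonneg_pos)
    have "\<forall>\<^sub>F F in finite_subsets_at_top UNIV. \<forall>x\<in>UNIV. dist (\<Sum>k\<in>F. c k * character L k x) (?S x) < d"
      by (rule uniform_limitD[OF lim d])
    then show "\<forall>\<^sub>F F in finite_subsets_at_top UNIV. dist (?I F) (\<integral>x. b x * ?S x \<partial>?M) < e"
    proof eventually_elim
      case (elim F)
      let ?D = "\<lambda>x. (\<Sum>k\<in>F. c k * character L k x) - ?S x"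
      have "?I F - (\<integral>x. b x * ?S x \<partial>?M) = (\<integral>x. b x * ?D x \<partial>?M)"
        unfolding eq by (subst Bochner_Integration.integral_diff[symmetric]) (auto simp: Fint Sint algebra_simps)
      then have "norm (?I F - (\<integral>x. b x * ?S x \<partial>?M)) \<le> (\<integral>x. norm (b x * ?D x) \<partial>?M)"
        using integral_norm_bound by simp
      also have "\<dots> \<le> (\<integral>x. d * norm (b x) \<partial>?M)"
      proof (rule integral_mono)
        have "integrable ?M (\<lambda>x. b x * (\<Sum>k\<in>F. c k * character L k x) - b x * ?S x)"
          using Fint Sint by (rule Bochner_Integration.integrable_diff)
        then show "integrable ?M (\<lambda>x. norm (b x * ?D x))"
          by (simp add: right_diff_distrib)
        show "norm (b x * ?D x) \<le> d * norm (b x)" for x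
        proof -
          have "norm (?D x) \<le> d" using elim by (simp add: dist_norm less_imp_le)
          then show ?thesis unfolding norm_mult by (subst mult.commute) (rule mult_right_mono, simp_all)
        qed
      qed (use b in simp)
      also have "\<dots> = d * ?B" by simp
      also have "\<dots> < d * (?B + 1)" using d by simp
      also have "\<dots> = e" using B0 by (simp add: d_def add_nonneg_eq_0_iff)
      finally show ?case by (simp add: dist_norm)
    qed
  qed
  then show ?thesis by (simp add: has_sum_def)
qed

end

text \<open>The difference between \<open>u\<close> and its series is orthogonal to every character,
  so completeness makes it vanish.\<close>

theorem fourier_series_AE:
  fixes u :: "real \<Rightarrow> real"
  assumes L: "L > 0" and u: "integrable (per_measure L) u"
    and c: "(\<lambda>k. cmod (fourier_coeff L u k)) summable_on UNIV"
  shows "AE x in per_measure L. u x = (\<Sum>\<^sub>\<infinity>k. fourier_coeff L u k * character L k x)"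
proof -
  let ?M = "per_measure L"
  let ?c = "fourier_coeff L u"
  let ?S = "\<lambda>x. \<Sum>\<^sub>\<infinity>k. ?c k * character L k x"
  have Sint: "integrable ?M ?S"
    by (intro integrable_per_measure_continuous continuous_fourier_series c)
  have uint: "integrable ?M (\<lambda>x. complex_of_real (u x))" using u by simp
  have "AE x in ?M. u x - ?S x = 0"
  proof (rule orthogonal_characters_imp_AE_zero)
    show "integrable ?M (\<lambda>x. u x - ?S x)" using uint Sint by simp
    fix k
    have cint: "integrable ?M (\<lambda>x. character L k x)"
      by (intro integrable_per_measure_continuous continuous_character)
    have "((\<lambda>j. ?c j * (\<integral>x. character L k x * character L j x \<partial>?M)) has_sum
        (\<integral>x. character L k x * ?S x \<partial>?M)) UNIV"
      by (rule integral_mult_fourier_series[OF c cint])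
    \<comment> \<open>The pairing is bilinear, without conjugation, so \<open>character L k\<close>
      meets only the term of index \<open>- k\<close>.\<close>
    moreover have "(\<lambda>j. ?c j * (\<integral>x. character L k x * character L j x \<partial>?M)) =
        (\<lambda>j. if j = - k then ?c (- k) * L else 0)"
      by (auto simp: fun_eq_iff character_mult integral_character[OF L] add_eq_0_iff)
    ultimately have "((\<lambda>j. if j = - k then ?c (- k) * L else 0) has_sum
        (\<integral>x. character L k x * ?S x \<partial>?M)) UNIV" by simp
    moreover have "((\<lambda>j. if j = - k then ?c (- k) * L else 0) has_sum (?c (- k) * L)) UNIV"
      by (rule has_sum_finite_neutralI[of "{- k}"]) auto
    ultimately have "(\<integral>x. character L k x * ?S x \<partial>?M) = ?c (- k) * L"
      by (rule has_sum_unique)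
    also have "\<dots> = (\<integral>x. u x * character L k x \<partial>?M)"
      using L by (simp add: fourier_coeff_eq character_uminus)
    finally have "(\<integral>x. ?S x * character L k x \<partial>?M) = (\<integral>x. u x * character L k x \<partial>?M)"
      by (subst mult.commute)
    then show "(\<integral>x. (u x - ?S x) * character L k x \<partial>?M) = 0"
      using integrable_mult_character[OF uint] integrable_mult_character[OF Sint]
      by (simp add: left_diff_distrib)
  qed
  then show ?thesis by (simp only: right_minus_eq)
qed

text \<open>Summable coefficients are asked of \<open>u\<close> alone. This asymmetry lets an
  \<open>H^2\<close> function be paired with a second weak derivative, about which only
  square-integrability is known.\<close>

theorem Parseval_abs_summable:
  fixes u b :: "real \<Rightarrow> real"
  assumes L: "L > 0" and u: "integrable (per_measure L) u" and b: "integrable (per_measure L) b"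
    and c: "(\<lambda>k. cmod (fourier_coeff L u k)) summable_on UNIV"
  shows "((\<lambda>k. L * Re (fourier_coeff L u k * cnj (fourier_coeff L b k))) has_sum
    (\<integral>x. u x * b x \<partial>per_measure L)) UNIV"
proof -
  let ?M = "per_measure L"
  let ?S = "\<lambda>x. \<Sum>\<^sub>\<infinity>k. fourier_coeff L u k * character L k x"
  have bint: "integrable ?M (\<lambda>x. complex_of_real (b x))" using b by simp
  have "((\<lambda>k. fourier_coeff L u k * (L * cnj (fourier_coeff L b k))) has_sum
      (\<integral>x. b x * ?S x \<partial>?M)) UNIV"
    using integral_mult_fourier_series[OF c bint] by (simp add: integral_mult_character[OF L])
  moreover have "(\<integral>x. b x * ?S x \<partial>?M) = (\<integral>x. complex_of_real (u x * b x) \<partial>?M)"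
  proof (rule integral_cong_AE)
    have Sm: "?S \<in> borel_measurable ?M"
      by (intro borel_measurable_per_measure borel_measurable_continuous_onI continuous_fourier_series c)
    show "(\<lambda>x. b x * ?S x) \<in> borel_measurable ?M"
      using bint by (intro borel_measurable_times Sm) simp
    show "(\<lambda>x. complex_of_real (u x * b x)) \<in> borel_measurable ?M"
      using b u by simp
    show "AE x in ?M. b x * ?S x = complex_of_real (u x * b x)"
      using fourier_series_AE[OF L u c] by eventually_elim (simp add: mult.commute)
  qed
  ultimately have "((\<lambda>k. fourier_coeff L u k * (L * cnj (fourier_coeff L b k))) has_sum
      complex_of_real (\<integral>x. u x * b x \<partial>?M)) UNIV" by (simp only: integral_complex_of_real)
  from has_sum_Re[OF this] show ?thesis by (simp add: algebra_simps)
qed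

section \<open>Periodic Sobolev functions\<close>

lemma L2_per_iff:
  "u \<in> L2_per L \<longleftrightarrow> u \<in> borel_measurable borel \<and> periodic L u \<and> integrable (per_measure L) (\<lambda>x. (u x)\<^sup>2)"
  by (simp add: L2_per_def set_integrable_iff_per_measure)

lemma L2_norm_eq: "L2_norm L u = sqrt (\<integral>x. (u x)\<^sup>2 \<partial>per_measure L)"
  by (simp add: L2_norm_def set_integral_eq_per_measure)

lemma L2_per_measurable: "u \<in> L2_per L \<Longrightarrow> u \<in> borel_measurable (per_measure L)"
  by (simp add: L2_per_iff borel_measurable_per_measure)

lemma L2_per_integrable_mult:
  assumes "u \<in> L2_per L" "v \<in> L2_per L"
  shows "integrable (per_measure L) (\<lambda>x. u x * v x)"
proof (rule Bochner_Integration.integrable_bound)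
  show "integrable (per_measure L) (\<lambda>x. (u x)\<^sup>2 + (v x)\<^sup>2)"
    using assms by (simp add: L2_per_iff)
  show "(\<lambda>x. u x * v x) \<in> borel_measurable (per_measure L)"
    using assms by (intro borel_measurable_times L2_per_measurable)
  have "\<bar>a * b\<bar> \<le> a\<^sup>2 + b\<^sup>2" for a b :: real
    using sum_squares_bound[of a b] sum_squares_bound[of "- a" b] by (simp add: abs_if)
  then show "AE x in per_measure L. norm (u x * v x) \<le> norm ((u x)\<^sup>2 + (v x)\<^sup>2)"
    by (intro AE_I2) simp
qed

lemma continuous_periodic_L2_per:
  assumes "continuous_on UNIV u" "periodic L u"
  shows "u \<in> L2_per L"
  using assms by (auto simp: L2_per_iff intro!: borel_measurable_continuous_onI
      integrable_per_measure_continuous continuous_intros)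

lemma L2_per_const: "(\<lambda>x. c) \<in> L2_per L"
  by (rule continuous_periodic_L2_per) (auto simp: periodic_def)

lemma L2_per_integrable: "u \<in> L2_per L \<Longrightarrow> integrable (per_measure L) u"
  using L2_per_integrable_mult[OF _ L2_per_const[of 1]] by simp

lemma L2_per_diff:
  assumes "u \<in> L2_per L" "v \<in> L2_per L"
  shows "(\<lambda>x. u x - v x) \<in> L2_per L"
proof -
  have "integrable (per_measure L) (\<lambda>x. (u x)\<^sup>2 - 2 * (u x * v x) + (v x)\<^sup>2)"
    using assms L2_per_integrable_mult[OF assms] by (simp add: L2_per_iff)
  then have "integrable (per_measure L) (\<lambda>x. (u x - v x)\<^sup>2)"
    by (simp add: power2_diff algebra_simps)
  then show ?thesis
    using assms by (auto simp: L2_per_iff periodic_def intro!: borel_measurable_diff)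
qed

lemma L2_per_cmult: "u \<in> L2_per L \<Longrightarrow> (\<lambda>x. c * u x) \<in> L2_per L"
  by (auto simp: L2_per_iff periodic_def power_mult_distrib intro!: borel_measurable_times)

lemma L2_per_add:
  assumes "u \<in> L2_per L" "v \<in> L2_per L"
  shows "(\<lambda>x. u x + v x) \<in> L2_per L"
  using L2_per_diff[OF assms(1) L2_per_cmult[OF assms(2), of "- 1"]] by simp

lemma L2_Cauchy_Schwarz:
  assumes "u \<in> L2_per L" "v \<in> L2_per L"
  shows "\<bar>\<integral>x. u x * v x \<partial>per_measure L\<bar> \<le> L2_norm L u * L2_norm L v"
proof -
  let ?M = "per_measure L"
  define A where "A = (\<integral>x. (u x)\<^sup>2 \<partial>?M)"
  define B where "B = (\<integral>x. (v x)\<^sup>2 \<partial>?M)"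
  define C where "C = (\<integral>x. u x * v x \<partial>?M)"
  have i: "integrable ?M (\<lambda>x. (u x)\<^sup>2)" "integrable ?M (\<lambda>x. (v x)\<^sup>2)" "integrable ?M (\<lambda>x. u x * v x)"
    using assms L2_per_integrable_mult by (auto simp: L2_per_iff)
  have q: "0 \<le> s\<^sup>2 * A - 2 * s * t * C + t\<^sup>2 * B" for s t
  proof -
    have "0 \<le> (\<integral>x. (s * u x - t * v x)\<^sup>2 \<partial>?M)" by simp
    also have "(\<lambda>x. (s * u x - t * v x)\<^sup>2) =
        (\<lambda>x. s\<^sup>2 * (u x)\<^sup>2 - (2 * s * t) * (u x * v x) + t\<^sup>2 * (v x)\<^sup>2)"
      by (auto simp: power2_eq_square algebra_simps)
    also have "(\<integral>x. s\<^sup>2 * (u x)\<^sup>2 - (2 * s * t) * (u x * v x) + t\<^sup>2 * (v x)\<^sup>2 \<partial>?M) =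
        s\<^sup>2 * A - 2 * s * t * C + t\<^sup>2 * B"
      using i by (simp add: A_def B_def C_def)
    finally show ?thesis .
  qed
  have A: "0 \<le> A" and B: "0 \<le> B" by (simp_all add: A_def B_def)
  have "C\<^sup>2 \<le> A * B"
  proof (cases "B = 0")
    case True
    have "C = 0"
    proof (rule ccontr)
      assume "C \<noteq> 0"
      \<comment> \<open>For \<open>B = 0\<close> the form is affine in \<open>t\<close>, and this
        value of \<open>t\<close> makes it equal to -1.\<close>
      then show False using q[of 1 "(A + 1) / (2 * C)"] True by simp
    qed
    then show ?thesis using A B by simp
  next
    case False
    \<comment> \<open>At \<open>s = B\<close>, \<open>t = C\<close> the quadratic form factors in
      this way.\<close>
    then have "0 \<le> B * (A * B - C\<^sup>2)"
      using q[of B C] by (simp add: power2_eq_square algebra_simps)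
    then show ?thesis using False B by (simp add: zero_le_mult_iff)
  qed
  then have "sqrt (C\<^sup>2) \<le> sqrt (A * B)" by (rule real_sqrt_le_mono)
  then show ?thesis by (simp add: L2_norm_eq A_def B_def C_def real_sqrt_mult)
qed

lemma L2_norm_nonneg: "0 \<le> L2_norm L u"
  by (simp add: L2_norm_eq)

lemma L2_norm_square: "(L2_norm L u)\<^sup>2 = (\<integral>x. (u x)\<^sup>2 \<partial>per_measure L)"
  by (simp add: L2_norm_eq)

lemma L2_norm_triangle:
  assumes "u \<in> L2_per L" "v \<in> L2_per L"
  shows "L2_norm L (\<lambda>x. u x + v x) \<le> L2_norm L u + L2_norm L v"
proof (rule power2_le_imp_le)
  let ?M = "per_measure L"
  have i: "integrable ?M (\<lambda>x. (u x)\<^sup>2)" "integrable ?M (\<lambda>x. (v x)\<^sup>2)" "integrable ?M (\<lambda>x. u x * v x)"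
    using assms L2_per_integrable_mult by (auto simp: L2_per_iff)
  have "(L2_norm L (\<lambda>x. u x + v x))\<^sup>2 = (\<integral>x. (u x)\<^sup>2 + 2 * (u x * v x) + (v x)\<^sup>2 \<partial>?M)"
    unfolding L2_norm_square by (simp add: power2_sum algebra_simps)
  also have "\<dots> = (L2_norm L u)\<^sup>2 + 2 * (\<integral>x. u x * v x \<partial>?M) + (L2_norm L v)\<^sup>2"
    using i by (simp add: L2_norm_square)
  also have "\<dots> \<le> (L2_norm L u + L2_norm L v)\<^sup>2"
    using L2_Cauchy_Schwarz[OF assms] by (simp add: power2_sum)
  finally show "(L2_norm L (\<lambda>x. u x + v x))\<^sup>2 \<le> (L2_norm L u + L2_norm L v)\<^sup>2" .
qed (simp add: L2_norm_nonneg add_nonneg_nonneg)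

lemma L2_norm_cmult: "L2_norm L (\<lambda>x. c * u x) = \<bar>c\<bar> * L2_norm L u"
  by (simp add: L2_norm_eq power_mult_distrib real_sqrt_mult)

lemma L2_norm_le_bound:
  assumes "0 \<le> L" "u \<in> borel_measurable borel" "0 \<le> B" "AE x in per_measure L. \<bar>u x\<bar> \<le> B"
  shows "L2_norm L u \<le> sqrt L * B"
proof -
  let ?M = "per_measure L"
  interpret finite_measure ?M by (rule finite_per_measure)
  have um: "u \<in> borel_measurable ?M" using assms(2) by (rule borel_measurable_per_measure)
  have b: "AE x in ?M. (u x)\<^sup>2 \<le> B\<^sup>2"
    using assms(4) by eventually_elim (use assms(3) in \<open>simp add: abs_le_square_iff[symmetric]\<close>)
  have "(\<integral>x. (u x)\<^sup>2 \<partial>?M) \<le> (\<integral>x. B\<^sup>2 \<partial>?M)"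
  proof (rule integral_mono_AE)
    show "integrable ?M (\<lambda>x. (u x)\<^sup>2)"
      by (rule integrable_per_measure_bounded[where B="B\<^sup>2"]) (use um b in auto)
  qed (use b in auto)
  also have "\<dots> = L * B\<^sup>2" using measure_per_measure[OF assms(1)] by simp
  finally have "L2_norm L u \<le> sqrt (L * B\<^sup>2)" unfolding L2_norm_eq by (rule real_sqrt_le_mono)
  then show ?thesis using assms by (simp add: real_sqrt_mult)
qed

section \<open>Fourier coefficients and the space \<open>Hs_per 2 L\<close>\<close>

lemma fourier_coeff_diff:
  assumes "integrable (per_measure L) u" "integrable (per_measure L) v"
  shows "fourier_coeff L (\<lambda>x. u x - v x) k = fourier_coeff L u k - fourier_coeff L v k"
proof -
  have "integrable (per_measure L) (\<lambda>x. complex_of_real (u x) * cnj (character L k x))"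
    "integrable (per_measure L) (\<lambda>x. complex_of_real (v x) * cnj (character L k x))"
    unfolding character_uminus[symmetric]
    by (rule integrable_mult_character; use assms in simp)+
  then show ?thesis by (simp add: fourier_coeff_eq left_diff_distrib diff_divide_distrib)
qed

lemma Hs_per_2_iff:
  "u \<in> Hs_per 2 L \<longleftrightarrow> u \<in> L2_per L \<and>
    (\<lambda>k. ((1 + (real_of_int k)\<^sup>2) * cmod (fourier_coeff L u k))\<^sup>2) summable_on UNIV"
proof -
  have "(1 + (real_of_int k)\<^sup>2) powr 2 = (1 + (real_of_int k)\<^sup>2)\<^sup>2" for k
    by (subst powr_numeral) (simp_all add: add_nonneg_nonneg)
  then show ?thesis by (simp add: Hs_per_def power_mult_distrib)
qed

lemma Hs_norm_2_eq:
  "Hs_norm 2 L u = sqrt (L * (\<Sum>\<^sub>\<infinity>k. ((1 + (real_of_int k)\<^sup>2) * cmod (fourier_coeff L u k))\<^sup>2))"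
proof -
  have "(1 + (real_of_int k)\<^sup>2) powr 2 = (1 + (real_of_int k)\<^sup>2)\<^sup>2" for k
    by (subst powr_numeral) (simp_all add: add_nonneg_nonneg)
  then show ?thesis by (simp add: Hs_norm_def power_mult_distrib)
qed

lemma Hs_per_2_diff:
  assumes "u \<in> Hs_per 2 L" "v \<in> Hs_per 2 L"
  shows "(\<lambda>x. u x - v x) \<in> Hs_per 2 L"
proof -
  let ?a = "\<lambda>u k. ((1 + (real_of_int k)\<^sup>2) * cmod (fourier_coeff L u k))\<^sup>2"
  have uv: "u \<in> L2_per L" "v \<in> L2_per L" using assms by (auto simp: Hs_per_2_iff)
  have "(\<lambda>k. 2 * ?a u k + 2 * ?a v k) summable_on UNIV"
    using assms by (intro summable_on_add summable_on_cmult_right) (auto simp: Hs_per_2_iff)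
  then have "?a (\<lambda>x. u x - v x) summable_on UNIV"
  proof (rule summable_on_comparison_test)
    fix k
    have "cmod (fourier_coeff L u k - fourier_coeff L v k) \<le> cmod (fourier_coeff L u k) + cmod (fourier_coeff L v k)"
      by (rule norm_triangle_ineq4)
    then have "(cmod (fourier_coeff L u k - fourier_coeff L v k))\<^sup>2 \<le>
        (cmod (fourier_coeff L u k) + cmod (fourier_coeff L v k))\<^sup>2"
      by (intro power_mono) auto
    also have "\<dots> \<le> 2 * (cmod (fourier_coeff L u k))\<^sup>2 + 2 * (cmod (fourier_coeff L v k))\<^sup>2"
      using sum_squares_bound[of "cmod (fourier_coeff L u k)" "cmod (fourier_coeff L v k)"]
      by (simp add: power2_sum)
    finally have "(1 + (real_of_int k)\<^sup>2)\<^sup>2 * (cmod (fourier_coeff L u k - fourier_coeff L v k))\<^sup>2 \<le>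
      (1 + (real_of_int k)\<^sup>2)\<^sup>2 * (2 * (cmod (fourier_coeff L u k))\<^sup>2 + 2 * (cmod (fourier_coeff L v k))\<^sup>2)"
      by (rule mult_left_mono) simp
    then show "?a (\<lambda>x. u x - v x) k \<le> 2 * ?a u k + 2 * ?a v k"
      using uv by (simp only: fourier_coeff_diff L2_per_integrable power_mult_distrib distrib_left mult.left_commute[of 2])
  qed simp
  then show ?thesis using uv by (simp add: Hs_per_2_iff L2_per_diff)
qed

text \<open>Cauchy-Schwarz against \<open>(1 + \<bar>k\<bar>) / (1 + k\<^sup>2)\<close>, whose
  square is at most \<open>2 / (1 + k\<^sup>2)\<close> and hence summable. The extra factor
  \<open>1 + \<bar>k\<bar>\<close> makes the coefficients of the first weak derivative absolutely
  summable as well.\<close>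

lemma Hs_per_2_summable:
  assumes "u \<in> Hs_per 2 L"
  shows "(\<lambda>k. (1 + \<bar>real_of_int k\<bar>) * cmod (fourier_coeff L u k)) summable_on UNIV"
proof -
  let ?b = "\<lambda>k. (1 + (real_of_int k)\<^sup>2) * cmod (fourier_coeff L u k)"
  let ?a = "\<lambda>k. (1 + \<bar>real_of_int k\<bar>) / (1 + (real_of_int k)\<^sup>2)"
  have pos: "1 + (real_of_int k)\<^sup>2 > 0" for k by (simp add: add_pos_nonneg)
  have "(\<lambda>k. 2 * (1 / (1 + (real_of_int k)\<^sup>2))) summable_on UNIV"
    by (intro summable_on_cmult_right summable_inverse_1_plus_square_int)
  then have "(\<lambda>k. (?a k)\<^sup>2) summable_on UNIV"
  proof (rule summable_on_comparison_test)
    fix k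
    have "(1 + \<bar>real_of_int k\<bar>)\<^sup>2 \<le> 2 * (1 + (real_of_int k)\<^sup>2)"
      using sum_squares_bound[of 1 "\<bar>real_of_int k\<bar>"] by (simp add: power2_sum)
    then have "(1 + \<bar>real_of_int k\<bar>)\<^sup>2 / (1 + (real_of_int k)\<^sup>2)\<^sup>2 \<le>
        2 * (1 + (real_of_int k)\<^sup>2) / (1 + (real_of_int k)\<^sup>2)\<^sup>2"
      by (rule divide_right_mono) simp
    then show "(?a k)\<^sup>2 \<le> 2 * (1 / (1 + (real_of_int k)\<^sup>2))"
      using pos[of k] by (simp only: power_divide power2_eq_square[of "1 + (real_of_int k)\<^sup>2"]
          mult_divide_mult_cancel_right times_divide_eq_right mult_1_right)
  qed simp
  then have "(\<lambda>k. ?a k * ?b k) summable_on UNIV"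
    by (rule Cauchy_Schwarz_infsum(1)) (use assms pos in \<open>auto simp: Hs_per_2_iff add_nonneg_nonneg\<close>)
  moreover have "?a k * ?b k = (1 + \<bar>real_of_int k\<bar>) * cmod (fourier_coeff L u k)" for k
    using pos[of k] by simp
  ultimately show ?thesis by simp
qed

lemma Hs_per_2_abs_summable:
  assumes "u \<in> Hs_per 2 L"
  shows "(\<lambda>k. cmod (fourier_coeff L u k)) summable_on UNIV"
  using Hs_per_2_summable[OF assms]
  by (rule summable_on_comparison_test) (simp_all add: mult_le_cancel_right1 distrib_right)

text \<open>Sobolev embedding: Cauchy-Schwarz bounds the sum of the moduli of the coefficients by
  the \<open>H^2\<close> norm, and this sum bounds the Fourier series. \<open>K\<close> depends on
  \<open>L\<close> only.\<close>

lemma Hs_per_2_sup_bound: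
  assumes L: "L > 0"
  shows "\<exists>K>0. \<forall>u\<in>Hs_per 2 L. AE x in per_measure L. \<bar>u x\<bar> \<le> K * Hs_norm 2 L u"
proof -
  let ?a = "\<lambda>k. 1 / (1 + (real_of_int k)\<^sup>2)"
  have pos: "1 + (real_of_int k)\<^sup>2 > 0" for k by (simp add: add_pos_nonneg)
  have a2: "(\<lambda>k. (?a k)\<^sup>2) summable_on UNIV"
  proof (rule summable_on_comparison_test[OF summable_inverse_1_plus_square_int])
    fix k
    have "0 \<le> ?a k" "?a k \<le> 1" using pos[of k] by (simp_all add: divide_le_eq_1)
    then show "(?a k)\<^sup>2 \<le> ?a k" by (simp only: power2_eq_square mult_left_le)
  qed simp
  \<comment> \<open>Adding 1 gives positivity without evaluating the sum; dividing by
    \<open>sqrt L\<close> cancels the factor \<open>L\<close> inside the norm.\<close>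
  define K where "K = (sqrt (\<Sum>\<^sub>\<infinity>k. (?a k)\<^sup>2) + 1) / sqrt L"
  have "0 \<le> (\<Sum>\<^sub>\<infinity>k. (?a k)\<^sup>2)" by (intro infsum_nonneg) simp
  then have "K > 0" using L by (simp add: K_def add_nonneg_pos)
  moreover have "AE x in per_measure L. \<bar>u x\<bar> \<le> K * Hs_norm 2 L u" if u: "u \<in> Hs_per 2 L" for u
  proof -
    let ?b = "\<lambda>k. (1 + (real_of_int k)\<^sup>2) * cmod (fourier_coeff L u k)"
    have c: "(\<lambda>k. cmod (fourier_coeff L u k)) summable_on UNIV"
      by (rule Hs_per_2_abs_summable[OF u])
    have "(\<Sum>\<^sub>\<infinity>k. ?a k * ?b k) \<le> sqrt (\<Sum>\<^sub>\<infinity>k. (?a k)\<^sup>2) * sqrt (\<Sum>\<^sub>\<infinity>k. (?b k)\<^sup>2)"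
      by (rule Cauchy_Schwarz_infsum(2)[OF a2])
         (use u pos in \<open>auto simp: Hs_per_2_iff add_nonneg_nonneg\<close>)
    also have "\<dots> \<le> (sqrt (\<Sum>\<^sub>\<infinity>k. (?a k)\<^sup>2) + 1) * sqrt (\<Sum>\<^sub>\<infinity>k. (?b k)\<^sup>2)"
      by (intro mult_right_mono) (auto intro!: infsum_nonneg)
    also have "\<dots> = K * Hs_norm 2 L u"
      using L by (simp add: K_def Hs_norm_2_eq real_sqrt_mult)
    finally have *: "(\<Sum>\<^sub>\<infinity>k. ?a k * ?b k) \<le> K * Hs_norm 2 L u" .
    have ab: "?a k * ?b k = cmod (fourier_coeff L u k)" for k using pos[of k] by simp
    have le: "(\<Sum>\<^sub>\<infinity>k. cmod (fourier_coeff L u k)) \<le> K * Hs_norm 2 L u"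
      using * unfolding ab .
    have "integrable (per_measure L) u" using u by (simp add: Hs_per_2_iff L2_per_integrable)
    from fourier_series_AE[OF L this c] show ?thesis
    proof eventually_elim
      case (elim x)
      have "\<bar>u x\<bar> = cmod (\<Sum>\<^sub>\<infinity>k. fourier_coeff L u k * character L k x)"
        using elim by (metis norm_of_real)
      then show ?case using norm_fourier_series_le[OF c, of L x] le by linarith
    qed
  qed
  ultimately show ?thesis by blast
qed

section \<open>Weak derivatives\<close>

text \<open>The phase \<open>b\<close> yields cosines, sines and, for \<open>a = b = 0\<close>, the
  constant 1. Testing a weak derivative with these functions extracts its Fourier coefficients and
  its mean.\<close>

lemma funpow_deriv_cos:
  "(deriv ^^ n) (\<lambda>x. cos (a * x + b)) = (\<lambda>x. a ^ n * cos (a * x + b + of_nat n * (pi / 2)))"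
  for a b :: real
proof (induction n)
  case (Suc n)
  have "deriv (\<lambda>x. a ^ n * cos (a * x + b + of_nat n * (pi / 2))) x =
      a ^ Suc n * cos (a * x + b + of_nat (Suc n) * (pi / 2))" for x
  proof (rule DERIV_imp_deriv)
    have e: "a * x + b + of_nat (Suc n) * (pi / 2) = (a * x + b + of_nat n * (pi / 2)) + pi / 2"
      by (simp add: distrib_right add_divide_distrib)
    have "cos (a * x + b + of_nat (Suc n) * (pi / 2)) = - sin (a * x + b + of_nat n * (pi / 2))"
      unfolding e cos_add by simp
    then show "((\<lambda>x. a ^ n * cos (a * x + b + of_nat n * (pi / 2))) has_real_derivative
        a ^ Suc n * cos (a * x + b + of_nat (Suc n) * (pi / 2))) (at x)"
      by (auto intro!: derivative_eq_intros)
  qed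
  then show ?case using Suc by auto
qed simp

lemma Ck_cos: "Ck n (\<lambda>x. cos (a * x + b))"
  unfolding Ck_def funpow_deriv_cos
proof (intro conjI allI impI)
  fix i and x :: real
  have "((\<lambda>x. a ^ i * cos (a * x + b + of_nat i * (pi / 2))) has_real_derivative
      a ^ i * (- sin (a * x + b + of_nat i * (pi / 2)) * a)) (at x)"
    by (auto intro!: derivative_eq_intros)
  then show "(\<lambda>x. a ^ i * cos (a * x + b + of_nat i * (pi / 2))) differentiable (at x)"
    using real_differentiable_def by blast
qed (intro continuous_intros)

lemma fourier_coeff_weak_deriv:
  assumes L: "L > 0" and w: "weak_deriv_per L u v"
  shows "fourier_coeff L v k = \<i> * complex_of_real (2 * pi * of_int k / L) * fourier_coeff L u k"
proof -
  let ?M = "per_measure L"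
  define a where "a = 2 * pi * of_int k / L"
  have u: "u \<in> L2_per L" and v: "v \<in> L2_per L" using w by (auto simp: weak_deriv_per_def)
  have aL: "a * L = of_int k * (2 * pi)" using L by (simp add: a_def)
  have per: "periodic L (\<lambda>x. cos (a * x + b))" for b
  proof -
    have "cos (a * (x + L) + b) = cos (a * x + b)" for x
    proof -
      have "cos (a * (x + L) + b) = cos ((a * x + b) + of_int k * (2 * pi))"
        unfolding distrib_left aL by (simp add: algebra_simps)
      also have "\<dots> = cos (a * x + b)"
        by (simp add: cos_add mult.commute[of _ "2 * pi"] cos_int_2pin sin_int_2pin)
      finally show ?thesis .
    qed
    then show ?thesis by (simp add: periodic_def)
  qed
  have d: "deriv (\<lambda>x. cos (a * x + b)) = (\<lambda>x. - a * sin (a * x + b))" for b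
    by (rule ext, rule DERIV_imp_deriv) (auto intro!: derivative_eq_intros)
  have test: "(\<integral>x. u x * (- a * sin (a * x + b)) \<partial>?M) = - (\<integral>x. v x * cos (a * x + b) \<partial>?M)" for b
    using w[unfolded weak_deriv_per_def set_integral_eq_per_measure, THEN conjunct2, THEN conjunct2,
        rule_format, of "\<lambda>x. cos (a * x + b)"] Ck_cos per by (simp add: d)
  have "(\<integral>x. u x * (- a * sin (a * x)) \<partial>?M) = - (\<integral>x. v x * cos (a * x) \<partial>?M)"
    using test[of 0] by simp
  moreover have "(\<integral>x. u x * (- a * sin (a * x)) \<partial>?M) = - a * (\<integral>x. u x * sin (a * x) \<partial>?M)"
    by (subst integral_mult_right_zero[symmetric]) (simp add: algebra_simps)
  ultimately have s: "(\<integral>x. v x * cos (a * x) \<partial>?M) = a * (\<integral>x. u x * sin (a * x) \<partial>?M)"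
    by simp
  have "(\<integral>x. u x * (- a * sin (a * x - pi / 2)) \<partial>?M) = - (\<integral>x. v x * cos (a * x - pi / 2) \<partial>?M)"
    using test[of "- pi / 2"] by simp
  then have "(\<integral>x. u x * (a * cos (a * x)) \<partial>?M) = - (\<integral>x. v x * sin (a * x) \<partial>?M)"
    by (simp add: cos_diff sin_diff)
  moreover have "(\<integral>x. u x * (a * cos (a * x)) \<partial>?M) = a * (\<integral>x. u x * cos (a * x) \<partial>?M)"
    by (subst integral_mult_right_zero[symmetric]) (simp add: algebra_simps)
  ultimately have c: "(\<integral>x. v x * sin (a * x) \<partial>?M) = - a * (\<integral>x. u x * cos (a * x) \<partial>?M)"
    by simp
  have f: "fourier_coeff L h k = ((\<integral>x. h x * cos (a * x) \<partial>?M) - \<i> * (\<integral>x. h x * sin (a * x) \<partial>?M)) / L"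
    if h: "h \<in> L2_per L" for h
  proof -
    have trig: "(\<lambda>x. cos (a * x)) \<in> L2_per L" "(\<lambda>x. sin (a * x)) \<in> L2_per L"
      using per[of 0] per[of "- pi / 2"]
      by (auto intro!: continuous_periodic_L2_per continuous_intros simp: cos_diff)
    have "h x * cnj (character L k x) = complex_of_real (h x * cos (a * x)) - \<i> * complex_of_real (h x * sin (a * x))" for x
      by (simp add: character_def a_def complex_eq_iff)
    then have "(\<integral>x. h x * cnj (character L k x) \<partial>?M) =
        (\<integral>x. complex_of_real (h x * cos (a * x)) - \<i> * complex_of_real (h x * sin (a * x)) \<partial>?M)" by simp
    also have "\<dots> = (\<integral>x. h x * cos (a * x) \<partial>?M) - \<i> * (\<integral>x. h x * sin (a * x) \<partial>?M)"
      using L2_per_integrable_mult[OF h trig(1)] L2_per_integrable_mult[OF h trig(2)]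
      by (subst Bochner_Integration.integral_diff) (simp_all del: of_real_mult)
    finally show ?thesis by (simp add: fourier_coeff_eq)
  qed
  have "fourier_coeff L v k = \<i> * complex_of_real a * fourier_coeff L u k"
    unfolding f[OF u] f[OF v] s c by (simp add: complex_eq_iff field_simps)
  then show ?thesis by (simp add: a_def)
qed

section \<open>Classical periodic derivatives as weak derivatives\<close>

lemma integral_derivative_periodic:
  fixes p p' :: "real \<Rightarrow> real"
  assumes L: "L > 0" and p: "\<And>x. (p has_real_derivative p' x) (at x)" and p': "continuous_on UNIV p'"
    and per: "periodic L p"
  shows "(\<integral>x. p' x \<partial>per_measure L) = 0"
proof -
  have "(LBINT x. indicator {0..L} x *\<^sub>R p' x) = p L - p 0"
    by (rule integral_FTC_atLeastAtMost)
       (use L continuous_on_subset[OF p'] has_vector_derivative_at_within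
          [OF p[unfolded has_real_derivative_iff_has_vector_derivative]] in auto)
  moreover have "p L = p 0" using per unfolding periodic_def by (metis add_0)
  ultimately show ?thesis by (simp add: integral_restrict_space)
qed

lemma periodic_derivative:
  assumes p: "\<And>x. (p has_real_derivative p' x) (at x)" and per: "periodic L p"
  shows "periodic L p'"
proof -
  have "p' (x + L) = p' x" for x
  proof (rule DERIV_unique)
    have "((\<lambda>y. p (y + L)) has_real_derivative p' (x + L)) (at x)"
      using p[of "x + L"] by (simp add: DERIV_shift)
    moreover have "(\<lambda>y. p (y + L)) = p" using per by (auto simp: periodic_def)
    ultimately show "(p has_real_derivative p' (x + L)) (at x)" by simp
  qed (rule p)
  then show ?thesis by (simp add: periodic_def)
qed

text \<open>The product of \<open>p\<close> with a test function is periodic, so its derivative has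
  integral 0 over a period.\<close>

lemma weak_deriv_per_C1:
  fixes p p' :: "real \<Rightarrow> real"
  assumes L: "L > 0" and p: "\<And>x. (p has_real_derivative p' x) (at x)" and p': "continuous_on UNIV p'"
    and per: "periodic L p"
  shows "weak_deriv_per L p p'"
  unfolding weak_deriv_per_def set_integral_eq_per_measure
proof (intro conjI allI impI)
  have cp: "continuous_on UNIV p" by (meson DERIV_isCont continuous_at_imp_continuous_on p)
  show "p \<in> L2_per L" using cp per by (rule continuous_periodic_L2_per)
  show "p' \<in> L2_per L" using p' periodic_derivative[OF p per] by (rule continuous_periodic_L2_per)
  fix h assume h: "(\<forall>n. Ck n h) \<and> periodic L h"
  then have "Ck 1 h" by blast
  then have hd: "(h has_real_derivative deriv h x) (at x)" and hc: "continuous_on UNIV (deriv h)" for x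
    by (auto simp: Ck_def DERIV_deriv_iff_real_differentiable)
  have ch: "continuous_on UNIV h" by (meson DERIV_isCont continuous_at_imp_continuous_on hd)
  have "(\<integral>x. p' x * h x + p x * deriv h x \<partial>per_measure L) = 0"
  proof (rule integral_derivative_periodic[OF L])
    show "((\<lambda>x. p x * h x) has_real_derivative p' x * h x + p x * deriv h x) (at x)" for x
      using DERIV_mult[OF p hd] by (simp add: algebra_simps)
    show "periodic L (\<lambda>x. p x * h x)" using per h by (simp add: periodic_def)
  qed (intro continuous_intros p' ch cp hc)
  moreover have "integrable (per_measure L) (\<lambda>x. p' x * h x)" "integrable (per_measure L) (\<lambda>x. p x * deriv h x)"
    by (intro integrable_per_measure_continuous continuous_intros p' ch cp hc)+
  ultimately show "(\<integral>x. p x * deriv h x \<partial>per_measure L) = - (\<integral>x. p' x * h x \<partial>per_measure L)"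
    by simp
qed

lemma weak_deriv_per_diff:
  assumes u: "weak_deriv_per L u u'" and v: "weak_deriv_per L v v'"
  shows "weak_deriv_per L (\<lambda>x. u x - v x) (\<lambda>x. u' x - v' x)"
  unfolding weak_deriv_per_def set_integral_eq_per_measure
proof (intro conjI allI impI)
  show "(\<lambda>x. u x - v x) \<in> L2_per L" "(\<lambda>x. u' x - v' x) \<in> L2_per L"
    using assms by (auto simp: weak_deriv_per_def intro: L2_per_diff)
  fix h assume h: "(\<forall>n. Ck n h) \<and> periodic L h"
  then have "Ck 1 h" by blast
  then have hd: "(h has_real_derivative deriv h x) (at x)" and hc: "continuous_on UNIV (deriv h)" for x
    by (auto simp: Ck_def DERIV_deriv_iff_real_differentiable)
  have ch: "continuous_on UNIV h" by (meson DERIV_isCont continuous_at_imp_continuous_on hd)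
  have h2: "h \<in> L2_per L" using ch h by (simp add: continuous_periodic_L2_per)
  have h'2: "deriv h \<in> L2_per L"
    using hc h periodic_derivative[OF hd] by (simp add: continuous_periodic_L2_per)
  have L2: "u \<in> L2_per L" "v \<in> L2_per L" "u' \<in> L2_per L" "v' \<in> L2_per L"
    using assms by (auto simp: weak_deriv_per_def)
  have "(\<integral>x. u x * deriv h x \<partial>per_measure L) = - (\<integral>x. u' x * h x \<partial>per_measure L)"
    "(\<integral>x. v x * deriv h x \<partial>per_measure L) = - (\<integral>x. v' x * h x \<partial>per_measure L)"
    using u v h by (auto simp: weak_deriv_per_def set_integral_eq_per_measure)
  then show "(\<integral>x. (u x - v x) * deriv h x \<partial>per_measure L) = - (\<integral>x. (u' x - v' x) * h x \<partial>per_measure L)"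
    using L2_per_integrable_mult[OF L2(1) h'2] L2_per_integrable_mult[OF L2(2) h'2]
      L2_per_integrable_mult[OF L2(3) h2] L2_per_integrable_mult[OF L2(4) h2]
    by (simp add: left_diff_distrib)
qed

lemma integral_weak_deriv:
  assumes "weak_deriv_per L u v"
  shows "(\<integral>x. v x \<partial>per_measure L) = 0"
proof -
  have "Ck n (\<lambda>x. 1)" for n using Ck_cos[of n 0 0] by simp
  then have "(\<integral>x. u x * deriv (\<lambda>x. 1) x \<partial>per_measure L) = - (\<integral>x. v x * 1 \<partial>per_measure L)"
    using assms[unfolded weak_deriv_per_def set_integral_eq_per_measure,
        THEN conjunct2, THEN conjunct2, rule_format, of "\<lambda>x. 1"] by (simp add: periodic_def)
  then show ?thesis by simp
qed

text \<open>The coefficients of the continuous function \<open>p3\<close> are bounded, so those of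
  \<open>p\<close> decay like the inverse cube of the index. After multiplication by the weight
  \<open>1 + k\<^sup>2\<close> a square-summable sequence of order 1/k remains.\<close>

lemma Hs_per_2_C3:
  fixes p p1 p2 p3 :: "real \<Rightarrow> real"
  assumes L: "L > 0" and per: "periodic L p"
    and p: "\<And>x. (p has_real_derivative p1 x) (at x)"
    and p1: "\<And>x. (p1 has_real_derivative p2 x) (at x)"
    and p2: "\<And>x. (p2 has_real_derivative p3 x) (at x)"
    and p3: "continuous_on UNIV p3"
  shows "p \<in> Hs_per 2 L"
proof -
  have c: "continuous_on UNIV p2" "continuous_on UNIV p1" "continuous_on UNIV p"
    by (meson DERIV_isCont continuous_at_imp_continuous_on p p1 p2)+
  have per1: "periodic L p1" by (rule periodic_derivative[OF p per])
  have per2: "periodic L p2" by (rule periodic_derivative[OF p1 per1])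
  define q where "q k = 2 * pi * real_of_int k / L" for k
  have f3: "fourier_coeff L p3 k = (\<i> * complex_of_real (q k)) ^ 3 * fourier_coeff L p k" for k
    using fourier_coeff_weak_deriv[OF L weak_deriv_per_C1[OF L p c(2) per], of k]
      fourier_coeff_weak_deriv[OF L weak_deriv_per_C1[OF L p1 c(1) per1], of k]
      fourier_coeff_weak_deriv[OF L weak_deriv_per_C1[OF L p2 p3 per2], of k]
    by (simp add: q_def power3_eq_cube mult.assoc)
  define B where "B = (\<integral>x. \<bar>p3 x\<bar> \<partial>per_measure L) / L"
  have B: "cmod (fourier_coeff L p3 k) \<le> B" for k
  proof -
    have "cmod (\<integral>x. p3 x * cnj (character L k x) \<partial>per_measure L) \<le>
      (\<integral>x. cmod (p3 x * cnj (character L k x)) \<partial>per_measure L)"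
      by (rule integral_norm_bound)
    then show ?thesis using L by (simp add: fourier_coeff_eq B_def norm_divide norm_mult divide_right_mono)
  qed
  \<comment> \<open>For \<open>k \<noteq> 0\<close> and \<open>s = k\<^sup>2\<close> one has
    \<open>(1 + s) ^ 3 \<le> 8 * s ^ 3\<close>, and \<open>s ^ 3\<close> is the sixth power of
    \<open>q k\<close> times \<open>(L / (2 * pi)) ^ 6\<close>. Index 0 is set aside, since
    \<open>q 0 = 0\<close> gives no bound there, and is put back as a single term at the
    end.\<close>
  define D where "D = 8 * B\<^sup>2 * (L / (2 * pi)) ^ 6"
  have "(\<lambda>k. D * (1 / (1 + (real_of_int k)\<^sup>2))) summable_on (UNIV - {0})"
    by (intro summable_on_cmult_right summable_on_subset_banach[OF summable_inverse_1_plus_square_int]) auto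
  then have "(\<lambda>k. ((1 + (real_of_int k)\<^sup>2) * cmod (fourier_coeff L p k))\<^sup>2) summable_on (UNIV - {0})"
  proof (rule summable_on_comparison_test)
    fix k :: int assume "k \<in> UNIV - {0}"
    then have k: "k \<noteq> 0" by simp
    define s where "s = (real_of_int k)\<^sup>2"
    have "\<bar>k\<bar> \<ge> 1" using k by linarith
    then have "1 \<le> \<bar>real_of_int k\<bar>" by linarith
    then have s: "s \<ge> 1" unfolding s_def using abs_le_square_iff[of 1 "real_of_int k"] by simp
    have q6: "(q k) ^ 6 = s ^ 3 / (L / (2 * pi)) ^ 6"
      using L by (simp add: q_def s_def power_divide power_mult_distrib power_mult[symmetric])
    have "cmod (fourier_coeff L p3 k) = \<bar>q k\<bar> ^ 3 * cmod (fourier_coeff L p k)"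
      unfolding f3 by (simp add: norm_mult norm_power)
    then have "(cmod (fourier_coeff L p3 k))\<^sup>2 = (q k) ^ 6 * (cmod (fourier_coeff L p k))\<^sup>2"
      by (simp add: power_mult_distrib power_mult[symmetric] power_even_abs)
    moreover have "(cmod (fourier_coeff L p3 k))\<^sup>2 \<le> B\<^sup>2" using B by (intro power_mono) auto
    ultimately have "s ^ 3 / (L / (2 * pi)) ^ 6 * (cmod (fourier_coeff L p k))\<^sup>2 \<le> B\<^sup>2" using q6 by simp
    then have m: "s ^ 3 * (cmod (fourier_coeff L p k))\<^sup>2 \<le> B\<^sup>2 * (L / (2 * pi)) ^ 6"
      using L by (simp add: field_simps)
    have "(1 + s) ^ 3 \<le> (2 * s) ^ 3" using s by (intro power_mono) auto
    then have "(1 + s) ^ 3 * (cmod (fourier_coeff L p k))\<^sup>2 \<le> (2 * s) ^ 3 * (cmod (fourier_coeff L p k))\<^sup>2"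
      by (rule mult_right_mono) simp
    also have "\<dots> \<le> D" using m by (simp add: D_def power_mult_distrib)
    finally have "(1 + s) * ((1 + s)\<^sup>2 * (cmod (fourier_coeff L p k))\<^sup>2) \<le> D"
      by (simp only: power3_eq_cube power2_eq_square mult.assoc)
    then show "((1 + (real_of_int k)\<^sup>2) * cmod (fourier_coeff L p k))\<^sup>2 \<le> D * (1 / (1 + (real_of_int k)\<^sup>2))"
      using s unfolding s_def[symmetric] power_mult_distrib by (simp add: pos_le_divide_eq mult.commute)
  qed simp
  then have "(\<lambda>k. ((1 + (real_of_int k)\<^sup>2) * cmod (fourier_coeff L p k))\<^sup>2) summable_on insert 0 (UNIV - {0})"
    by (subst summable_on_insert_iff)
  moreover have "insert 0 (UNIV - {0}) = (UNIV :: int set)" by auto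
  ultimately show ?thesis
    using continuous_periodic_L2_per[OF c(3) per] by (simp add: Hs_per_2_iff)
qed

text \<open>Weak derivatives may be tested against smooth functions only, and \<open>w\<close> is
  not smooth. Instead both sides are expanded by Parseval and compared term by term: the factor
  \<open>\<i> * q k\<close> changes sign when it moves across the conjugation. Absolute summability
  is needed only for \<open>w\<close> in one series and for \<open>wx\<close> in the other, and
  \<open>H^2\<close> gives both.\<close>

lemma integration_by_parts_weak:
  assumes L: "L > 0" and w: "w \<in> Hs_per 2 L"
    and wx: "weak_deriv_per L w wx" and Fx: "weak_deriv_per L F Fx"
  shows "(\<integral>x. w x * Fx x \<partial>per_measure L) = - (\<integral>x. wx x * F x \<partial>per_measure L)"
proof -
  define q where "q k = 2 * pi * real_of_int k / L" for k
  have L2: "wx \<in> L2_per L" "F \<in> L2_per L" "Fx \<in> L2_per L" "w \<in> L2_per L"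
    using wx Fx by (auto simp: weak_deriv_per_def)
  note i = L2[THEN L2_per_integrable]
  have fw: "fourier_coeff L wx k = \<i> * complex_of_real (q k) * fourier_coeff L w k" for k
    using fourier_coeff_weak_deriv[OF L wx] by (simp add: q_def)
  have fF: "fourier_coeff L Fx k = \<i> * complex_of_real (q k) * fourier_coeff L F k" for k
    using fourier_coeff_weak_deriv[OF L Fx] by (simp add: q_def)
  have "(\<lambda>k. (2 * pi / L) * ((1 + \<bar>real_of_int k\<bar>) * cmod (fourier_coeff L w k))) summable_on UNIV"
    by (intro summable_on_cmult_right Hs_per_2_summable w)
  then have swx: "(\<lambda>k. cmod (fourier_coeff L wx k)) summable_on UNIV"
    by (rule summable_on_comparison_test)
       (use L in \<open>auto simp: fw q_def norm_mult norm_divide abs_mult abs_divide divide_right_mono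
          mult_right_mono mult_left_mono\<close>)
  have "((\<lambda>k. L * Re (fourier_coeff L w k * cnj (fourier_coeff L Fx k))) has_sum
      (\<integral>x. w x * Fx x \<partial>per_measure L)) UNIV"
    by (rule Parseval_abs_summable[OF L i(4,3) Hs_per_2_abs_summable[OF w]])
  moreover have "((\<lambda>k. - (L * Re (fourier_coeff L wx k * cnj (fourier_coeff L F k)))) has_sum
      - (\<integral>x. wx x * F x \<partial>per_measure L)) UNIV"
    by (rule has_sum_uminusI, rule Parseval_abs_summable[OF L i(1,2) swx])
  moreover have "L * Re (fourier_coeff L w k * cnj (fourier_coeff L Fx k)) =
      - (L * Re (fourier_coeff L wx k * cnj (fourier_coeff L F k)))" for k
    by (simp add: fw fF algebra_simps)
  ultimately show ?thesis using has_sum_unique by (metis (no_types, lifting) has_sum_cong)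
qed

text \<open>The squared mean accounts for exactly the term of index 0. At every other index
  \<open>k\<^sup>2\<close> is at least 1, so differentiation multiplies the squared modulus of the
  coefficient by at least \<open>(2 * pi / L)\<^sup>2\<close>.\<close>

lemma Poincare_inequality:
  assumes L: "L > 0" and w: "w \<in> Hs_per 2 L" and wx: "weak_deriv_per L w wx"
  shows "(2 * pi / L)\<^sup>2 * ((\<integral>x. (w x)\<^sup>2 \<partial>per_measure L) - (\<integral>x. w x \<partial>per_measure L)\<^sup>2 / L)
    \<le> (\<integral>x. (wx x)\<^sup>2 \<partial>per_measure L)"
proof -
  let ?M = "per_measure L"
  define q where "q k = 2 * pi * real_of_int k / L" for k
  let ?c = "fourier_coeff L w"
  have L2: "wx \<in> L2_per L" "w \<in> L2_per L" using wx by (auto simp: weak_deriv_per_def)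
  note i = L2[THEN L2_per_integrable]
  have fw: "fourier_coeff L wx k = \<i> * complex_of_real (q k) * ?c k" for k
    using fourier_coeff_weak_deriv[OF L wx] by (simp add: q_def)
  have "(\<lambda>k. (2 * pi / L) * ((1 + \<bar>real_of_int k\<bar>) * cmod (?c k))) summable_on UNIV"
    by (intro summable_on_cmult_right Hs_per_2_summable w)
  then have swx: "(\<lambda>k. cmod (fourier_coeff L wx k)) summable_on UNIV"
    by (rule summable_on_comparison_test)
       (use L in \<open>auto simp: fw q_def norm_mult norm_divide abs_mult abs_divide divide_right_mono
          mult_right_mono mult_left_mono\<close>)
  have re: "Re (z * cnj z) = (cmod z)\<^sup>2" for z
    by (subst cmod_power2) (simp add: power2_eq_square)
  have N: "((\<lambda>k. L * (cmod (?c k))\<^sup>2) has_sum (\<integral>x. (w x)\<^sup>2 \<partial>?M)) UNIV"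
    using Parseval_abs_summable[OF L i(2,2) Hs_per_2_abs_summable[OF w]]
    unfolding re by (simp add: power2_eq_square)
  have D: "((\<lambda>k. L * (cmod (fourier_coeff L wx k))\<^sup>2) has_sum (\<integral>x. (wx x)\<^sup>2 \<partial>?M)) UNIV"
    using Parseval_abs_summable[OF L i(1,1) swx]
    unfolding re by (simp add: power2_eq_square)
  have c0: "?c 0 = complex_of_real ((\<integral>x. w x \<partial>?M) / L)" by (simp add: fourier_coeff_eq)
  have A: "((\<lambda>k. if k = 0 then L * (cmod (?c 0))\<^sup>2 else 0) has_sum ((\<integral>x. w x \<partial>?M)\<^sup>2 / L)) UNIV"
    by (rule has_sum_finite_neutralI[of "{0}"])
       (use L in \<open>auto simp: c0 norm_divide power_divide power2_eq_square\<close>)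
  have "((\<lambda>k. (2 * pi / L)\<^sup>2 * (L * (cmod (?c k))\<^sup>2 + - (if k = 0 then L * (cmod (?c 0))\<^sup>2 else 0))) has_sum
      ((2 * pi / L)\<^sup>2 * ((\<integral>x. (w x)\<^sup>2 \<partial>?M) + - ((\<integral>x. w x \<partial>?M)\<^sup>2 / L)))) UNIV"
    by (intro has_sum_cmult_right has_sum_add N has_sum_uminusI A)
  then have "(2 * pi / L)\<^sup>2 * ((\<integral>x. (w x)\<^sup>2 \<partial>?M) + - ((\<integral>x. w x \<partial>?M)\<^sup>2 / L)) \<le> (\<integral>x. (wx x)\<^sup>2 \<partial>?M)"
  proof (rule has_sum_mono[OF _ D])
    fix k
    show "(2 * pi / L)\<^sup>2 * (L * (cmod (?c k))\<^sup>2 + - (if k = 0 then L * (cmod (?c 0))\<^sup>2 else 0))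
        \<le> L * (cmod (fourier_coeff L wx k))\<^sup>2"
    proof (cases "k = 0")
      case False
      then have "\<bar>k\<bar> \<ge> 1" by linarith
      then have "1 \<le> \<bar>real_of_int k\<bar>" by linarith
      then have one: "1 \<le> (real_of_int k)\<^sup>2" using abs_le_square_iff[of 1 "real_of_int k"] by simp
      have e: "L * (cmod (fourier_coeff L wx k))\<^sup>2 =
          (real_of_int k)\<^sup>2 * ((2 * pi / L)\<^sup>2 * (L * (cmod (?c k))\<^sup>2))"
        by (simp add: fw norm_mult norm_divide q_def power_mult_distrib power_divide abs_mult)
      have nonneg: "0 \<le> (2 * pi / L)\<^sup>2 * (L * (cmod (?c k))\<^sup>2)" using L by simp
      show ?thesis unfolding e using False mult_right_mono[OF one nonneg]
        by (simp only: if_False minus_zero add_0_right mult_1)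
    qed (use L in simp)
  qed
  then show ?thesis by simp
qed

section \<open>Growth of perturbations\<close>

text \<open>Supplies square-integrability together with the norm bound. Both are needed for the
  nonlinear reaction difference, which is known only to be measurable and comparable to
  \<open>w\<close>.\<close>

lemma L2_per_dominated:
  assumes "h \<in> borel_measurable borel" "periodic L h" "w \<in> L2_per L"
    and le: "AE x in per_measure L. \<bar>h x\<bar> \<le> B * \<bar>w x\<bar>"
  shows "h \<in> L2_per L" and "0 \<le> B \<Longrightarrow> L2_norm L h \<le> B * L2_norm L w"
proof -
  let ?M = "per_measure L"
  have sq: "AE x in ?M. (h x)\<^sup>2 \<le> B\<^sup>2 * (w x)\<^sup>2"
    using le
  proof eventually_elim
    case (elim x)
    then have "\<bar>h x\<bar>\<^sup>2 \<le> (B * \<bar>w x\<bar>)\<^sup>2" by (intro power_mono) auto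
    then show ?case by (simp add: power_mult_distrib)
  qed
  have hm: "h \<in> borel_measurable ?M" using assms(1) by (rule borel_measurable_per_measure)
  have wi: "integrable ?M (\<lambda>x. B\<^sup>2 * (w x)\<^sup>2)" using assms(3) by (simp add: L2_per_iff)
  have hi: "integrable ?M (\<lambda>x. (h x)\<^sup>2)"
    by (rule Bochner_Integration.integrable_bound[OF wi]) (use hm sq in auto)
  then show "h \<in> L2_per L" using assms by (simp add: L2_per_iff)
  assume B: "0 \<le> B"
  have "(\<integral>x. (h x)\<^sup>2 \<partial>?M) \<le> (\<integral>x. B\<^sup>2 * (w x)\<^sup>2 \<partial>?M)"
    by (rule integral_mono_AE[OF hi wi sq])
  then have "sqrt (\<integral>x. (h x)\<^sup>2 \<partial>?M) \<le> sqrt (B\<^sup>2 * (\<integral>x. (w x)\<^sup>2 \<partial>?M))"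
    by (intro real_sqrt_le_mono) simp
  then show "L2_norm L h \<le> B * L2_norm L w"
    using B by (simp add: L2_norm_eq real_sqrt_mult)
qed

lemma L2_norm_1: "L > 0 \<Longrightarrow> L2_norm L (\<lambda>x. 1) = sqrt L"
  using measure_per_measure[of L] by (simp add: L2_norm_eq)

lemma mean_square_le:
  assumes L: "L > 0" and w: "w \<in> L2_per L"
  shows "(\<integral>x. w x \<partial>per_measure L)\<^sup>2 / L \<le> (\<integral>x. (w x)\<^sup>2 \<partial>per_measure L)"
proof -
  have "\<bar>\<integral>x. w x * 1 \<partial>per_measure L\<bar> \<le> L2_norm L w * sqrt L"
    using L2_Cauchy_Schwarz[OF w L2_per_const[of 1]] L2_norm_1[OF L] by simp
  then have "\<bar>\<integral>x. w x \<partial>per_measure L\<bar>\<^sup>2 \<le> (L2_norm L w * sqrt L)\<^sup>2" by (intro power_mono) auto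
  then show ?thesis using L by (simp add: power_mult_distrib L2_norm_square divide_le_eq)
qed

text \<open>A statement at one fixed time: \<open>v\<close> stands for the time derivative of
  \<open>w\<close>, so that the right-hand side is the derivative of \<open>V\<close>, and
  \<open>F\<close>, \<open>G\<close> stand for the differences of flux and reaction between
  \<open>u\<close> and the wave. The second condition on \<open>\<kappa>\<close> demands twice the
  loss from the Poincare constant; this factor turns the error into a multiple of \<open>V\<close>
  itself.\<close>

lemma energy_inequality:
  fixes w wx wxx F Fx G v :: "real \<Rightarrow> real"
  assumes L: "L > 0" and w: "w \<in> Hs_per 2 L"
    and wx: "weak_deriv_per L w wx" and wxx: "weak_deriv_per L wx wxx" and Fx: "weak_deriv_per L F Fx"
    and G: "G \<in> borel_measurable borel" "periodic L G"
    and v: "v \<in> L2_per L" "AE x in per_measure L. v x = wxx x - Fx x + G x"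
    and \<kappa>: "0 \<le> \<kappa>" "2 * (6 * \<kappa> + \<kappa>\<^sup>2) \<le> (2 * pi / L)\<^sup>2"
    and F_lin: "AE x in per_measure L. \<bar>F x - a * w x\<bar> \<le> \<kappa> * \<bar>w x\<bar>"
    and G_lin: "AE x in per_measure L. \<bar>G x - \<gamma> * w x\<bar> \<le> \<kappa> * \<bar>w x\<bar>"
  shows "(2 * \<gamma> - (6 * \<kappa> + \<kappa>\<^sup>2)) *
      (2 * (\<integral>x. w x \<partial>per_measure L)\<^sup>2 / L - (\<integral>x. (w x)\<^sup>2 \<partial>per_measure L))
    \<le> 4 * (\<integral>x. w x \<partial>per_measure L) * (\<integral>x. v x \<partial>per_measure L) / L
        - 2 * (\<integral>x. w x * v x \<partial>per_measure L)"
proof -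
  let ?M = "per_measure L"
  define m where "m = (\<integral>x. w x \<partial>?M)"
  define n where "n = L2_norm L w"
  define d where "d = L2_norm L wx"
  have L2: "w \<in> L2_per L" "wx \<in> L2_per L" "wxx \<in> L2_per L" "F \<in> L2_per L" "Fx \<in> L2_per L"
    using wx wxx Fx by (auto simp: weak_deriv_per_def)
  have G': "(\<lambda>x. G x - \<gamma> * w x) \<in> L2_per L" "L2_norm L (\<lambda>x. G x - \<gamma> * w x) \<le> \<kappa> * n"
  proof -
    have "(\<lambda>x. G x - \<gamma> * w x) \<in> borel_measurable borel"
      using G(1) L2(1) by (auto simp: L2_per_iff intro!: borel_measurable_diff borel_measurable_times)
    moreover have "periodic L (\<lambda>x. G x - \<gamma> * w x)"
      using G(2) L2(1) by (auto simp: L2_per_iff periodic_def)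
    ultimately show "(\<lambda>x. G x - \<gamma> * w x) \<in> L2_per L" "L2_norm L (\<lambda>x. G x - \<gamma> * w x) \<le> \<kappa> * n"
      using L2_per_dominated[OF _ _ L2(1) G_lin] \<kappa>(1) by (auto simp: n_def)
  qed
  have F': "(\<lambda>x. F x - a * w x) \<in> L2_per L" "L2_norm L (\<lambda>x. F x - a * w x) \<le> \<kappa> * n"
  proof -
    show F': "(\<lambda>x. F x - a * w x) \<in> L2_per L" by (intro L2_per_diff L2_per_cmult L2)
    then show "L2_norm L (\<lambda>x. F x - a * w x) \<le> \<kappa> * n"
      using L2_per_dominated(2)[OF _ _ L2(1) F_lin] \<kappa>(1) by (auto simp: n_def L2_per_iff)
  qed
  have G2: "G \<in> L2_per L" using L2_per_add[OF G'(1) L2_per_cmult[OF L2(1), of \<gamma>]] by simp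
  have n: "n \<ge> 0" and d: "d \<ge> 0" by (simp_all add: n_def d_def L2_norm_nonneg)
  have N: "(\<integral>x. (w x)\<^sup>2 \<partial>?M) = n\<^sup>2" by (simp add: n_def L2_norm_square)
  have m_le: "\<bar>m\<bar> \<le> n * sqrt L"
    using L2_Cauchy_Schwarz[OF L2(1) L2_per_const[of 1]] L2_norm_1[OF L] by (simp add: m_def n_def)
  have vm: "v \<in> borel_measurable ?M" using v(1) by (rule L2_per_measurable)
  \<comment> \<open>Weak derivatives have mean 0, so only the reaction drives the mean of
    \<open>w\<close>.\<close>
  have "(\<integral>x. v x \<partial>?M) = (\<integral>x. wxx x - Fx x + G x \<partial>?M)"
    by (intro integral_cong_AE vm v(2) borel_measurable_add borel_measurable_diff L2_per_measurable L2 G2)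
  also have "\<dots> = (\<integral>x. G x \<partial>?M)"
    using L2(3,5) G2 integral_weak_deriv[OF wxx] integral_weak_deriv[OF Fx] by (simp add: L2_per_integrable)
  also have "\<dots> = (\<integral>x. (G x - \<gamma> * w x) * 1 + \<gamma> * w x \<partial>?M)" by simp
  also have "\<dots> = (\<integral>x. (G x - \<gamma> * w x) * 1 \<partial>?M) + \<gamma> * m"
    using L2_per_integrable[OF G'(1)] L2_per_integrable[OF L2(1)]
    by (subst Bochner_Integration.integral_add) (simp_all add: m_def)
  finally have intv: "(\<integral>x. v x \<partial>?M) = (\<integral>x. (G x - \<gamma> * w x) * 1 \<partial>?M) + \<gamma> * m" .
  define R where "R = (\<integral>x. (G x - \<gamma> * w x) * 1 \<partial>?M)"
  have "\<bar>R\<bar> \<le> L2_norm L (\<lambda>x. G x - \<gamma> * w x) * sqrt L"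
    using L2_Cauchy_Schwarz[OF G'(1) L2_per_const[of 1]] L2_norm_1[OF L] by (simp add: R_def)
  also have "\<dots> \<le> \<kappa> * n * sqrt L" using G'(2) L by (intro mult_right_mono) auto
  finally have R: "\<bar>R\<bar> \<le> \<kappa> * n * sqrt L" .
  have "\<bar>m * R\<bar> \<le> (n * sqrt L) * (\<kappa> * n * sqrt L)"
    unfolding abs_mult by (intro mult_mono m_le R) (use n L in auto)
  also have "\<dots> = \<kappa> * n\<^sup>2 * L" using L by (simp add: power2_eq_square)
  finally have mR: "- (\<kappa> * n\<^sup>2) \<le> m * R / L" using L by (simp add: pos_le_divide_eq abs_le_iff)
  then have e1: "4 * m * (\<integral>x. v x \<partial>?M) / L \<ge> 4 * \<gamma> * (m\<^sup>2 / L) - 4 * \<kappa> * n\<^sup>2"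
  proof -
    have "4 * m * (\<integral>x. v x \<partial>?M) / L = 4 * \<gamma> * (m\<^sup>2 / L) + 4 * (m * R / L)"
      unfolding intv R_def[symmetric] by (simp add: power2_eq_square distrib_left add_divide_distrib mult_ac)
    then show ?thesis using mR by linarith
  qed

  note int = L2_per_integrable_mult[OF L2(1)]
  have "(\<integral>x. w x * v x \<partial>?M) = (\<integral>x. w x * wxx x - w x * Fx x + (\<gamma> * (w x)\<^sup>2 + w x * (G x - \<gamma> * w x)) \<partial>?M)"
  proof (rule integral_cong_AE)
    show "(\<lambda>x. w x * v x) \<in> borel_measurable ?M"
      by (intro borel_measurable_times vm L2_per_measurable L2)
    show "(\<lambda>x. w x * wxx x - w x * Fx x + (\<gamma> * (w x)\<^sup>2 + w x * (G x - \<gamma> * w x))) \<in> borel_measurable ?M"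
      by (intro borel_measurable_add borel_measurable_diff borel_measurable_times borel_measurable_power
          borel_measurable_const L2_per_measurable L2 G2)
    show "AE x in ?M. w x * v x = w x * wxx x - w x * Fx x + (\<gamma> * (w x)\<^sup>2 + w x * (G x - \<gamma> * w x))"
      using v(2)
    proof eventually_elim
      case (elim x)
      show ?case unfolding elim by (simp add: algebra_simps power2_eq_square)
    qed
  qed
  also have "\<dots> = (\<integral>x. w x * wxx x \<partial>?M) - (\<integral>x. w x * Fx x \<partial>?M) +
      (\<gamma> * n\<^sup>2 + (\<integral>x. w x * (G x - \<gamma> * w x) \<partial>?M))"
  proof -
    have "integrable ?M (\<lambda>x. (w x)\<^sup>2)" using L2(1) by (simp add: L2_per_iff)
    then show ?thesis using int[OF L2(3)] int[OF L2(5)] int[OF G'(1)] N by simp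
  qed
  also have "(\<integral>x. w x * wxx x \<partial>?M) = - d\<^sup>2"
    using integration_by_parts_weak[OF L w wx wxx]
    by (simp add: d_def L2_norm_square power2_eq_square[symmetric])
  also have "(\<integral>x. w x * Fx x \<partial>?M) = - (\<integral>x. wx x * F x \<partial>?M)"
    by (rule integration_by_parts_weak[OF L w wx Fx])
  \<comment> \<open>\<open>wx\<close> is orthogonal to \<open>w\<close>, so the linear part
    \<open>a * w\<close> of the flux drops out and only its deviation, of size
    \<open>\<kappa>\<close>, is left.\<close>
  also have "(\<integral>x. wx x * F x \<partial>?M) = (\<integral>x. wx x * (F x - a * w x) \<partial>?M)"
  proof -
    have "(\<integral>x. w x * wx x \<partial>?M) = - (\<integral>x. wx x * w x \<partial>?M)"
      by (rule integration_by_parts_weak[OF L w wx wx])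
    then have z: "(\<integral>x. wx x * w x \<partial>?M) = 0" by (simp add: mult.commute)
    have "(\<integral>x. wx x * F x \<partial>?M) = (\<integral>x. wx x * (F x - a * w x) + a * (wx x * w x) \<partial>?M)"
      by (simp add: algebra_simps)
    also have "\<dots> = (\<integral>x. wx x * (F x - a * w x) \<partial>?M) + a * (\<integral>x. wx x * w x \<partial>?M)"
      using L2_per_integrable_mult[OF L2(2) F'(1)] L2_per_integrable_mult[OF L2(2) L2(1)] by simp
    finally show ?thesis using z by simp
  qed
  finally have intwv: "(\<integral>x. w x * v x \<partial>?M) = - d\<^sup>2 + (\<integral>x. wx x * (F x - a * w x) \<partial>?M) +
      \<gamma> * n\<^sup>2 + (\<integral>x. w x * (G x - \<gamma> * w x) \<partial>?M)" by simp
  define X where "X = (\<integral>x. wx x * (F x - a * w x) \<partial>?M)"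
  define Y where "Y = (\<integral>x. w x * (G x - \<gamma> * w x) \<partial>?M)"
  have X: "\<bar>X\<bar> \<le> d * (\<kappa> * n)"
    using L2_Cauchy_Schwarz[OF L2(2) F'(1)] mult_left_mono[OF F'(2) d] by (simp add: d_def X_def)
  have Y: "\<bar>Y\<bar> \<le> \<kappa> * n\<^sup>2"
    using L2_Cauchy_Schwarz[OF L2(1) G'(1)] mult_left_mono[OF G'(2) n]
    by (simp add: n_def Y_def power2_eq_square mult.left_commute)
  \<comment> \<open>Young's inequality: the flux error consumes one of the two copies of
    \<open>d\<^sup>2\<close> in the energy identity; the other is reserved for the Poincare
    inequality.\<close>
  have dn: "2 * (d * (\<kappa> * n)) \<le> d\<^sup>2 + \<kappa>\<^sup>2 * n\<^sup>2"
    using sum_squares_bound[of d "\<kappa> * n"] by (simp add: power_mult_distrib)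
  have "- 2 * (\<integral>x. w x * v x \<partial>?M) = 2 * d\<^sup>2 - 2 * X - 2 * (\<gamma> * n\<^sup>2) - 2 * Y"
    unfolding intwv X_def[symmetric] Y_def[symmetric] by simp
  then have e2: "- 2 * (\<integral>x. w x * v x \<partial>?M) \<ge> d\<^sup>2 - \<kappa>\<^sup>2 * n\<^sup>2 - 2 * (\<gamma> * n\<^sup>2) - 2 * (\<kappa> * n\<^sup>2)"
    using X Y dn by linarith
  define A where "A = m\<^sup>2 / L"
  have A: "A \<le> n\<^sup>2" using mean_square_le[OF L L2(1)] N by (simp add: A_def m_def)
  have "(2 * pi / L)\<^sup>2 * (n\<^sup>2 - A) \<le> d\<^sup>2"
    using Poincare_inequality[OF L w wx] N by (simp add: A_def m_def d_def L2_norm_square)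
  moreover have "2 * (6 * \<kappa> + \<kappa>\<^sup>2) * (n\<^sup>2 - A) \<le> (2 * pi / L)\<^sup>2 * (n\<^sup>2 - A)"
    using A by (intro mult_right_mono \<kappa>(2)) simp
  ultimately have e3: "2 * (6 * \<kappa> + \<kappa>\<^sup>2) * (n\<^sup>2 - A) \<le> d\<^sup>2" by linarith
  \<comment> \<open>The balance of all constants: the Poincare gain of twice \<eta> times
    \<open>n\<^sup>2 - A\<close>, less the total loss of \<eta> times \<open>n\<^sup>2\<close>, with
    \<eta> = \<open>6 * \<kappa> + \<kappa>\<^sup>2\<close>, is exactly -\<eta> times
    \<open>2 * A - n\<^sup>2\<close>.\<close>
  have "(2 * \<gamma> - (6 * \<kappa> + \<kappa>\<^sup>2)) * (2 * A - n\<^sup>2) =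
    4 * \<gamma> * A - 4 * \<kappa> * n\<^sup>2 + (2 * (6 * \<kappa> + \<kappa>\<^sup>2) * (n\<^sup>2 - A) - \<kappa>\<^sup>2 * n\<^sup>2 - 2 * (\<gamma> * n\<^sup>2) - 2 * (\<kappa> * n\<^sup>2))"
    by (simp add: algebra_simps)
  also have "\<dots> \<le> 4 * m * (\<integral>x. v x \<partial>?M) / L - 2 * (\<integral>x. w x * v x \<partial>?M)"
    using e1 e2 e3 unfolding A_def by linarith
  finally show ?thesis unfolding A_def m_def N by simp
qed

section \<open>Continuity and differentiability along curves in \<open>L2_per L\<close>\<close>

lemma L2_inner_tendsto:
  assumes a: "a \<in> L2_per L" and b: "b \<in> L2_per L"
    and as: "\<forall>\<^sub>F s in E. as s \<in> L2_per L" and bs: "\<forall>\<^sub>F s in E. bs s \<in> L2_per L"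
    and la: "((\<lambda>s. L2_norm L (\<lambda>x. as s x - a x)) \<longlongrightarrow> 0) E"
    and lb: "((\<lambda>s. L2_norm L (\<lambda>x. bs s x - b x)) \<longlongrightarrow> 0) E"
  shows "((\<lambda>s. \<integral>x. as s x * bs s x \<partial>per_measure L) \<longlongrightarrow> (\<integral>x. a x * b x \<partial>per_measure L)) E"
proof -
  let ?M = "per_measure L"
  let ?A = "\<lambda>s. L2_norm L (\<lambda>x. as s x - a x)"
  let ?B = "\<lambda>s. L2_norm L (\<lambda>x. bs s x - b x)"
  have "((\<lambda>s. ?A s * ?B s + ?A s * L2_norm L b + L2_norm L a * ?B s) \<longlongrightarrow>
      0 * 0 + 0 * L2_norm L b + L2_norm L a * 0) E"
    by (intro tendsto_intros la lb)
  then have lim: "((\<lambda>s. ?A s * ?B s + ?A s * L2_norm L b + L2_norm L a * ?B s) \<longlongrightarrow> 0) E" by simp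
  have "((\<lambda>s. (\<integral>x. as s x * bs s x \<partial>?M) - (\<integral>x. a x * b x \<partial>?M)) \<longlongrightarrow> 0) E"
  proof (rule Lim_null_comparison[OF _ lim])
    show "\<forall>\<^sub>F s in E. norm ((\<integral>x. as s x * bs s x \<partial>?M) - (\<integral>x. a x * b x \<partial>?M)) \<le>
        ?A s * ?B s + ?A s * L2_norm L b + L2_norm L a * ?B s"
      using as bs
    proof eventually_elim
      case (elim s)
      let ?p = "\<lambda>x. as s x - a x" and ?q = "\<lambda>x. bs s x - b x"
      have p: "?p \<in> L2_per L" and q: "?q \<in> L2_per L"
        using elim a b by (auto intro: L2_per_diff)
      note i = L2_per_integrable_mult
      have "(\<integral>x. as s x * bs s x \<partial>?M) = (\<integral>x. ?p x * ?q x + ?p x * b x + a x * ?q x + a x * b x \<partial>?M)"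
        by (simp add: algebra_simps)
      also have "\<dots> = (\<integral>x. ?p x * ?q x \<partial>?M) + (\<integral>x. ?p x * b x \<partial>?M) + (\<integral>x. a x * ?q x \<partial>?M)
          + (\<integral>x. a x * b x \<partial>?M)"
        using i[OF p q] i[OF p b] i[OF a q] i[OF a b] by simp
      finally show ?case
        using L2_Cauchy_Schwarz[OF p q] L2_Cauchy_Schwarz[OF p b] L2_Cauchy_Schwarz[OF a q] by simp
    qed
  qed
  then show ?thesis by (rule LIM_zero_cancel)
qed

lemma L2_tendsto_integral:
  assumes "a \<in> L2_per L" "\<forall>\<^sub>F s in E. as s \<in> L2_per L"
    "((\<lambda>s. L2_norm L (\<lambda>x. as s x - a x)) \<longlongrightarrow> 0) E"
  shows "((\<lambda>s. \<integral>x. as s x \<partial>per_measure L) \<longlongrightarrow> (\<integral>x. a x \<partial>per_measure L)) E"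
proof -
  have "((\<lambda>s. L2_norm L (\<lambda>x. 1 - 1)) \<longlongrightarrow> 0) E" by (simp add: L2_norm_eq)
  from L2_inner_tendsto[OF assms(1) L2_per_const[of 1] assms(2) _ assms(3) this] L2_per_const[of 1 L]
  show ?thesis by simp
qed

text \<open>The difference of squares factors, so the difference quotient of the squared norm is the
  pairing of the quotient of \<open>w\<close> with the sum \<open>w s + w t\<close>; both factors
  converge in \<open>L^2\<close>. Limits are taken within \<open>S\<close> because a solution is
  differentiable only on a half-open time interval.\<close>

lemma has_derivative_integral_L2:
  assumes w: "\<And>s. s \<in> S \<Longrightarrow> w s \<in> L2_per L" and t: "t \<in> S" and v: "v \<in> L2_per L"
    and cont: "((\<lambda>s. L2_norm L (\<lambda>x. w s x - w t x)) \<longlongrightarrow> 0) (at t within S)"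
    and diff: "((\<lambda>s. L2_norm L (\<lambda>x. (w s x - w t x) / (s - t) - v x)) \<longlongrightarrow> 0) (at t within S)"
  shows "((\<lambda>s. \<integral>x. w s x \<partial>per_measure L) has_real_derivative (\<integral>x. v x \<partial>per_measure L)) (at t within S)"
    and "((\<lambda>s. \<integral>x. (w s x)\<^sup>2 \<partial>per_measure L) has_real_derivative
      2 * (\<integral>x. w t x * v x \<partial>per_measure L)) (at t within S)"
proof -
  let ?M = "per_measure L"
  let ?q = "\<lambda>s x. (w s x - w t x) / (s - t)"
  have q: "?q s \<in> L2_per L" if "s \<in> S" for s
    using L2_per_cmult[OF L2_per_diff[OF w[OF that] w[OF t]], of "1 / (s - t)"] by simp
  have evS: "\<forall>\<^sub>F s in at t within S. s \<in> S \<and> s \<noteq> t"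
    by (simp add: eventually_at_filter)
  have evq: "\<forall>\<^sub>F s in at t within S. ?q s \<in> L2_per L"
    using evS by eventually_elim (use q in blast)
  have "((\<lambda>s. \<integral>x. ?q s x \<partial>?M) \<longlongrightarrow> (\<integral>x. v x \<partial>?M)) (at t within S)"
    by (rule L2_tendsto_integral[OF v evq diff])
  moreover have "\<forall>\<^sub>F s in at t within S. (\<integral>x. ?q s x \<partial>?M) =
      ((\<integral>x. w s x \<partial>?M) - (\<integral>x. w t x \<partial>?M)) / (s - t)"
    using evS by eventually_elim (use w t in \<open>simp add: L2_per_integrable\<close>)
  ultimately show "((\<lambda>s. \<integral>x. w s x \<partial>?M) has_real_derivative (\<integral>x. v x \<partial>?M)) (at t within S)"
    unfolding has_field_derivative_iff by (rule Lim_transform_eventually)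

  have evp: "\<forall>\<^sub>F s in at t within S. (\<lambda>x. w s x + w t x) \<in> L2_per L"
    using evS by eventually_elim (use w t L2_per_add in blast)
  have "((\<lambda>s. L2_norm L (\<lambda>x. (w s x + w t x) - 2 * w t x)) \<longlongrightarrow> 0) (at t within S)"
    using cont by simp
  then have "((\<lambda>s. \<integral>x. ?q s x * (w s x + w t x) \<partial>?M) \<longlongrightarrow> (\<integral>x. v x * (2 * w t x) \<partial>?M)) (at t within S)"
    by (rule L2_inner_tendsto[OF v L2_per_cmult[OF w[OF t]] evq evp diff])
  also have "(\<integral>x. v x * (2 * w t x) \<partial>?M) = 2 * (\<integral>x. w t x * v x \<partial>?M)"
    by (subst integral_mult_right_zero[symmetric]) (simp add: mult_ac)
  finally have lim: "((\<lambda>s. \<integral>x. ?q s x * (w s x + w t x) \<partial>?M) \<longlongrightarrow> 2 * (\<integral>x. w t x * v x \<partial>?M))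
      (at t within S)" .
  have ev: "\<forall>\<^sub>F s in at t within S. (\<integral>x. ?q s x * (w s x + w t x) \<partial>?M) =
      ((\<integral>x. (w s x)\<^sup>2 \<partial>?M) - (\<integral>x. (w t x)\<^sup>2 \<partial>?M)) / (s - t)"
    using evS
  proof eventually_elim
    case (elim s)
    have "?q s x * (w s x + w t x) = ((w s x)\<^sup>2 - (w t x)\<^sup>2) / (s - t)" for x
      by (simp add: power2_eq_square algebra_simps)
    then show ?case using w[of s] w[of t] t elim by (simp add: L2_per_iff)
  qed
  show "((\<lambda>s. \<integral>x. (w s x)\<^sup>2 \<partial>?M) has_real_derivative
      2 * (\<integral>x. w t x * v x \<partial>?M)) (at t within S)"
    unfolding has_field_derivative_iff by (rule Lim_transform_eventually[OF lim ev])
qed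

text \<open>\<open>exp (- r * t) * V t\<close> is nondecreasing, whatever the sign of
  \<open>V\<close>. Differentiability is asked for on the open interval only, since a solution is
  merely continuous at time 0.\<close>

lemma exponential_lower_bound:
  fixes V V' :: "real \<Rightarrow> real"
  assumes T: "0 < T" and cont: "continuous_on {0..T} V"
    and der: "\<And>t. 0 < t \<Longrightarrow> t < T \<Longrightarrow> (V has_real_derivative V' t) (at t)"
    and le: "\<And>t. 0 < t \<Longrightarrow> t < T \<Longrightarrow> r * V t \<le> V' t"
  shows "exp (r * T) * V 0 \<le> V T"
proof -
  have "exp (- r * 0) * V 0 \<le> exp (- r * T) * V T"
  proof (rule DERIV_nonneg_imp_increasing_open[where f="\<lambda>t. exp (- r * t) * V t"])
    fix t assume t: "0 < t" "t < T"
    have "((\<lambda>t. exp (- r * t) * V t) has_real_derivative exp (- r * t) * (V' t - r * V t)) (at t)"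
      by (auto intro!: derivative_eq_intros der t simp: algebra_simps)
    moreover have "0 \<le> exp (- r * t) * (V' t - r * V t)" using le[OF t] by simp
    ultimately show "\<exists>y. ((\<lambda>t. exp (- r * t) * V t) has_real_derivative y) (at t) \<and> 0 \<le> y" by blast
  qed (use T in \<open>auto intro!: continuous_intros cont\<close>)
  then have "exp (r * T) * V 0 \<le> exp (r * T) * (exp (- r * T) * V T)"
    by (intro mult_left_mono) auto
  also have "\<dots> = V T" by (simp add: exp_minus)
  finally show ?thesis .
qed

section \<open>Calculus for the nonlinearities and for translates of the profile\<close>

lemma Ck_Suc:
  assumes "Ck (Suc n) h"
  shows "(h has_real_derivative deriv h x) (at x)" "Ck n (deriv h)"
proof -
  have "(deriv ^^ 0) h differentiable (at x)"
    using assms unfolding Ck_def by blast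
  then show "(h has_real_derivative deriv h x) (at x)"
    by (simp add: DERIV_deriv_iff_real_differentiable)
  have "(deriv ^^ i) (deriv h) = (deriv ^^ Suc i) h" for i
    by (simp add: funpow_swap1)
  then show "Ck n (deriv h)"
    using assms unfolding Ck_def by (metis Suc_less_eq)
qed

lemma Ck_continuous: "Ck n h \<Longrightarrow> continuous_on UNIV h"
proof (cases n)
  case (Suc m)
  assume "Ck n h"
  then show ?thesis using Ck_Suc(1)[of m h] Suc by (meson DERIV_isCont continuous_at_imp_continuous_on)
qed (simp add: Ck_def)

text \<open>The mean value inequality for \<open>h z - a * z\<close>. It turns closeness of
  \<open>f'\<close> or \<open>g'\<close> to a constant near 0 into closeness of the nonlinear
  difference to a linear one.\<close>

lemma abs_diff_linear_le:
  fixes h h' :: "real \<Rightarrow> real"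
  assumes h: "\<And>z. (h has_real_derivative h' z) (at z)"
    and b: "\<And>z. \<bar>z\<bar> \<le> \<rho> \<Longrightarrow> \<bar>h' z - a\<bar> \<le> \<kappa>" and xy: "\<bar>x\<bar> \<le> \<rho>" "\<bar>y\<bar> \<le> \<rho>"
  shows "\<bar>h x - h y - a * (x - y)\<bar> \<le> \<kappa> * \<bar>x - y\<bar>"
proof -
  have "norm ((h x - a * x) - (h y - a * y)) \<le> \<kappa> * norm (x - y)"
  proof (rule field_differentiable_bound[where f="\<lambda>z. h z - a * z" and f'="\<lambda>z. h' z - a" and S="{- \<rho>..\<rho>}"])
    fix z assume "z \<in> {- \<rho>..\<rho>}"
    show "((\<lambda>z. h z - a * z) has_real_derivative h' z - a) (at z within {- \<rho>..\<rho>})"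
      by (rule has_field_derivative_at_within) (auto intro!: derivative_eq_intros h)
    show "norm (h' z - a) \<le> \<kappa>" using b[of z] \<open>z \<in> {- \<rho>..\<rho>}\<close> by auto
  qed (use xy in auto)
  then show ?thesis by (simp add: algebra_simps)
qed

lemma Taylor_remainder_le:
  fixes p p1 p2 :: "real \<Rightarrow> real"
  assumes p: "\<And>z. (p has_real_derivative p1 z) (at z)" and p1: "\<And>z. (p1 has_real_derivative p2 z) (at z)"
    and B: "\<And>z. \<bar>p2 z\<bar> \<le> B"
  shows "\<bar>p y - p x - p1 x * (y - x)\<bar> \<le> B * (y - x)\<^sup>2"
proof -
  define e where "e = \<bar>y - x\<bar>"
  have e: "0 \<le> e" by (simp add: e_def)
  have "norm ((p y - p1 x * y) - (p x - p1 x * x)) \<le> (B * e) * norm (y - x)"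
  proof (rule field_differentiable_bound[where f="\<lambda>z. p z - p1 x * z" and f'="\<lambda>z. p1 z - p1 x" and S="{x - e..x + e}"])
    fix z assume z: "z \<in> {x - e..x + e}"
    show "((\<lambda>z. p z - p1 x * z) has_real_derivative p1 z - p1 x) (at z within {x - e..x + e})"
      by (rule has_field_derivative_at_within) (auto intro!: derivative_eq_intros p)
    have "norm (p1 z - p1 x) \<le> B * norm (z - x)"
      by (rule field_differentiable_bound[where S=UNIV and f'=p2]) (use p1 B in auto)
    also have "\<dots> \<le> B * e" using z B[of 0] by (intro mult_left_mono) (auto simp: abs_le_iff)
    finally show "norm (p1 z - p1 x) \<le> B * e" .
  qed (auto simp: e_def)
  moreover have "B * e * norm (y - x) = B * (y - x)\<^sup>2" by (simp add: e_def power2_eq_square abs_mult_self_eq)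
  moreover have "(p y - p1 x * y) - (p x - p1 x * x) = p y - p x - p1 x * (y - x)" by (simp add: algebra_simps)
  ultimately show ?thesis by (simp only: real_norm_def)
qed

lemma continuous_periodic_bounded:
  assumes L: "L > 0" and per: "periodic L p" and p: "continuous_on UNIV p"
  shows "\<exists>B\<ge>0. \<forall>x. \<bar>p x\<bar> \<le> B"
proof -
  have "compact (p ` {0..L})"
    by (intro compact_continuous_image continuous_on_subset[OF p]) auto
  then obtain B where B: "\<forall>y\<in>p ` {0..L}. \<bar>y\<bar> \<le> B"
    by (metis bounded_iff compact_imp_bounded real_norm_def)
  have nat: "p (x + real n * L) = p x" for n x
  proof (induction n)
    case (Suc n)
    have "p (x + real (Suc n) * L) = p ((x + real n * L) + L)" by (simp add: algebra_simps)
    then show ?case using Suc per by (simp add: periodic_def)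
  qed simp
  have "\<bar>p x\<bar> \<le> B" for x
  proof -
    define k where "k = \<lfloor>x / L\<rfloor>"
    define y where "y = x - of_int k * L"
    have "of_int k \<le> x / L" "x / L < of_int k + 1" by (auto simp: k_def)
    then have y: "y \<in> {0..L}" using L by (auto simp: y_def field_simps)
    have "p x = p y"
    proof (cases "k \<ge> 0")
      case True
      then have "x = y + real (nat k) * L" by (simp add: y_def)
      then show ?thesis using nat by metis
    next
      case False
      then have "y = x + real (nat (- k)) * L" by (simp add: y_def)
      then show ?thesis using nat by metis
    qed
    then show ?thesis using B y by auto
  qed
  moreover from this[of 0] have "0 \<le> B" by linarith
  ultimately show ?thesis by blast
qed

lemma L2_norm_triangle_diff:
  assumes "u \<in> L2_per L" "v \<in> L2_per L"
  shows "L2_norm L (\<lambda>x. u x - v x) \<le> L2_norm L u + L2_norm L v"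
  using L2_norm_triangle[OF assms(1) L2_per_cmult[OF assms(2), of "- 1"]] L2_norm_cmult[of L "- 1" v]
  by simp

lemma L2_norm_le_Hs_norm:
  assumes L: "L > 0"
  shows "\<exists>K. \<forall>u\<in>Hs_per 2 L. L2_norm L u \<le> K * Hs_norm 2 L u"
proof -
  obtain K where K: "K > 0" "\<And>u. u \<in> Hs_per 2 L \<Longrightarrow> AE x in per_measure L. \<bar>u x\<bar> \<le> K * Hs_norm 2 L u"
    using Hs_per_2_sup_bound[OF L] by blast
  have "L2_norm L u \<le> sqrt L * (K * Hs_norm 2 L u)" if u: "u \<in> Hs_per 2 L" for u
  proof (rule L2_norm_le_bound)
    show "u \<in> borel_measurable borel" using u by (simp add: Hs_per_2_iff L2_per_iff)
    show "0 \<le> K * Hs_norm 2 L u"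
      using K(1) L by (simp add: Hs_norm_2_eq infsum_nonneg)
  qed (use L K(2)[OF u] in auto)
  then show ?thesis by (metis mult.assoc)
qed

lemma periodic_shift: "periodic L p \<Longrightarrow> periodic L (\<lambda>x. p (x - r))"
  unfolding periodic_def by (metis add_diff_eq diff_add_eq)

lemma DERIV_shift_minus:
  "(\<And>z. (p has_real_derivative p' z) (at z)) \<Longrightarrow>
    ((\<lambda>x. p (x - r)) has_real_derivative p' (x - r)) (at x)" for p p' :: "real \<Rightarrow> real"
  using DERIV_shift[of p "p' (x - r)" x "- r"] by simp

text \<open>The moving wave is a differentiable curve in \<open>L^2\<close>: by periodicity
  \<open>p1\<close> and \<open>p2\<close> are bounded on the whole line, so the Taylor error is
  uniform in \<open>x\<close> and of first order in \<open>s - t\<close>.\<close>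

lemma translation_L2_derivative:
  fixes p p1 p2 :: "real \<Rightarrow> real"
  assumes L: "L > 0" and per: "periodic L p"
    and p: "\<And>z. (p has_real_derivative p1 z) (at z)" and p1: "\<And>z. (p1 has_real_derivative p2 z) (at z)"
    and p2: "continuous_on UNIV p2"
  shows "((\<lambda>s. L2_norm L (\<lambda>x. (p (x - c * s) - p (x - c * t)) / (s - t) - (- c * p1 (x - c * t)))) \<longlongrightarrow> 0)
      (at t within S)"
    and "((\<lambda>s. L2_norm L (\<lambda>x. p (x - c * s) - p (x - c * t))) \<longlongrightarrow> 0) (at t within S)"
proof -
  have per1: "periodic L p1" by (rule periodic_derivative[OF p per])
  have per2: "periodic L p2" by (rule periodic_derivative[OF p1 per1])
  have cont: "continuous_on UNIV p" "continuous_on UNIV p1"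
    by (meson DERIV_isCont continuous_at_imp_continuous_on p p1)+
  obtain B1 where B1: "B1 \<ge> 0" "\<And>x. \<bar>p1 x\<bar> \<le> B1"
    using continuous_periodic_bounded[OF L per1 cont(2)] by blast
  obtain B2 where B2: "B2 \<ge> 0" "\<And>x. \<bar>p2 x\<bar> \<le> B2"
    using continuous_periodic_bounded[OF L per2 p2] by blast
  have m: "(\<lambda>x. p (x - c * s)) \<in> borel_measurable borel" "(\<lambda>x. p1 (x - c * s)) \<in> borel_measurable borel" for s
    by (intro borel_measurable_continuous_onI continuous_on_compose2[OF cont(1)]
        continuous_on_compose2[OF cont(2)] continuous_intros; simp)+
  have id: "((\<lambda>s. \<bar>s - t\<bar>) \<longlongrightarrow> 0) (at t within S)"
    using tendsto_rabs[OF LIM_zero[OF tendsto_ident_at]] by simp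
  have "((\<lambda>s. sqrt L * (B2 * c\<^sup>2 * \<bar>s - t\<bar>)) \<longlongrightarrow> sqrt L * (B2 * c\<^sup>2 * 0)) (at t within S)"
    by (intro tendsto_intros id)
  then have lim2: "((\<lambda>s. sqrt L * (B2 * c\<^sup>2 * \<bar>s - t\<bar>)) \<longlongrightarrow> 0) (at t within S)" by simp
  show "((\<lambda>s. L2_norm L (\<lambda>x. (p (x - c * s) - p (x - c * t)) / (s - t) - (- c * p1 (x - c * t)))) \<longlongrightarrow> 0)
      (at t within S)"
  proof (rule Lim_null_comparison[OF _ lim2])
    have "\<forall>\<^sub>F s in at t within S. s \<noteq> t" by (simp add: eventually_at_filter)
    then show "\<forall>\<^sub>F s in at t within S. norm (L2_norm L (\<lambda>x. (p (x - c * s) - p (x - c * t)) / (s - t)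
        - (- c * p1 (x - c * t)))) \<le> sqrt L * (B2 * c\<^sup>2 * \<bar>s - t\<bar>)"
    proof eventually_elim
      case (elim s)
      have "L2_norm L (\<lambda>x. (p (x - c * s) - p (x - c * t)) / (s - t) - (- c * p1 (x - c * t)))
          \<le> sqrt L * (B2 * c\<^sup>2 * \<bar>s - t\<bar>)"
      proof (rule L2_norm_le_bound)
        show "(\<lambda>x. (p (x - c * s) - p (x - c * t)) / (s - t) - (- c * p1 (x - c * t))) \<in> borel_measurable borel"
          by (intro borel_measurable_diff borel_measurable_divide borel_measurable_times m borel_measurable_const)
        show "AE x in per_measure L. \<bar>(p (x - c * s) - p (x - c * t)) / (s - t) - (- c * p1 (x - c * t))\<bar>
            \<le> B2 * c\<^sup>2 * \<bar>s - t\<bar>"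
        proof (rule AE_I2)
          fix x
          have "\<bar>p (x - c * s) - p (x - c * t) - p1 (x - c * t) * ((x - c * s) - (x - c * t))\<bar> \<le>
              B2 * ((x - c * s) - (x - c * t))\<^sup>2"
            by (rule Taylor_remainder_le[OF p p1 B2(2)])
          also have "(x - c * s) - (x - c * t) = - (c * (s - t))" by (simp add: algebra_simps)
          finally have le: "\<bar>p (x - c * s) - p (x - c * t) + c * p1 (x - c * t) * (s - t)\<bar> \<le>
              B2 * c\<^sup>2 * (s - t)\<^sup>2" by (simp add: power_mult_distrib mult_ac)
          have "(p (x - c * s) - p (x - c * t)) / (s - t) - (- c * p1 (x - c * t)) =
              (p (x - c * s) - p (x - c * t) + c * p1 (x - c * t) * (s - t)) / (s - t)"
            using elim by (simp add: add_divide_distrib)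
          also have "\<bar>\<dots>\<bar> \<le> B2 * c\<^sup>2 * (s - t)\<^sup>2 / \<bar>s - t\<bar>"
            unfolding abs_divide using le by (rule divide_right_mono) simp
          also have "\<dots> = B2 * c\<^sup>2 * \<bar>s - t\<bar>"
          proof -
            have "(s - t)\<^sup>2 = \<bar>s - t\<bar> * \<bar>s - t\<bar>" by (simp add: power2_eq_square)
            then show ?thesis using elim by (simp only: mult.assoc[symmetric]) simp
          qed
          finally show "\<bar>(p (x - c * s) - p (x - c * t)) / (s - t) - (- c * p1 (x - c * t))\<bar>
            \<le> B2 * c\<^sup>2 * \<bar>s - t\<bar>" .
        qed
      qed (use L B2 in auto)
      then show ?case using L2_norm_nonneg by simp
    qed
  qed
  have "((\<lambda>s. sqrt L * (B1 * \<bar>c\<bar> * \<bar>s - t\<bar>)) \<longlongrightarrow> sqrt L * (B1 * \<bar>c\<bar> * 0)) (at t within S)"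
    by (intro tendsto_intros id)
  then have lim1: "((\<lambda>s. sqrt L * (B1 * \<bar>c\<bar> * \<bar>s - t\<bar>)) \<longlongrightarrow> 0) (at t within S)" by simp
  show "((\<lambda>s. L2_norm L (\<lambda>x. p (x - c * s) - p (x - c * t))) \<longlongrightarrow> 0) (at t within S)"
  proof (rule Lim_null_comparison[OF always_eventually lim1], rule allI)
    fix s
    have "L2_norm L (\<lambda>x. p (x - c * s) - p (x - c * t)) \<le> sqrt L * (B1 * \<bar>c\<bar> * \<bar>s - t\<bar>)"
    proof (rule L2_norm_le_bound)
      show "AE x in per_measure L. \<bar>p (x - c * s) - p (x - c * t)\<bar> \<le> B1 * \<bar>c\<bar> * \<bar>s - t\<bar>"
      proof (rule AE_I2)
        fix x
        have "norm (p (x - c * s) - p (x - c * t)) \<le> B1 * norm ((x - c * s) - (x - c * t))"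
          by (rule field_differentiable_bound[where S=UNIV and f'=p1]) (use p B1 in auto)
        also have "(x - c * s) - (x - c * t) = - (c * (s - t))" by (simp add: algebra_simps)
        finally show "\<bar>p (x - c * s) - p (x - c * t)\<bar> \<le> B1 * \<bar>c\<bar> * \<bar>s - t\<bar>" by (simp add: abs_mult)
      qed
    qed (use L B1 in \<open>auto intro!: borel_measurable_diff m\<close>)
    then show "norm (L2_norm L (\<lambda>x. p (x - c * s) - p (x - c * t))) \<le> sqrt L * (B1 * \<bar>c\<bar> * \<bar>s - t\<bar>)"
      using L2_norm_nonneg by simp
  qed
qed

text \<open>Subtracting the profile equation from the equation for \<open>u\<close> gives
  \<open>w\<close> an equation with the flux \<open>f (u t x) - f (\<phi> (x - c * t))\<close> and
  the analogous reaction. As long as both functions stay within \<open>\<rho>\<close>, these are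
  linear in \<open>w\<close> up to \<open>\<kappa>\<close>; the instantaneous energy inequality then
  holds at every interior time and is integrated.\<close>

lemma perturbation_growth:
  fixes f f' g g' \<phi> \<phi>1 \<phi>2 \<phi>3 :: "real \<Rightarrow> real"
  assumes L: "L > 0" and T: "T > 0"
    and f: "\<And>z. (f has_real_derivative f' z) (at z)" "continuous_on UNIV f'"
    and g: "\<And>z. (g has_real_derivative g' z) (at z)"
    and \<phi>: "\<And>z. (\<phi> has_real_derivative \<phi>1 z) (at z)" and \<phi>1: "\<And>z. (\<phi>1 has_real_derivative \<phi>2 z) (at z)"
    and \<phi>2: "\<And>z. (\<phi>2 has_real_derivative \<phi>3 z) (at z)" and \<phi>3: "continuous_on UNIV \<phi>3"
    and per: "periodic L \<phi>"
    and ode: "\<And>z. - c * \<phi>1 z + f' (\<phi> z) * \<phi>1 z = \<phi>2 z + g (\<phi> z)"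
    and \<kappa>: "0 \<le> \<kappa>" "2 * (6 * \<kappa> + \<kappa>\<^sup>2) \<le> (2 * pi / L)\<^sup>2"
    and f': "\<And>z. \<bar>z\<bar> \<le> \<rho> \<Longrightarrow> \<bar>f' z - a\<bar> \<le> \<kappa>" and g': "\<And>z. \<bar>z\<bar> \<le> \<rho> \<Longrightarrow> \<bar>g' z - \<gamma>\<bar> \<le> \<kappa>"
    and sol: "solution_on f g L T u"
    and small: "\<And>z. \<bar>\<phi> z\<bar> \<le> \<rho>"
      "\<And>t. 0 < t \<Longrightarrow> t < T \<Longrightarrow> AE x in per_measure L. \<bar>u t x\<bar> \<le> \<rho>"
  defines "V \<equiv> \<lambda>t. 2 * (\<integral>x. (u t x - \<phi> (x - c * t)) \<partial>per_measure L)\<^sup>2 / L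
      - (\<integral>x. (u t x - \<phi> (x - c * t))\<^sup>2 \<partial>per_measure L)"
  shows "exp ((2 * \<gamma> - (6 * \<kappa> + \<kappa>\<^sup>2)) * T) * V 0 \<le> V T"
proof -
  let ?M = "per_measure L"
  define w where "w t x = u t x - \<phi> (x - c * t)" for t x
  obtain v where vs: "\<forall>t\<in>{0<..T}. v t \<in> L2_per L \<and>
        ((\<lambda>s. L2_norm L (\<lambda>x. (u s x - u t x) / (s - t) - v t x)) \<longlongrightarrow> 0) (at t within {0<..T}) \<and>
        ((\<lambda>s. L2_norm L (\<lambda>x. v s x - v t x)) \<longlongrightarrow> 0) (at t within {0<..T}) \<and>
        (\<exists>ux uxx fx. weak_deriv_per L (u t) ux \<and> weak_deriv_per L ux uxx \<and>
           weak_deriv_per L (\<lambda>x. f (u t x)) fx \<and> (AE x in lborel. v t x + fx x = uxx x + g (u t x)))"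
    using sol[unfolded solution_on_def, THEN conjunct2] by (elim exE)
  have v: "\<And>t. t \<in> {0<..T} \<Longrightarrow> v t \<in> L2_per L"
    and v_deriv: "\<And>t. t \<in> {0<..T} \<Longrightarrow>
        ((\<lambda>s. L2_norm L (\<lambda>x. (u s x - u t x) / (s - t) - v t x)) \<longlongrightarrow> 0) (at t within {0<..T})"
    and v_eq: "\<And>t. t \<in> {0<..T} \<Longrightarrow> \<exists>ux uxx fx. weak_deriv_per L (u t) ux \<and> weak_deriv_per L ux uxx \<and>
           weak_deriv_per L (\<lambda>x. f (u t x)) fx \<and> (AE x in lborel. v t x + fx x = uxx x + g (u t x))"
    using vs by blast+
  have u: "u t \<in> Hs_per 2 L" if "t \<in> {0..T}" for t using sol that by (simp add: solution_on_def)
  have u_cont: "((\<lambda>s. Hs_norm 2 L (\<lambda>x. u s x - u t x)) \<longlongrightarrow> 0) (at t within {0..T})" if "t \<in> {0..T}" for t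
    using sol that by (simp add: solution_on_def)
  have cont: "continuous_on UNIV \<phi>" "continuous_on UNIV \<phi>1" "continuous_on UNIV \<phi>2"
    "continuous_on UNIV f" "continuous_on UNIV g"
    by (meson DERIV_isCont continuous_at_imp_continuous_on \<phi> \<phi>1 \<phi>2 f g)+
  have per1: "periodic L \<phi>1" by (rule periodic_derivative[OF \<phi> per])
  have per2: "periodic L \<phi>2" by (rule periodic_derivative[OF \<phi>1 per1])
  have shift: "continuous_on UNIV (\<lambda>x. \<phi> (x - r))" "continuous_on UNIV (\<lambda>x. \<phi>1 (x - r))"
    "continuous_on UNIV (\<lambda>x. \<phi>2 (x - r))" "continuous_on UNIV (\<lambda>x. \<phi>3 (x - r))" for r
    by (rule continuous_on_compose2[OF cont(1)] continuous_on_compose2[OF cont(2)]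
        continuous_on_compose2[OF cont(3)] continuous_on_compose2[OF \<phi>3];
        auto intro!: continuous_intros)+
  have \<psi>: "(\<lambda>x. \<phi> (x - r)) \<in> Hs_per 2 L" for r
    by (rule Hs_per_2_C3[OF L periodic_shift[OF per] DERIV_shift_minus[OF \<phi>] DERIV_shift_minus[OF \<phi>1]
        DERIV_shift_minus[OF \<phi>2] shift(4)])
  have w: "w t \<in> Hs_per 2 L" if "t \<in> {0..T}" for t
    unfolding w_def by (rule Hs_per_2_diff[OF u[OF that] \<psi>])
  have w2: "w t \<in> L2_per L" if "t \<in> {0..T}" for t using w[OF that] by (simp add: Hs_per_2_iff)
  have u2: "u t \<in> L2_per L" if "t \<in> {0..T}" for t using u[OF that] by (simp add: Hs_per_2_iff)
  have \<psi>2: "(\<lambda>x. \<phi> (x - r)) \<in> L2_per L" for r using \<psi> by (simp add: Hs_per_2_iff)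
  have \<psi>12: "(\<lambda>x. \<phi>1 (x - r)) \<in> L2_per L" for r
    by (rule continuous_periodic_L2_per[OF shift(2) periodic_shift[OF per1]])
  obtain K where K: "\<And>h. h \<in> Hs_per 2 L \<Longrightarrow> L2_norm L h \<le> K * Hs_norm 2 L h"
    using L2_norm_le_Hs_norm[OF L] by blast

  \<comment> \<open>Continuity must include time 0, where no time derivative is available; it comes
    from the \<open>H^2\<close> continuity of the solution.\<close>
  have w_cont: "((\<lambda>s. L2_norm L (\<lambda>x. w s x - w t x)) \<longlongrightarrow> 0) (at t within {0..T})" if t: "t \<in> {0..T}" for t
  proof -
    have "((\<lambda>s. K * Hs_norm 2 L (\<lambda>x. u s x - u t x) + L2_norm L (\<lambda>x. \<phi> (x - c * s) - \<phi> (x - c * t)))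
        \<longlongrightarrow> K * 0 + 0) (at t within {0..T})"
      by (intro tendsto_add tendsto_mult tendsto_const u_cont[OF t]
          translation_L2_derivative(2)[OF L per \<phi> \<phi>1 cont(3)])
    then have lim: "((\<lambda>s. K * Hs_norm 2 L (\<lambda>x. u s x - u t x) + L2_norm L (\<lambda>x. \<phi> (x - c * s) - \<phi> (x - c * t)))
        \<longlongrightarrow> 0) (at t within {0..T})" by simp
    show ?thesis
    proof (rule Lim_null_comparison[OF _ lim])
      have "\<forall>\<^sub>F s in at t within {0..T}. s \<in> {0..T}" by (simp add: eventually_at_filter)
      then show "\<forall>\<^sub>F s in at t within {0..T}. norm (L2_norm L (\<lambda>x. w s x - w t x)) \<le>
          K * Hs_norm 2 L (\<lambda>x. u s x - u t x) + L2_norm L (\<lambda>x. \<phi> (x - c * s) - \<phi> (x - c * t))"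
      proof eventually_elim
        case (elim s)
        have "L2_norm L (\<lambda>x. w s x - w t x) =
            L2_norm L (\<lambda>x. (u s x - u t x) - (\<phi> (x - c * s) - \<phi> (x - c * t)))"
          by (simp add: w_def algebra_simps)
        also have "\<dots> \<le> L2_norm L (\<lambda>x. u s x - u t x) + L2_norm L (\<lambda>x. \<phi> (x - c * s) - \<phi> (x - c * t))"
          by (intro L2_norm_triangle_diff L2_per_diff u2 \<psi>2 elim t)
        also have "L2_norm L (\<lambda>x. u s x - u t x) \<le> K * Hs_norm 2 L (\<lambda>x. u s x - u t x)"
          by (intro K Hs_per_2_diff u elim t)
        finally show ?case using L2_norm_nonneg by simp
      qed
    qed
  qed

  \<comment> \<open>The time derivative of \<open>w\<close>: the wave moving with speed
    \<open>c\<close> contributes \<open>- c * \<phi>1\<close>.\<close>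
  define vw where "vw t x = v t x - (- c * \<phi>1 (x - c * t))" for t x
  have vw2: "vw t \<in> L2_per L" if "t \<in> {0<..T}" for t
    unfolding vw_def by (intro L2_per_diff L2_per_cmult v that \<psi>12)
  have w_deriv: "((\<lambda>s. L2_norm L (\<lambda>x. (w s x - w t x) / (s - t) - vw t x)) \<longlongrightarrow> 0) (at t within {0<..T})"
    if t: "t \<in> {0<..T}" for t
  proof -
    let ?a = "\<lambda>s x. (u s x - u t x) / (s - t) - v t x"
    let ?b = "\<lambda>s x. (\<phi> (x - c * s) - \<phi> (x - c * t)) / (s - t) - (- c * \<phi>1 (x - c * t))"
    have "((\<lambda>s. L2_norm L (?a s) + L2_norm L (?b s)) \<longlongrightarrow> 0 + 0) (at t within {0<..T})"
      by (intro tendsto_add v_deriv[OF t] translation_L2_derivative(1)[OF L per \<phi> \<phi>1 cont(3)])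
    then have lim: "((\<lambda>s. L2_norm L (?a s) + L2_norm L (?b s)) \<longlongrightarrow> 0) (at t within {0<..T})" by simp
    show ?thesis
    proof (rule Lim_null_comparison[OF _ lim])
      have "\<forall>\<^sub>F s in at t within {0<..T}. s \<in> {0<..T}" by (simp add: eventually_at_filter)
      then show "\<forall>\<^sub>F s in at t within {0<..T}. norm (L2_norm L (\<lambda>x. (w s x - w t x) / (s - t) - vw t x)) \<le>
          L2_norm L (?a s) + L2_norm L (?b s)"
      proof eventually_elim
        case (elim s)
        have st: "s \<in> {0..T}" "t \<in> {0..T}" using elim t by auto
        have a: "?a s \<in> L2_per L"
          using L2_per_diff[OF L2_per_cmult[OF L2_per_diff[OF u2[OF st(1)] u2[OF st(2)]], of "1 / (s - t)"] v[OF t]]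
          by simp
        have b: "?b s \<in> L2_per L"
          using L2_per_diff[OF L2_per_cmult[OF L2_per_diff[OF \<psi>2 \<psi>2], of "1 / (s - t)"]
              L2_per_cmult[OF \<psi>12, of "- c"]] by simp
        have "(w s x - w t x) / (s - t) - vw t x = ?a s x - ?b s x" for x
          by (simp add: w_def vw_def diff_divide_distrib)
        then show ?case using L2_norm_triangle_diff[OF a b] L2_norm_nonneg by simp
      qed
    qed
  qed

  define V' where "V' t = 4 * (\<integral>x. w t x \<partial>?M) * (\<integral>x. vw t x \<partial>?M) / L - 2 * (\<integral>x. w t x * vw t x \<partial>?M)" for t
  have V_w: "V = (\<lambda>t. 2 * (\<integral>x. w t x \<partial>?M)\<^sup>2 / L - (\<integral>x. (w t x)\<^sup>2 \<partial>?M))"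
    by (simp add: V_def w_def)
  show ?thesis
  proof (rule exponential_lower_bound[OF T, where V'=V'])
    show "continuous_on {0..T} V"
      unfolding continuous_on_def
    proof
      fix t assume t: "t \<in> {0..T}"
      have "\<forall>\<^sub>F s in at t within {0..T}. s \<in> {0..T}" by (simp add: eventually_at_filter)
      then have ev: "\<forall>\<^sub>F s in at t within {0..T}. w s \<in> L2_per L"
        by eventually_elim (rule w2)
      have "((\<lambda>s. \<integral>x. w s x * w s x \<partial>?M) \<longlongrightarrow> (\<integral>x. w t x * w t x \<partial>?M)) (at t within {0..T})"
        by (rule L2_inner_tendsto[OF w2[OF t] w2[OF t] ev ev w_cont[OF t] w_cont[OF t]])
      then have "((\<lambda>s. \<integral>x. (w s x)\<^sup>2 \<partial>?M) \<longlongrightarrow> (\<integral>x. (w t x)\<^sup>2 \<partial>?M)) (at t within {0..T})"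
        by (simp add: power2_eq_square)
      moreover have "((\<lambda>s. \<integral>x. w s x \<partial>?M) \<longlongrightarrow> (\<integral>x. w t x \<partial>?M)) (at t within {0..T})"
        by (rule L2_tendsto_integral[OF w2[OF t] ev w_cont[OF t]])
      ultimately show "(V \<longlongrightarrow> V t) (at t within {0..T})"
        unfolding V_w by (intro tendsto_intros) (use L in auto)
    qed
  next
    fix t assume t0: "0 < t" "t < T"
    then have t: "t \<in> {0<..T}" and t': "t \<in> {0..T}" by auto
    \<comment> \<open>At an interior time the half-open interval is a neighbourhood, so limits
      within it are two-sided.\<close>
    have within: "at t within {0<..T} = at t"
      by (rule at_within_open_subset[of t "{0<..<T}"]) (use t0 in auto)
    have wS: "w s \<in> L2_per L" if "s \<in> {0<..T}" for s using w2 that by auto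
    have cont': "((\<lambda>s. L2_norm L (\<lambda>x. w s x - w t x)) \<longlongrightarrow> 0) (at t within {0<..T})"
      by (rule tendsto_within_subset[OF w_cont[OF t']]) auto
    note der = has_derivative_integral_L2[OF wS t vw2[OF t] cont' w_deriv[OF t], unfolded within]
    show "(V has_real_derivative V' t) (at t)"
      unfolding V_w V'_def
    proof (rule DERIV_cong)
      show "((\<lambda>t. 2 * (\<integral>x. w t x \<partial>?M)\<^sup>2 / L - (\<integral>x. (w t x)\<^sup>2 \<partial>?M)) has_real_derivative
        2 * (2 * ((\<integral>x. vw t x \<partial>?M) * (\<integral>x. w t x \<partial>?M))) / L - 2 * (\<integral>x. w t x * vw t x \<partial>?M)) (at t)"
        using DERIV_diff[OF DERIV_cdivide[OF DERIV_cmult[OF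
          DERIV_power[OF der(1), where n=2], where c=2], where c=L] der(2)] by simp
    qed simp
    obtain ux uxx fx where eq: "weak_deriv_per L (u t) ux" "weak_deriv_per L ux uxx"
      "weak_deriv_per L (\<lambda>x. f (u t x)) fx" "AE x in lborel. v t x + fx x = uxx x + g (u t x)"
      using v_eq[OF t] by blast
    let ?r = "c * t"
    have d\<psi>: "weak_deriv_per L (\<lambda>x. \<phi> (x - ?r)) (\<lambda>x. \<phi>1 (x - ?r))"
      "weak_deriv_per L (\<lambda>x. \<phi>1 (x - ?r)) (\<lambda>x. \<phi>2 (x - ?r))"
      by (rule weak_deriv_per_C1[OF L DERIV_shift_minus[OF \<phi>] shift(2) periodic_shift[OF per]]
          weak_deriv_per_C1[OF L DERIV_shift_minus[OF \<phi>1] shift(3) periodic_shift[OF per1]])+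
    have df\<psi>: "weak_deriv_per L (\<lambda>x. f (\<phi> (x - ?r))) (\<lambda>x. f' (\<phi> (x - ?r)) * \<phi>1 (x - ?r))"
    proof (rule weak_deriv_per_C1[OF L])
      show "((\<lambda>x. f (\<phi> (x - ?r))) has_real_derivative f' (\<phi> (x - ?r)) * \<phi>1 (x - ?r)) (at x)" for x
        by (rule DERIV_chain2[OF f(1) DERIV_shift_minus[OF \<phi>]])
      show "continuous_on UNIV (\<lambda>x. f' (\<phi> (x - ?r)) * \<phi>1 (x - ?r))"
        by (intro continuous_on_mult continuous_on_compose2[OF f(2) shift(1)] shift(2)) auto
      show "periodic L (\<lambda>x. f (\<phi> (x - ?r)))"
        using periodic_shift[OF per, of ?r] by (simp add: periodic_def)
    qed
    show "(2 * \<gamma> - (6 * \<kappa> + \<kappa>\<^sup>2)) * V t \<le> V' t"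
      unfolding V_w V'_def
    proof (rule energy_inequality[OF L w[OF t'] _ _ weak_deriv_per_diff[OF eq(3) df\<psi>] _ _ vw2[OF t] _ \<kappa>,
          where G="\<lambda>x. g (u t x) - g (\<phi> (x - ?r))"])
      show "weak_deriv_per L (w t) (\<lambda>x. ux x - \<phi>1 (x - ?r))"
        unfolding w_def by (rule weak_deriv_per_diff[OF eq(1) d\<psi>(1)])
      show "weak_deriv_per L (\<lambda>x. ux x - \<phi>1 (x - ?r)) (\<lambda>x. uxx x - \<phi>2 (x - ?r))"
        by (rule weak_deriv_per_diff[OF eq(2) d\<psi>(2)])
      have gm: "g \<in> borel_measurable borel" using cont(5) by (rule borel_measurable_continuous_onI)
      have um: "u t \<in> borel_measurable borel" using u2[OF t'] by (simp add: L2_per_iff)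
      have \<psi>m: "(\<lambda>x. \<phi> (x - ?r)) \<in> borel_measurable borel" using \<psi>2 by (simp add: L2_per_iff)
      show "(\<lambda>x. g (u t x) - g (\<phi> (x - ?r))) \<in> borel_measurable borel"
        by (intro borel_measurable_diff measurable_compose[OF um gm] measurable_compose[OF \<psi>m gm])
      show "periodic L (\<lambda>x. g (u t x) - g (\<phi> (x - ?r)))"
        using periodic_shift[OF per, of ?r] u2[OF t'] by (simp add: periodic_def L2_per_iff)
      show "AE x in ?M. vw t x = (uxx x - \<phi>2 (x - ?r)) - (fx x - f' (\<phi> (x - ?r)) * \<phi>1 (x - ?r))
          + (g (u t x) - g (\<phi> (x - ?r)))"
        using AE_per_measure[OF eq(4)]
      proof eventually_elim
        case (elim x)
        then show ?case using ode[of "x - ?r"] unfolding vw_def by linarith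
      qed
      show "AE x in ?M. \<bar>(f (u t x) - f (\<phi> (x - ?r))) - a * w t x\<bar> \<le> \<kappa> * \<bar>w t x\<bar>"
        using small(2)[OF t0]
        by eventually_elim (unfold w_def, rule abs_diff_linear_le[OF f(1) f'], use small(1) in auto)
      show "AE x in ?M. \<bar>(g (u t x) - g (\<phi> (x - ?r))) - \<gamma> * w t x\<bar> \<le> \<kappa> * \<bar>w t x\<bar>"
        using small(2)[OF t0]
        by eventually_elim (unfold w_def, rule abs_diff_linear_le[OF g g'], use small(1) in auto)
    qed
  qed
qed

section \<open>Orbital instability\<close>

lemma fourier_coeff_const:
  assumes "L > 0"
  shows "fourier_coeff L (\<lambda>x. \<delta>) k = (if k = 0 then complex_of_real \<delta> else 0)"
  using integral_character[OF assms, of "- k"] assms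
  by (auto simp: fourier_coeff_eq character_uminus[symmetric])

lemma Hs_const:
  assumes L: "L > 0"
  shows "(\<lambda>x. \<delta>) \<in> Hs_per 2 L" and "Hs_norm 2 L (\<lambda>x. \<delta>) = sqrt L * \<bar>\<delta>\<bar>"
proof -
  have eq: "(\<lambda>k. ((1 + (real_of_int k)\<^sup>2) * cmod (fourier_coeff L (\<lambda>x. \<delta>) k))\<^sup>2) =
      (\<lambda>k. if k = 0 then \<delta>\<^sup>2 else 0)"
    by (auto simp: fun_eq_iff fourier_coeff_const[OF L])
  have s: "((\<lambda>k::int. if k = 0 then \<delta>\<^sup>2 else 0) has_sum \<delta>\<^sup>2) UNIV"
    by (rule has_sum_finite_neutralI[of "{0}"]) auto
  then show "(\<lambda>x. \<delta>) \<in> Hs_per 2 L"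
    unfolding Hs_per_2_iff eq using L2_per_const has_sum_imp_summable by blast
  show "Hs_norm 2 L (\<lambda>x. \<delta>) = sqrt L * \<bar>\<delta>\<bar>"
    unfolding Hs_norm_2_eq eq infsumI[OF s] by (simp add: real_sqrt_mult)
qed

lemma orbit_dist_le: "orbit_dist L \<phi> w \<le> Hs_norm 2 L (\<lambda>x. w x - \<phi> (x + r))"
  if "L > 0"
  unfolding orbit_dist_def
proof (rule cINF_lower)
  show "bdd_below (range (\<lambda>r. Hs_norm 2 L (\<lambda>x. w x - \<phi> (x + r))))"
    by (rule bdd_belowI[of _ 0]) (use that in \<open>auto simp: Hs_norm_2_eq infsum_nonneg\<close>)
qed simp

lemma orbit_dist_less:
  assumes "orbit_dist L \<phi> w < e"
  obtains r where "Hs_norm 2 L (\<lambda>x. w x - \<phi> (x + r)) < e"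
  using assms cINF_less_iff[of UNIV] unfolding orbit_dist_def
  by (metis (no_types, lifting) UNIV_not_empty cInf_lessD empty_is_image imageE)

theorem orbitally_unstable_of_small_wave:
  fixes f f' g g' \<phi> \<phi>1 \<phi>2 \<phi>3 :: "real \<Rightarrow> real"
  assumes L: "L > 0"
    and f: "\<And>z. (f has_real_derivative f' z) (at z)" "continuous_on UNIV f'"
    and g: "\<And>z. (g has_real_derivative g' z) (at z)"
    and \<phi>: "\<And>z. (\<phi> has_real_derivative \<phi>1 z) (at z)" and \<phi>1: "\<And>z. (\<phi>1 has_real_derivative \<phi>2 z) (at z)"
    and \<phi>2: "\<And>z. (\<phi>2 has_real_derivative \<phi>3 z) (at z)" and \<phi>3: "continuous_on UNIV \<phi>3"
    and per: "periodic L \<phi>"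
    and ode: "\<And>z. - c * \<phi>1 z + f' (\<phi> z) * \<phi>1 z = \<phi>2 z + g (\<phi> z)"
    and \<kappa>: "0 \<le> \<kappa>" "2 * (6 * \<kappa> + \<kappa>\<^sup>2) \<le> (2 * pi / L)\<^sup>2" "6 * \<kappa> + \<kappa>\<^sup>2 < 2 * \<gamma>"
    and f': "\<And>z. \<bar>z\<bar> \<le> \<rho> \<Longrightarrow> \<bar>f' z - a\<bar> \<le> \<kappa>" and g': "\<And>z. \<bar>z\<bar> \<le> \<rho> \<Longrightarrow> \<bar>g' z - \<gamma>\<bar> \<le> \<kappa>"
    and \<rho>: "0 < \<rho>" and small: "\<And>z. \<bar>\<phi> z\<bar> \<le> \<rho> / 2"
  shows "orbitally_unstable f g L \<phi>"
  unfolding orbitally_unstable_def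
proof
  assume stable: "orbitally_stable f g L \<phi>"
  let ?M = "per_measure L"
  obtain K where K: "K > 0" "\<And>u. u \<in> Hs_per 2 L \<Longrightarrow> AE x in ?M. \<bar>u x\<bar> \<le> K * Hs_norm 2 L u"
    using Hs_per_2_sup_bound[OF L] by blast
  \<comment> \<open>Makes \<open>K * e\<close> equal to \<open>\<rho> / 2\<close>. Staying
    \<open>e\<close>-close to a translate of the profile, itself bounded by
    \<open>\<rho> / 2\<close>, then forces \<open>u\<close> to stay within \<open>\<rho>\<close>,
    where \<open>f'\<close> and \<open>g'\<close> are controlled.\<close>
  define e where "e = \<rho> / (2 * K)"
  have e: "e > 0" using K \<rho> by (simp add: e_def)
  obtain d where d: "d > 0" and dstab: "\<forall>\<psi>\<in>Hs_per 2 L. orbit_dist L \<phi> \<psi> < d \<longrightarrow>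
        (\<exists>u. global_solution f g L \<psi> u \<and> (SUP t\<in>{0<..}. ereal (orbit_dist L \<phi> (u t))) < ereal e)"
    using stable e unfolding orbitally_stable_def by blast
  \<comment> \<open>A constant \<open>\<delta>\<close> has \<open>H^2\<close> norm
    \<open>sqrt L * \<delta>\<close>, which is \<open>d / 2\<close> here.\<close>
  define \<delta> where "\<delta> = d / (2 * sqrt L)"
  have \<delta>: "\<delta> > 0" using d L by (simp add: \<delta>_def)
  have \<phi>H: "(\<lambda>x. \<phi> (x - r)) \<in> Hs_per 2 L" for r
  proof (rule Hs_per_2_C3[OF L periodic_shift[OF per] DERIV_shift_minus[OF \<phi>] DERIV_shift_minus[OF \<phi>1]
        DERIV_shift_minus[OF \<phi>2]])
    show "continuous_on UNIV (\<lambda>x. \<phi>3 (x - r))"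
      by (rule continuous_on_compose2[OF \<phi>3]) (auto intro!: continuous_intros)
  qed
  \<comment> \<open>Written as a subtraction so that closure of \<open>Hs_per 2 L\<close> under
    differences applies.\<close>
  define \<psi> where "\<psi> x = \<phi> x - (- \<delta>)" for x
  have \<psi>: "\<psi> \<in> Hs_per 2 L"
    unfolding \<psi>_def using Hs_per_2_diff[OF \<phi>H[of 0] Hs_const(1)[OF L, of "- \<delta>"]] by simp
  have "orbit_dist L \<phi> \<psi> \<le> Hs_norm 2 L (\<lambda>x. \<psi> x - \<phi> (x + 0))" by (rule orbit_dist_le[OF L])
  also have "\<dots> = sqrt L * \<delta>" using Hs_const(2)[OF L, of \<delta>] \<delta> by (simp add: \<psi>_def)
  also have "\<dots> = d / 2" using L by (simp add: \<delta>_def)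
  also have "\<dots> < d" using d by simp
  finally have "orbit_dist L \<phi> \<psi> < d" .
  then obtain u where u: "global_solution f g L \<psi> u"
    and sup: "(SUP t\<in>{0<..}. ereal (orbit_dist L \<phi> (u t))) < ereal e"
    using dstab \<psi> by blast
  have sol: "solution_on f g L T u" if "T > 0" for T
    using u that by (simp add: global_solution_def)
  have u0: "AE x in ?M. u 0 x = \<psi> x"
    using u AE_per_measure by (simp add: global_solution_def)
  have uH: "u t \<in> Hs_per 2 L" if "t > 0" for t
    using sol[OF that] that by (simp add: solution_on_def)
  have bound: "AE x in ?M. \<bar>u t x\<bar> \<le> \<rho>" if t: "t > 0" for t
  proof -
    have "ereal (orbit_dist L \<phi> (u t)) \<le> (SUP t\<in>{0<..}. ereal (orbit_dist L \<phi> (u t)))"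
      using t by (intro SUP_upper) simp
    then have "ereal (orbit_dist L \<phi> (u t)) < ereal e" using sup by (rule le_less_trans)
    then obtain r where r: "Hs_norm 2 L (\<lambda>x. u t x - \<phi> (x + r)) < e"
      using orbit_dist_less by (metis less_ereal.simps(1))
    have H: "(\<lambda>x. u t x - \<phi> (x + r)) \<in> Hs_per 2 L"
      using Hs_per_2_diff[OF uH[OF t] \<phi>H[of "- r"]] by simp
    have "K * Hs_norm 2 L (\<lambda>x. u t x - \<phi> (x + r)) \<le> K * e" using r K by simp
    also have "K * e = \<rho> / 2" using K by (simp add: e_def)
    finally have le: "K * Hs_norm 2 L (\<lambda>x. u t x - \<phi> (x + r)) \<le> \<rho> / 2" .
    from K(2)[OF H] show ?thesis
    proof eventually_elim
      case (elim x)
      then show ?case using le small[of "x + r"] by linarith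
    qed
  qed
  have small': "\<bar>\<phi> z\<bar> \<le> \<rho>" for z using small[of z] \<rho> by linarith

  define V where "V t = 2 * (\<integral>x. (u t x - \<phi> (x - c * t)) \<partial>?M)\<^sup>2 / L
      - (\<integral>x. (u t x - \<phi> (x - c * t))\<^sup>2 \<partial>?M)" for t
  define r where "r = 2 * \<gamma> - (6 * \<kappa> + \<kappa>\<^sup>2)"
  have r: "r > 0" using \<kappa>(3) by (simp add: r_def)
  have growth: "exp (r * T) * V 0 \<le> V T" if "T > 0" for T
    unfolding V_def r_def
    by (rule perturbation_growth[OF L that f g \<phi> \<phi>1 \<phi>2 \<phi>3 per ode \<kappa>(1,2) f' g' sol[OF that] small'])
       (simp_all add: bound)
  have V0: "V 0 = L * \<delta>\<^sup>2"
  proof -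
    have um: "u 0 \<in> borel_measurable ?M" "\<phi> \<in> borel_measurable ?M"
      using sol[of 1] \<phi>H[of 0] by (auto simp: solution_on_def Hs_per_2_iff intro!: L2_per_measurable)
    have "(\<integral>x. u 0 x - \<phi> (x - c * 0) \<partial>?M) = (\<integral>x. \<delta> \<partial>?M)"
      using um u0 by (intro integral_cong_AE) (auto simp: \<psi>_def elim!: eventually_mono)
    moreover have "(\<integral>x. (u 0 x - \<phi> (x - c * 0))\<^sup>2 \<partial>?M) = (\<integral>x. \<delta>\<^sup>2 \<partial>?M)"
      using um u0 by (intro integral_cong_AE) (auto simp: \<psi>_def elim!: eventually_mono)
    ultimately show ?thesis
      using L measure_per_measure[of L] by (simp add: V_def power2_eq_square)
  qed
  \<comment> \<open>The translate close to \<open>u T\<close> need not be the one in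
    \<open>?w\<close>; the bound uses only that \<open>u T\<close> and the wave are each at most
    \<open>\<rho>\<close> in modulus.\<close>
  have V_le: "V T \<le> 4 * \<rho>\<^sup>2 * L" if T: "T > 0" for T
  proof -
    let ?w = "\<lambda>x. u T x - \<phi> (x - c * T)"
    have w: "?w \<in> L2_per L" using Hs_per_2_diff[OF uH[OF T] \<phi>H] by (simp add: Hs_per_2_iff)
    have "AE x in ?M. \<bar>?w x\<bar> \<le> 2 * \<rho>"
      using bound[OF T]
    proof eventually_elim
      case (elim x)
      then show ?case using small'[of "x - c * T"] by linarith
    qed
    then have "L2_norm L ?w \<le> sqrt L * (2 * \<rho>)"
      using L w \<rho> by (intro L2_norm_le_bound) (auto simp: L2_per_iff)
    then have "(L2_norm L ?w)\<^sup>2 \<le> (sqrt L * (2 * \<rho>))\<^sup>2"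
      by (intro power_mono L2_norm_nonneg)
    then have "(\<integral>x. (?w x)\<^sup>2 \<partial>?M) \<le> 4 * \<rho>\<^sup>2 * L"
      using L by (simp add: L2_norm_square power_mult_distrib mult.commute)
    moreover have "V T \<le> (\<integral>x. (?w x)\<^sup>2 \<partial>?M)"
      using mean_square_le[OF L w] by (simp add: V_def)
    ultimately show ?thesis by linarith
  qed
  \<comment> \<open>Chosen so that \<open>r * T * (L * \<delta>\<^sup>2)\<close> already equals the
    upper bound \<open>4 * \<rho>\<^sup>2 * L\<close>; the 1 in \<open>exp x \<ge> 1 + x\<close>
    then overshoots it by \<open>L * \<delta>\<^sup>2\<close>.\<close>
  define T where "T = 4 * \<rho>\<^sup>2 / (r * \<delta>\<^sup>2)"
  have T: "T > 0" using \<rho> r \<delta> by (simp add: T_def)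
  have "(1 + r * T) * (L * \<delta>\<^sup>2) \<le> exp (r * T) * (L * \<delta>\<^sup>2)"
    using L by (intro mult_right_mono exp_ge_add_one_self) simp
  also have "\<dots> \<le> 4 * \<rho>\<^sup>2 * L" using growth[OF T] V_le[OF T] V0 by simp
  finally have "(1 + r * T) * (L * \<delta>\<^sup>2) \<le> 4 * \<rho>\<^sup>2 * L" .
  moreover have "r * T * (L * \<delta>\<^sup>2) = 4 * \<rho>\<^sup>2 * L" using r \<delta> by (simp add: T_def)
  ultimately have "L * \<delta>\<^sup>2 \<le> 0" by (simp add: distrib_right)
  then show False using L \<delta> by (simp add: mult_le_0_iff)
qed

lemma continuous_close_at_0:
  fixes h :: "real \<Rightarrow> real"
  assumes "continuous_on UNIV h" "0 < \<kappa>"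
  obtains \<rho> where "0 < \<rho>" "\<And>z. \<bar>z\<bar> \<le> \<rho> \<Longrightarrow> \<bar>h z - h 0\<bar> \<le> \<kappa>"
proof -
  obtain d where d: "d > 0" "\<And>z. dist z 0 < d \<Longrightarrow> dist (h z) (h 0) < \<kappa>"
    using assms unfolding continuous_on_iff by (metis UNIV_I)
  have "\<bar>h z - h 0\<bar> \<le> \<kappa>" if "\<bar>z\<bar> \<le> d / 2" for z
    using d(2)[of z] d(1) that by (simp add: dist_real_def)
  then show thesis using that[of "d / 2"] d(1) by simp
qed

text \<open>The tolerance \<open>\<kappa>\<close> has to be fixed before \<open>\<epsilon>\<close>,
  because it determines how small the wave must be; yet the Poincare constant that limits
  \<open>\<kappa>\<close> depends on \<open>L \<epsilon>\<close>. The asymptotics of the period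
  resolve this: they bound \<open>L \<epsilon>\<close> uniformly, and so bound the Poincare constant
  from below.\<close>

theorem theorem5p6:
  fixes f g :: "real \<Rightarrow> real"
    and \<epsilon>\<^sub>0 :: real
    and \<phi> :: "real \<Rightarrow> real \<Rightarrow> real"
    and c L :: "real \<Rightarrow> real"
  assumes A1: "Ck 4 f"
    and A2: "Ck 3 g" "g 0 = 0" "g 1 = 0" "deriv g 0 > 0" "deriv g 1 < 0"
      "\<And>u. 0 < u \<Longrightarrow> u < 1 \<Longrightarrow> g u > 0"
      "\<And>u. u < 0 \<Longrightarrow> g u < 0"
    and A3: "\<exists>ustar<0. integral {ustar..0} g + integral {0..1} g = 0"
    and A4: "a0_bar f g \<noteq> 0"
    and eps0: "\<epsilon>\<^sub>0 > 0"
    and waves: "small_amplitude_waves f g \<epsilon>\<^sub>0 \<phi> c L"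
  shows "\<exists>\<epsilon>\<^sub>1. 0 < \<epsilon>\<^sub>1 \<and> \<epsilon>\<^sub>1 < \<epsilon>\<^sub>0 \<and>
           (\<forall>\<epsilon>. 0 < \<epsilon> \<and> \<epsilon> < \<epsilon>\<^sub>1 \<longrightarrow> orbitally_unstable f g (L \<epsilon>) (\<phi> \<epsilon>))"
proof -
  define \<gamma> where "\<gamma> = deriv g 0"
  have \<gamma>: "\<gamma> > 0" using A2(4) by (simp add: \<gamma>_def)
  have f: "(f has_real_derivative deriv f z) (at z)" "continuous_on UNIV (deriv f)" for z
    using A1 Ck_Suc[of 3 f] Ck_continuous by (auto simp: eval_nat_numeral)
  have g: "(g has_real_derivative deriv g z) (at z)" "continuous_on UNIV (deriv g)" for z
    using A2(1) Ck_Suc[of 2 g] Ck_continuous by (auto simp: eval_nat_numeral)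
  define Lmax where "Lmax = 2 * pi / sqrt \<gamma> + 1"
  have Lmax: "Lmax > 0" using \<gamma> by (simp add: Lmax_def add_pos_pos)
  \<comment> \<open>The admissible size of the total loss: the first entry leaves a growth rate of
    at least \<open>\<gamma>\<close>, the second is half the Poincare constant of the longest period
    allowed.\<close>
  define p where "p = min \<gamma> ((2 * pi / Lmax)\<^sup>2 / 2)"
  have p_le: "p \<le> \<gamma>" "p \<le> (2 * pi / Lmax)\<^sup>2 / 2" by (simp_all add: p_def)
  have p: "p > 0" using \<gamma> Lmax by (simp add: p_def)
  \<comment> \<open>For \<open>\<kappa> \<le> 1\<close> the loss
    \<open>6 * \<kappa> + \<kappa>\<^sup>2\<close> is at most \<open>7 * \<kappa>\<close>, hence at
    most \<open>p\<close>.\<close>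
  define \<kappa> where "\<kappa> = min 1 (p / 7)"
  have \<kappa>: "\<kappa> > 0" "\<kappa> \<le> 1" "\<kappa> \<le> p / 7" using p by (auto simp: \<kappa>_def)
  have "\<kappa>\<^sup>2 \<le> \<kappa>" using \<kappa> by (simp add: power2_eq_square mult_left_le)
  then have \<kappa>p: "6 * \<kappa> + \<kappa>\<^sup>2 \<le> p" using \<kappa>(3) by linarith
  obtain \<rho>1 where \<rho>1: "0 < \<rho>1" "\<And>z. \<bar>z\<bar> \<le> \<rho>1 \<Longrightarrow> \<bar>deriv f z - deriv f 0\<bar> \<le> \<kappa>"
    using continuous_close_at_0[OF f(2) \<kappa>(1)] by blast
  obtain \<rho>2 where \<rho>2: "0 < \<rho>2" "\<And>z. \<bar>z\<bar> \<le> \<rho>2 \<Longrightarrow> \<bar>deriv g z - deriv g 0\<bar> \<le> \<kappa>"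
    using continuous_close_at_0[OF g(2) \<kappa>(1)] by blast
  define \<rho> where "\<rho> = min \<rho>1 \<rho>2"
  have \<rho>: "\<rho> > 0" using \<rho>1 \<rho>2 by (simp add: \<rho>_def)

  obtain C where C: "C > 0" "\<And>\<epsilon> x. 0 < \<epsilon> \<Longrightarrow> \<epsilon> < \<epsilon>\<^sub>0 \<Longrightarrow> \<bar>\<phi> \<epsilon> x\<bar> \<le> C * sqrt \<epsilon>"
    using waves unfolding small_amplitude_waves_def by blast
  have "(\<lambda>\<epsilon>. L \<epsilon> - 2 * pi / sqrt \<gamma>) \<in> O[at_right 0](\<lambda>\<epsilon>. \<epsilon>)"
    using waves unfolding small_amplitude_waves_def \<gamma>_def by blast
  then obtain D where D: "D > 0"
    "\<forall>\<^sub>F \<epsilon> in at_right 0. norm (L \<epsilon> - 2 * pi / sqrt \<gamma>) \<le> D * norm \<epsilon>"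
    by (rule landau_o.bigE)
  then obtain b where b: "b > 0" "\<And>\<epsilon>. 0 < \<epsilon> \<Longrightarrow> \<epsilon> < b \<Longrightarrow> \<bar>L \<epsilon> - 2 * pi / sqrt \<gamma>\<bar> \<le> D * \<epsilon>"
    unfolding eventually_at_right_field by auto
  \<comment> \<open>In order: strictly below \<open>\<epsilon>\<^sub>0\<close>; inside the range of
    the asymptotic estimate; deviation of the period at most 1, so that
    \<open>L \<epsilon> \<le> Lmax\<close>; amplitude \<open>C * sqrt \<epsilon>\<close> at most
    \<open>\<rho> / 2\<close>.\<close>
  define \<epsilon>\<^sub>1 where "\<epsilon>\<^sub>1 = Min {\<epsilon>\<^sub>0 / 2, b, 1 / D, (\<rho> / (2 * C))\<^sup>2}"
  have \<epsilon>1: "\<epsilon>\<^sub>1 > 0" "\<epsilon>\<^sub>1 \<le> \<epsilon>\<^sub>0 / 2" "\<epsilon>\<^sub>1 \<le> b" "\<epsilon>\<^sub>1 \<le> 1 / D" "\<epsilon>\<^sub>1 \<le> (\<rho> / (2 * C))\<^sup>2"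
    using eps0 b(1) D(1) \<rho> C(1) by (auto simp: \<epsilon>\<^sub>1_def)
  have "orbitally_unstable f g (L \<epsilon>) (\<phi> \<epsilon>)" if \<epsilon>: "0 < \<epsilon>" "\<epsilon> < \<epsilon>\<^sub>1" for \<epsilon>
  proof -
    have \<epsilon>': "\<epsilon> < \<epsilon>\<^sub>0" using \<epsilon> \<epsilon>1(2) eps0 by linarith
    then have wave: "Ck 3 (\<phi> \<epsilon>)" "fundamental_period (L \<epsilon>) (\<phi> \<epsilon>)"
      "classical_solution f g (\<lambda>x t. \<phi> \<epsilon> (x - c \<epsilon> * t))"
      using waves \<epsilon>(1) unfolding small_amplitude_waves_def by blast+
    have Lpos: "L \<epsilon> > 0" and per: "periodic (L \<epsilon>) (\<phi> \<epsilon>)"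
      using wave(2) by (auto simp: fundamental_period_def)
    have "D * \<epsilon> \<le> D * (1 / D)" using \<epsilon> \<epsilon>1(4) D(1) by (intro mult_left_mono) auto
    then have "\<bar>L \<epsilon> - 2 * pi / sqrt \<gamma>\<bar> \<le> 1" using b(2)[of \<epsilon>] \<epsilon> \<epsilon>1(3) D(1) by simp
    then have "L \<epsilon> \<le> Lmax" by (simp add: Lmax_def)
    then have Lmax_le: "(2 * pi / Lmax)\<^sup>2 \<le> (2 * pi / L \<epsilon>)\<^sup>2"
      using Lpos Lmax by (intro power_mono divide_left_mono) auto
    have "2 * (6 * \<kappa> + \<kappa>\<^sup>2) \<le> 2 * p" using \<kappa>p by (rule mult_left_mono) simp
    also have "\<dots> \<le> (2 * pi / Lmax)\<^sup>2" using p_le(2) by (simp only: le_divide_eq_numeral1 mult.commute)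
    also note Lmax_le
    finally have \<kappa>L: "2 * (6 * \<kappa> + \<kappa>\<^sup>2) \<le> (2 * pi / L \<epsilon>)\<^sup>2" .
    have \<kappa>\<gamma>: "6 * \<kappa> + \<kappa>\<^sup>2 < 2 * \<gamma>" using \<kappa>p p_le \<gamma> by linarith
    define p1 where "p1 = deriv (\<phi> \<epsilon>)"
    define p2 where "p2 = deriv p1"
    have c2: "Ck 2 p1" and d0: "(\<phi> \<epsilon> has_real_derivative p1 z) (at z)" for z
      using Ck_Suc[of 2 "\<phi> \<epsilon>"] wave(1) by (auto simp: p1_def eval_nat_numeral)
    have c1: "Ck 1 p2" and d1: "(p1 has_real_derivative p2 z) (at z)" for z
      using Ck_Suc[of 1 p1] c2 by (auto simp: p2_def eval_nat_numeral)
    have c0: "Ck 0 (deriv p2)" and d2: "(p2 has_real_derivative deriv p2 z) (at z)" for z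
      using Ck_Suc[of 0 p2] c1 by auto
    \<comment> \<open>The equation at time 0 already gives the profile equation, because
      \<open>z\<close> ranges over the whole line.\<close>
    have ode: "- c \<epsilon> * p1 z + deriv f (\<phi> \<epsilon> z) * p1 z = p2 z + g (\<phi> \<epsilon> z)" for z
    proof -
      have "deriv (\<lambda>t. \<phi> \<epsilon> (z - c \<epsilon> * t)) 0 = - c \<epsilon> * p1 z"
      proof (rule DERIV_imp_deriv)
        have "((\<lambda>t. z - c \<epsilon> * t) has_real_derivative - c \<epsilon>) (at 0)"
          by (auto intro!: derivative_eq_intros)
        from DERIV_chain2[OF _ this, of "\<phi> \<epsilon>" "p1 z"] d0[of z]
        show "((\<lambda>t. \<phi> \<epsilon> (z - c \<epsilon> * t)) has_real_derivative - c \<epsilon> * p1 z) (at 0)"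
          by (simp add: mult.commute)
      qed
      moreover have "deriv (\<lambda>y. f (\<phi> \<epsilon> y)) z = deriv f (\<phi> \<epsilon> z) * p1 z"
        by (intro DERIV_imp_deriv DERIV_chain2[OF f(1) d0])
      moreover have "(deriv ^^ 2) (\<phi> \<epsilon>) z = p2 z" by (simp add: eval_nat_numeral p1_def p2_def)
      ultimately show ?thesis
        using wave(3)[unfolded classical_solution_def, rule_format, where x=z and t=0] by simp
    qed
    have "\<bar>\<phi> \<epsilon> z\<bar> \<le> \<rho> / 2" for z
    proof -
      have "sqrt \<epsilon> \<le> sqrt ((\<rho> / (2 * C))\<^sup>2)" using \<epsilon> \<epsilon>1(5) by (intro real_sqrt_le_mono) linarith
      also have "\<dots> = \<rho> / (2 * C)" using \<rho> C(1) by simp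
      finally have "C * sqrt \<epsilon> \<le> C * (\<rho> / (2 * C))" using C(1) by (intro mult_left_mono) auto
      then show ?thesis using C(2)[OF \<epsilon>(1) \<epsilon>', of z] C(1) by simp
    qed
    then show ?thesis
      using \<rho>1(2) \<rho>2(2) \<kappa>(1) \<rho>
      by (intro orbitally_unstable_of_small_wave[OF Lpos f g(1) d0 d1 d2 Ck_continuous[OF c0] per ode _ \<kappa>L \<kappa>\<gamma>,
            where a="deriv f 0" and \<rho>=\<rho>]) (auto simp: \<rho>_def \<gamma>_def)
  qed
  moreover have "\<epsilon>\<^sub>1 < \<epsilon>\<^sub>0" using \<epsilon>1(2) eps0 by linarith
  ultimately show ?thesis using \<epsilon>1(1) by blast
qed

end
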